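(* Let $X_t,Y_t$ be symmetric Lévy processes in $\mathbb{R}^d$ with triplets $(0,\nu^X,0)$, $(0,\nu^Y,0)$ (nonzero) and bounded transition densities, let $D$ be a bounded open set, and suppose $\sigma=\nu^X-\nu^Y$ is a nonnegative finite measure. Suppose that $X$ or $Y$ satisfies Property A on $D$. Then there is a constant $C=C(\sigma,D)$ such that for every $x\in D$, \[G^Y_D(x,y)\le C\,G^X_D(x,y)\quad\text{for a.e. } y.\]
   Context: For a process $X$ with transition density $p(t,x,y)=p(t,y-x)$: $\tau_D=\inf\{t>0:X_t\notin D\}$; $p_D(t,x,y)=p(t,x,y)-E^x[t\ge\tau_D;\,p(t-\tau_D,X_{\tau_D},y)]$; Green function $G_D(x,y)=\int_0^\infty p_D(t,x,y)dt$. Property A for a process on $D$: there is a constant $c=c(D)$ such that $E^x\tau_D\,E^y\tau_D\le c\,G_D(x,y)$ for all $x,y\in D$.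
   Formalization: The constant C is allowed to depend on the processes X and Y (e.g. through the Property A constant and the density bound), not on σ and D alone; uniformity over all X, Y with the same σ and D fails, e.g. for ν^Y = ε times a stable Lévy measure as ε→0. *)

theory Defs
  imports "HOL-Probability.Probability"
begin

definition cadlag_path :: "(real \<Rightarrow> 'a::metric_space) \<Rightarrow> bool" where
  "cadlag_path f \<longleftrightarrow> (\<forall>t\<ge>0. continuous (at_right t) f) \<and> (\<forall>t>0. \<exists>l. (f \<longlongrightarrow> l) (at_left t))"

text \<open>A Levy process started at 0, realised on a complete probability space.
  The process started at x is x + X t.\<close>
definition levy_process :: "'b measure \<Rightarrow> (real \<Rightarrow> 'b \<Rightarrow> 'a::euclidean_space) \<Rightarrow> bool" where
  "levy_process M X \<longleftrightarrow> prob_space M \<and> complete_measure M \<and>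
     (\<forall>t\<ge>0. X t \<in> borel_measurable M) \<and>
     (\<forall>\<omega>\<in>space M. X 0 \<omega> = 0 \<and> cadlag_path (\<lambda>t. X t \<omega>)) \<and>
     (\<forall>(n::nat) (s::nat \<Rightarrow> real). 0 \<le> s 0 \<and> (\<forall>i<n. s i \<le> s (Suc i)) \<longrightarrow>
        prob_space.indep_vars M (\<lambda>_. borel) (\<lambda>i \<omega>. X (s (Suc i)) \<omega> - X (s i) \<omega>) {..<n}) \<and>
     (\<forall>s t. 0 \<le> s \<and> s \<le> t \<longrightarrow> distr M borel (\<lambda>\<omega>. X t \<omega> - X s \<omega>) = distr M borel (X (t - s)))"

definition symmetric_levy_measure :: "'a::euclidean_space measure \<Rightarrow> bool" where
  "symmetric_levy_measure \<nu> \<longleftrightarrow> sets \<nu> = sets borel \<and> emeasure \<nu> {0} = 0 \<and>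
     (\<integral>\<^sup>+z. ennreal (min 1 (norm z ^ 2)) \<partial>\<nu>) < \<infinity> \<and>
     (\<forall>A\<in>sets borel. emeasure \<nu> (uminus ` A) = emeasure \<nu> A)"

definition levy_exponent :: "'a::euclidean_space measure \<Rightarrow> 'a \<Rightarrow> real" where
  "levy_exponent \<nu> \<xi> = (\<integral>z. (1 - cos (\<xi> \<bullet> z)) \<partial>\<nu>)"

definition has_triplet_0_nu_0 :: "'b measure \<Rightarrow> (real \<Rightarrow> 'b \<Rightarrow> 'a::euclidean_space) \<Rightarrow> 'a measure \<Rightarrow> bool" where
  "has_triplet_0_nu_0 M X \<nu> \<longleftrightarrow> symmetric_levy_measure \<nu> \<and>
     (\<forall>t\<ge>0. \<forall>\<xi>. (\<integral>\<omega>. cis (\<xi> \<bullet> X t \<omega>) \<partial>M) = complex_of_real (exp (- t * levy_exponent \<nu> \<xi>)))"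

text \<open>p t is a bounded (jointly measurable) density of X t for every t > 0;
  the transition density is p(t,x,y) = p t (y - x).\<close>
definition bounded_transition_density :: "'b measure \<Rightarrow> (real \<Rightarrow> 'b \<Rightarrow> 'a::euclidean_space) \<Rightarrow> (real \<Rightarrow> 'a \<Rightarrow> real) \<Rightarrow> bool" where
  "bounded_transition_density M X p \<longleftrightarrow> (\<lambda>(t, z). p t z) \<in> borel_measurable borel \<and>
     (\<forall>t>0. (\<forall>z. 0 \<le> p t z) \<and> (\<exists>B. \<forall>z. p t z \<le> B) \<and>
        distr M borel (X t) = density lborel (\<lambda>z. ennreal (p t z)))"

text \<open>First exit time from D for the process started at x (= oo if it never exits).\<close>
definition exit_time :: "(real \<Rightarrow> 'b \<Rightarrow> 'a::euclidean_space) \<Rightarrow> 'a set \<Rightarrow> 'a \<Rightarrow> 'b \<Rightarrow> ennreal" where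
  "exit_time X D x \<omega> = Inf (ennreal ` {t. 0 < t \<and> x + X t \<omega> \<notin> D})"

definition expected_exit :: "'b measure \<Rightarrow> (real \<Rightarrow> 'b \<Rightarrow> 'a::euclidean_space) \<Rightarrow> 'a set \<Rightarrow> 'a \<Rightarrow> ennreal" where
  "expected_exit M X D x = (\<integral>\<^sup>+\<omega>. exit_time X D x \<omega> \<partial>M)"

definition killed_density :: "'b measure \<Rightarrow> (real \<Rightarrow> 'b \<Rightarrow> 'a::euclidean_space) \<Rightarrow> (real \<Rightarrow> 'a \<Rightarrow> real)
    \<Rightarrow> 'a set \<Rightarrow> real \<Rightarrow> 'a \<Rightarrow> 'a \<Rightarrow> real" where
  "killed_density M X p D t x y = p t (y - x) -
     (\<integral>\<omega>. (if exit_time X D x \<omega> \<le> ennreal t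
            then p (t - enn2real (exit_time X D x \<omega>)) (y - (x + X (enn2real (exit_time X D x \<omega>)) \<omega>))
            else 0) \<partial>M)"

definition green :: "'b measure \<Rightarrow> (real \<Rightarrow> 'b \<Rightarrow> 'a::euclidean_space) \<Rightarrow> (real \<Rightarrow> 'a \<Rightarrow> real)
    \<Rightarrow> 'a set \<Rightarrow> 'a \<Rightarrow> 'a \<Rightarrow> ennreal" where
  "green M X p D x y = (\<integral>\<^sup>+t\<in>{0<..}. ennreal (killed_density M X p D t x y) \<partial>lborel)"

definition property_A :: "'b measure \<Rightarrow> (real \<Rightarrow> 'b \<Rightarrow> 'a::euclidean_space) \<Rightarrow> (real \<Rightarrow> 'a \<Rightarrow> real) \<Rightarrow> 'a set \<Rightarrow> bool" where
  "property_A M X p D \<longleftrightarrow> (\<exists>c::real. \<forall>x\<in>D. \<forall>y\<in>D.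
     expected_exit M X D x * expected_exit M X D y \<le> ennreal c * green M X p D x y)"

end

theory Submission
  imports Defs
begin

text \<open>
  Let \<open>\<lambda> = \<sigma>(\<real>\<^sup>d)\<close>. Since \<open>\<psi>\<^sup>X = \<psi>\<^sup>Y + \<lambda> - \<integral> cos (u \<bullet> z) d\<sigma>\<close>, expanding the exponential of
  \<open>t \<integral> cos (u \<bullet> z) d\<sigma>\<close> and testing against Gaussians shows that the law of \<open>Y\<^sub>t\<close> is at most
  \<open>e\<^bsup>\<lambda>t\<^esup>\<close> times the law of \<open>X\<^sub>t\<close>. Applied to the increments along finer and finer grids this gives
  \<open>p\<^sub>D\<^sup>Y(t,x,\<cdot>) \<le> e\<^bsup>\<lambda>t\<^esup> p\<^sub>D\<^sup>X(t,x,\<cdot>)\<close> almost everywhere. For large times, symmetry and the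
  semigroup property yield \<open>p\<^sub>D\<^sup>Y(3s,x,y) \<le> B P\<^sup>x(\<tau> > s) P\<^sup>y(\<tau> > s) \<le> B s\<^bsup>-2\<^esup> E\<^sup>x\<tau> E\<^sup>y\<tau>\<close>, so that
  \<open>G\<^sup>Y(x,y) \<le> e\<^bsup>\<lambda>r\<^esup> G\<^sup>X(x,y) + (9B/r) E\<^sup>x\<tau>\<^sup>Y E\<^sup>y\<tau>\<^sup>Y\<close> for \<open>r \<ge> 3\<close>. If \<open>Y\<close> has Property A, the last term is
  absorbed into \<open>G\<^sup>Y\<close> for large \<open>r\<close>; if \<open>X\<close> has it, one uses \<open>E\<^sup>x\<tau>\<^sup>Y \<le> C E\<^sup>x\<tau>\<^sup>X\<close>.

  The killed density is defined through the exit time itself. That it integrates to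
  \<open>P\<^sup>x(X\<^sub>t \<in> A, t < \<tau>)\<close> for almost every \<open>t\<close> is the strong Markov property, and that \<open>\<tau>\<close> is the limit
  of the exit times from closed sets exhausting \<open>D\<close> is quasi-left-continuity.
\<close>

section \<open>Domination of measures from characteristic functions\<close>

text \<open>In probabilistic terms, X is Y plus an independent compound Poisson process with jump
  measure \<sigma>, and \<open>exp (- \<lambda> * t)\<close> is the probability that the latter has
  not jumped by time t. The two processes are given on unrelated probability spaces and are linked
  only through their laws, so a positivity argument on characteristic functions takes the place of
  this decomposition. The densities are fixed only almost everywhere in space, with no pointwise
  regularity or symmetry, so semigroup identities for the killed density cannot be evaluated at
  points. All estimates are therefore made for operators on a time grid, passed to the killed
  semigroup \<open>Q\<close>, and compared with the killed density only through integrals over Borel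
  sets. The exit time is an infimum over uncountably many times and not visibly measurable. It is
  replaced by \<open>D_exit\<close>, built from countable infima and suprema; the two agree almost
  surely, and completeness of the probability space transfers measurability.\<close>

lemma gaussian_char_measure:
  obtains \<gamma> :: "'a::euclidean_space measure"
  where "prob_space \<gamma>" "sets \<gamma> = sets borel"
    "\<And>v. (\<integral>u. cos (u \<bullet> v) \<partial>\<gamma>) = exp (- (norm v)\<^sup>2 / 2)"
proof -
  interpret N: real_distribution std_normal_distribution by (rule real_dist_normal_dist)
  interpret P: product_prob_space "\<lambda>_::'a. std_normal_distribution" Basis
    by (simp add: product_prob_space_def product_prob_space_axioms_def product_sigma_finite_def
        N.prob_space_axioms N.sigma_finite_measure_axioms)
  \<comment> \<open>\<open>e\<close> reassembles a vector from its coordinates: the Gaussian is an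
    image of a product of one-dimensional normal laws, so its characteristic function
    factors.\<close>
  define e where "e f = (\<Sum>b\<in>Basis. f b *\<^sub>R b)" for f :: "'a \<Rightarrow> real"
  let ?P = "PiM (Basis::'a set) (\<lambda>_. std_normal_distribution)"
  have e[measurable]: "e \<in> borel_measurable ?P"
    unfolding e_def by measurable
  define \<gamma> where "\<gamma> = distr ?P borel e"
  have 1: "prob_space \<gamma>" unfolding \<gamma>_def by (rule P.prob_space_distr) (rule e)
  have 3: "(\<integral>u. cos (u \<bullet> v) \<partial>\<gamma>) = exp (- (norm v)\<^sup>2 / 2)" for v :: 'a
  proof -
    have cis_sum: "(\<Prod>b\<in>Basis. iexp ((v \<bullet> b) * f b)) = cis (e f \<bullet> v)" for f
    proof -
      have "(\<Prod>b\<in>Basis. iexp ((v \<bullet> b) * f b)) = exp (\<Sum>b\<in>Basis. \<i> * complex_of_real ((v \<bullet> b) * f b))"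
        by (simp add: exp_sum)
      also have "(\<Sum>b\<in>Basis. \<i> * complex_of_real ((v \<bullet> b) * f b)) = \<i> * complex_of_real (e f \<bullet> v)"
        by (simp add: e_def inner_sum_left sum_distrib_left inner_commute[of v] mult.commute)
      finally show ?thesis by (simp add: cis_conv_exp)
    qed
    have "(\<integral>u. cis (u \<bullet> v) \<partial>\<gamma>) = (\<integral>f. cis (e f \<bullet> v) \<partial>?P)"
      unfolding \<gamma>_def by (subst integral_distr) (auto simp: cis_conv_exp)
    also have "\<dots> = (\<integral>f. (\<Prod>b\<in>Basis. iexp ((v \<bullet> b) * f b)) \<partial>?P)"
      by (simp only: cis_sum)
    also have "\<dots> = (\<Prod>b\<in>Basis. (\<integral>x. iexp ((v \<bullet> b) * x) \<partial>std_normal_distribution))"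
      by (rule P.product_integral_prod) (auto intro!: N.integrable_iexp)
    also have "\<dots> = (\<Prod>b\<in>Basis. complex_of_real (exp (- (v \<bullet> b)\<^sup>2 / 2)))"
      using char_std_normal_distribution by (auto simp: char_def fun_eq_iff)
    also have "\<dots> = complex_of_real (exp (\<Sum>b\<in>Basis. - (v \<bullet> b)\<^sup>2 / 2))"
      by (simp add: exp_sum)
    also have "(\<Sum>b\<in>Basis. - (v \<bullet> b)\<^sup>2 / 2) = - (norm v)\<^sup>2 / 2"
      unfolding power2_norm_eq_inner euclidean_inner[of v v]
      by (simp add: sum_negf sum_divide_distrib power2_eq_square)
    finally have *: "(\<integral>u. cis (u \<bullet> v) \<partial>\<gamma>) = complex_of_real (exp (- (norm v)\<^sup>2 / 2))" .
    have "integrable \<gamma> (\<lambda>u. cis (u \<bullet> v))"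
      by (rule finite_measure.integrable_const_bound[where B=1])
        (use 1 in \<open>auto simp: prob_space_def \<gamma>_def cis_conv_exp\<close>)
    then have "(\<integral>u. Re (cis (u \<bullet> v)) \<partial>\<gamma>) = Re (\<integral>u. cis (u \<bullet> v) \<partial>\<gamma>)"
      by (rule integral_Re)
    with * show ?thesis by simp
  qed
  show thesis
    by (rule that[OF 1 _ 3]) (simp add: \<gamma>_def)
qed

lemma nn_integral_gaussian_finite:
  "(\<integral>\<^sup>+x. ennreal (exp (- (norm (x::'a::euclidean_space))\<^sup>2 / 2)) \<partial>lborel) < \<infinity>"
proof -
  have "(\<integral>\<^sup>+x. ennreal (exp (- x\<^sup>2 / 2)) \<partial>lborel) < (\<infinity>::ennreal)"
  proof -
    have "ennreal (exp (- x\<^sup>2 / 2)) = ennreal (sqrt (2*pi)) * ennreal (std_normal_density x)" for x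
      by (simp add: std_normal_density_def ennreal_mult[symmetric])
    moreover have "(\<integral>\<^sup>+x. ennreal (std_normal_density x) \<partial>lborel) = 1"
      using prob_space.emeasure_space_1[OF prob_space_normal_density[of 1 0]]
      by (simp add: emeasure_density)
    ultimately show ?thesis
      by (simp add: nn_integral_cmult)
  qed
  moreover have "(\<integral>\<^sup>+x. ennreal (exp (- (norm (x::'a))\<^sup>2 / 2)) \<partial>lborel) =
     (\<integral>\<^sup>+x. (\<Prod>b\<in>Basis. ennreal (exp (- (x \<bullet> b)\<^sup>2 / 2))) \<partial>(lborel::'a measure))"
  proof (intro nn_integral_cong)
    fix x :: 'a
    have "- (norm x)\<^sup>2 / 2 = (\<Sum>b\<in>Basis. - (x \<bullet> b)\<^sup>2 / 2)"
      unfolding power2_norm_eq_inner euclidean_inner[of x x]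
      by (simp add: sum_negf sum_divide_distrib power2_eq_square)
    then show "ennreal (exp (- (norm x)\<^sup>2 / 2)) = (\<Prod>b\<in>Basis. ennreal (exp (- (x \<bullet> b)\<^sup>2 / 2)))"
      by (simp add: exp_sum prod_ennreal)
  qed
  ultimately show ?thesis
    by (subst (asm) nn_integral_lborel_prod) (auto simp: power_less_top_ennreal)
qed

lemma integrable_bounded_finite_measure:
  fixes f :: "'a \<Rightarrow> real"
  assumes "finite_measure M" "f \<in> borel_measurable M" "\<And>x. \<bar>f x\<bar> \<le> B"
  shows "integrable M f"
  by (rule finite_measure.integrable_const_bound[where B=B]) (use assms in auto)

text \<open>Multiplying by the cosine transform of \<sigma> amounts to averaging over shifts by
  \<open>z\<close> and \<open>- z\<close>, which preserves positivity. As the transform of \<gamma>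
  is nonnegative, so is every \<open>S n\<close>, and each term in the power series of
  \<open>exp (t * s u)\<close> contributes a nonnegative amount; the term \<open>n = 0\<close> alone
  is the left side.\<close>

lemma fourier_kernel_domination:
  fixes \<mu>1 \<mu>2 \<sigma> \<gamma> :: "'a::euclidean_space measure" and c t :: real and a :: 'a
  assumes fin: "finite_measure \<mu>1" "finite_measure \<mu>2" "finite_measure \<sigma>" "finite_measure \<gamma>"
    and sets[measurable_cong]: "sets \<mu>1 = sets borel" "sets \<mu>2 = sets borel" "sets \<sigma> = sets borel" "sets \<gamma> = sets borel"
    and t: "t \<ge> 0"
    and char: "\<And>u \<theta>. c * (\<integral>x. cos (u \<bullet> x + \<theta>) \<partial>\<mu>2) =
      exp (t * (\<integral>z. cos (u \<bullet> z) \<partial>\<sigma>)) * (\<integral>x. cos (u \<bullet> x + \<theta>) \<partial>\<mu>1)"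
    and pos: "\<And>x. 0 \<le> (\<integral>u. cos (u \<bullet> x) \<partial>\<gamma>)"
  shows "(\<integral>x. (\<integral>u. cos (u \<bullet> (x - a)) \<partial>\<gamma>) \<partial>\<mu>1) \<le> c * (\<integral>x. (\<integral>u. cos (u \<bullet> (x - a)) \<partial>\<gamma>) \<partial>\<mu>2)"
proof -
  interpret m1: finite_measure \<mu>1 by fact
  interpret m2: finite_measure \<mu>2 by fact
  interpret s: finite_measure \<sigma> by fact
  interpret g: finite_measure \<gamma> by fact
  interpret g1: pair_sigma_finite \<gamma> \<mu>1 ..
  interpret g2: pair_sigma_finite \<gamma> \<mu>2 ..
  interpret gs: pair_sigma_finite \<gamma> \<sigma> ..
  interpret G1: finite_measure "\<gamma> \<Otimes>\<^sub>M \<mu>1" by (rule finite_measure_pair_measure) fact+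
  interpret G2: finite_measure "\<gamma> \<Otimes>\<^sub>M \<mu>2" by (rule finite_measure_pair_measure) fact+
  interpret GS: finite_measure "\<gamma> \<Otimes>\<^sub>M \<sigma>" by (rule finite_measure_pair_measure) fact+
  define s where "s u = (\<integral>z. cos (u \<bullet> z) \<partial>\<sigma>)" for u
  have s_meas[measurable]: "s \<in> borel_measurable borel"
    unfolding s_def by measurable
  define L where "L = measure \<sigma> (space \<sigma>)"
  have L: "0 \<le> L" by (simp add: L_def)
  have s_bd: "\<bar>s u\<bar> \<le> L" for u
  proof -
    have "\<bar>s u\<bar> \<le> (\<integral>z. \<bar>cos (u \<bullet> z)\<bar> \<partial>\<sigma>)" unfolding s_def by (rule integral_abs_bound)
    also have "\<dots> \<le> (\<integral>z. 1 \<partial>\<sigma>)"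
      by (intro integral_mono integrable_bounded_finite_measure[where B=1] fin) auto
    finally show ?thesis by (simp add: L_def)
  qed
  have sn_bd: "\<bar>w * s u ^ n\<bar> \<le> L ^ n" if "\<bar>w\<bar> \<le> 1" for w u n
  proof -
    have "\<bar>w * s u ^ n\<bar> = \<bar>w\<bar> * \<bar>s u\<bar> ^ n" by (simp add: abs_mult power_abs)
    also have "\<dots> \<le> 1 * L ^ n" by (intro mult_mono that power_mono s_bd) auto
    finally show ?thesis by simp
  qed
  define S where "S n x = (\<integral>u. cos (u \<bullet> x) * s u ^ n \<partial>\<gamma>)" for n x
  have S_meas[measurable]: "S n \<in> borel_measurable borel" for n
    unfolding S_def by measurable
  have S_nonneg: "0 \<le> S n x" for n x
  proof (induction n arbitrary: x)
    case 0 then show ?case using pos by (simp add: S_def)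
  next
    case (Suc n)
    have "S (Suc n) x = (\<integral>u. (\<integral>z. cos (u \<bullet> x) * s u ^ n * cos (u \<bullet> z) \<partial>\<sigma>) \<partial>\<gamma>)"
      unfolding S_def by (intro Bochner_Integration.integral_cong refl) (simp add: s_def mult.assoc mult.commute)
    also have "\<dots> = (\<integral>z. (\<integral>u. cos (u \<bullet> x) * s u ^ n * cos (u \<bullet> z) \<partial>\<gamma>) \<partial>\<sigma>)"
    proof (rule gs.Fubini_integral[symmetric])
      have "\<bar>cos (u \<bullet> x) * s u ^ n * cos (u \<bullet> z)\<bar> \<le> L ^ n" for u z
      proof -
        have "\<bar>cos (u \<bullet> x) * s u ^ n * cos (u \<bullet> z)\<bar> = \<bar>(cos (u \<bullet> x) * cos (u \<bullet> z)) * s u ^ n\<bar>"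
          by (simp add: mult_ac)
        also have "\<dots> \<le> L ^ n"
          by (rule sn_bd) (auto simp: abs_mult intro!: mult_le_one)
        finally show ?thesis .
      qed
      then show "integrable (\<gamma> \<Otimes>\<^sub>M \<sigma>) (\<lambda>(u, z). cos (u \<bullet> x) * s u ^ n * cos (u \<bullet> z))"
        by (intro integrable_bounded_finite_measure[where B="L ^ n"] GS.finite_measure_axioms) auto
    qed
    \<comment> \<open>Product-to-sum: \<open>cos (u \<bullet> x) * cos (u \<bullet> z)\<close> is
      the mean of the cosines at \<open>x + z\<close> and \<open>x - z\<close>.\<close>
    also have "\<dots> = (\<integral>z. (S n (x + z) + S n (x - z)) / 2 \<partial>\<sigma>)"
    proof (intro Bochner_Integration.integral_cong refl)
      fix z
      have int: "integrable \<gamma> (\<lambda>u. cos (u \<bullet> y) * s u ^ n)" for y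
        by (intro integrable_bounded_finite_measure[where B="L ^ n"] fin sn_bd) auto
      have "(\<integral>u. cos (u \<bullet> x) * s u ^ n * cos (u \<bullet> z) \<partial>\<gamma>)
        = (\<integral>u. (cos (u \<bullet> (x + z)) * s u ^ n + cos (u \<bullet> (x - z)) * s u ^ n) / 2 \<partial>\<gamma>)"
        by (intro Bochner_Integration.integral_cong refl)
          (simp add: inner_add_right inner_diff_right cos_add cos_diff algebra_simps)
      also have "\<dots> = (S n (x + z) + S n (x - z)) / 2"
        unfolding S_def by (subst integral_divide_zero, subst Bochner_Integration.integral_add) (use int in auto)
      finally show "(\<integral>u. cos (u \<bullet> x) * s u ^ n * cos (u \<bullet> z) \<partial>\<gamma>) = (S n (x + z) + S n (x - z)) / 2" .
    qed
    also have "\<dots> \<ge> 0" using Suc by (intro integral_nonneg_AE) auto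
    finally show ?case .
  qed
  define C1 where "C1 u = (\<integral>x. cos (u \<bullet> (x - a)) \<partial>\<mu>1)" for u
  have C1_meas[measurable]: "C1 \<in> borel_measurable borel" unfolding C1_def by measurable
  have C1_bd: "\<bar>C1 u\<bar> \<le> measure \<mu>1 (space \<mu>1)" for u
  proof -
    have "\<bar>C1 u\<bar> \<le> (\<integral>z. \<bar>cos (u \<bullet> (z - a))\<bar> \<partial>\<mu>1)" unfolding C1_def by (rule integral_abs_bound)
    also have "\<dots> \<le> (\<integral>z. 1 \<partial>\<mu>1)"
      by (intro integral_mono integrable_bounded_finite_measure[where B=1] fin) auto
    finally show ?thesis by simp
  qed
  have trm: "(\<integral>u. C1 u * s u ^ n \<partial>\<gamma>) = (\<integral>x. S n (x - a) \<partial>\<mu>1)" for n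
  proof -
    have "(\<integral>u. C1 u * s u ^ n \<partial>\<gamma>) = (\<integral>u. (\<integral>x. cos (u \<bullet> (x - a)) * s u ^ n \<partial>\<mu>1) \<partial>\<gamma>)"
      unfolding C1_def by simp
    also have "\<dots> = (\<integral>x. S n (x - a) \<partial>\<mu>1)"
      unfolding S_def
      by (rule g1.Fubini_integral[symmetric])
        (intro integrable_bounded_finite_measure[where B="L ^ n"] G1.finite_measure_axioms, auto intro!: sn_bd)
    finally show ?thesis .
  qed
  have "c * (\<integral>x. (\<integral>u. cos (u \<bullet> (x - a)) \<partial>\<gamma>) \<partial>\<mu>2) = c * (\<integral>u. (\<integral>x. cos (u \<bullet> (x - a)) \<partial>\<mu>2) \<partial>\<gamma>)"
    by (subst g2.Fubini_integral[symmetric])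
      (auto intro!: integrable_bounded_finite_measure[where B=1] G2.finite_measure_axioms)
  also have "\<dots> = (\<integral>u. c * (\<integral>x. cos (u \<bullet> (x - a)) \<partial>\<mu>2) \<partial>\<gamma>)"
    by (rule integral_mult_right_zero[symmetric])
  \<comment> \<open>The hypothesis is used with the phase \<open>- (u \<bullet> a)\<close>, which
    moves the argument from \<open>x\<close> to \<open>x - a\<close>.\<close>
  also have "\<dots> = (\<integral>u. exp (t * s u) * C1 u \<partial>\<gamma>)"
    using char[of _ "- (_ \<bullet> a)"]
    by (intro Bochner_Integration.integral_cong refl) (simp add: s_def C1_def inner_diff_right)
  finally have R: "c * (\<integral>x. (\<integral>u. cos (u \<bullet> (x - a)) \<partial>\<gamma>) \<partial>\<mu>2) = (\<integral>u. exp (t * s u) * C1 u \<partial>\<gamma>)" .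
  have lim: "(\<lambda>m. \<integral>u. (\<Sum>n<m. (t * s u) ^ n /\<^sub>R fact n) * C1 u \<partial>\<gamma>) \<longlonglongrightarrow> (\<integral>u. exp (t * s u) * C1 u \<partial>\<gamma>)"
  proof (rule integral_dominated_convergence[where w="\<lambda>_. exp (t * L) * measure \<mu>1 (space \<mu>1)"])
    show "AE u in \<gamma>. (\<lambda>m. (\<Sum>n<m. (t * s u) ^ n /\<^sub>R fact n) * C1 u) \<longlonglongrightarrow> exp (t * s u) * C1 u"
      by (intro AE_I2 tendsto_mult[OF exp_converges[unfolded sums_def] tendsto_const])
    fix m
    have "\<bar>(\<Sum>n<m. (t * s u) ^ n /\<^sub>R fact n) * C1 u\<bar> \<le> exp (t * L) * measure \<mu>1 (space \<mu>1)" for u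
    proof -
      have "\<bar>\<Sum>n<m. (t * s u) ^ n /\<^sub>R fact n\<bar> \<le> (\<Sum>n<m. \<bar>(t * s u) ^ n /\<^sub>R fact n\<bar>)"
        by (rule sum_abs)
      also have "\<dots> \<le> (\<Sum>n<m. (t * L) ^ n /\<^sub>R fact n)"
        using s_bd t by (intro sum_mono) (auto simp: abs_mult power_abs intro!: divide_right_mono power_mono mult_left_mono)
      also have "\<dots> \<le> exp (t * L)"
        unfolding exp_def using t L
        by (intro sum_le_suminf summable_exp_generic) auto
      finally show ?thesis
        using C1_bd[of u] by (auto simp: abs_mult intro!: mult_mono)
    qed
    then show "AE u in \<gamma>. norm ((\<Sum>n<m. (t * s u) ^ n /\<^sub>R fact n) * C1 u) \<le> exp (t * L) * measure \<mu>1 (space \<mu>1)"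
      by simp
  qed auto
  have partial: "(\<integral>x. S 0 (x - a) \<partial>\<mu>1) \<le> (\<integral>u. (\<Sum>n<m. (t * s u) ^ n /\<^sub>R fact n) * C1 u \<partial>\<gamma>)" if "m > 0" for m
  proof -
    have "(\<integral>u. (\<Sum>n<m. (t * s u) ^ n /\<^sub>R fact n) * C1 u \<partial>\<gamma>)
        = (\<integral>u. (\<Sum>n<m. (t ^ n / fact n) * (C1 u * s u ^ n)) \<partial>\<gamma>)"
      by (intro Bochner_Integration.integral_cong refl)
        (simp add: sum_distrib_right sum_distrib_left power_mult_distrib divide_inverse mult_ac)
    also have "\<dots> = (\<Sum>n<m. (\<integral>u. (t ^ n / fact n) * (C1 u * s u ^ n) \<partial>\<gamma>))"
    proof (intro Bochner_Integration.integral_sum integrable_mult_right)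
      fix n
      have "\<bar>C1 u * s u ^ n\<bar> \<le> measure \<mu>1 (space \<mu>1) * L ^ n" for u
        using C1_bd[of u] s_bd[of u] by (auto simp: abs_mult power_abs intro!: mult_mono power_mono)
      then show "integrable \<gamma> (\<lambda>u. C1 u * s u ^ n)"
        by (intro integrable_bounded_finite_measure fin) auto
    qed
    also have "\<dots> = (\<Sum>n<m. (t ^ n / fact n) * (\<integral>x. S n (x - a) \<partial>\<mu>1))"
      by (simp add: trm)
    also have "\<dots> \<ge> (\<Sum>n\<in>{0}. (t ^ n / fact n) * (\<integral>x. S n (x - a) \<partial>\<mu>1))"
      using that t S_nonneg by (intro sum_mono2) (auto intro!: integral_nonneg_AE)
    finally show ?thesis by simp
  qed
  have "(\<integral>x. S 0 (x - a) \<partial>\<mu>1) \<le> (\<integral>u. exp (t * s u) * C1 u \<partial>\<gamma>)"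
    by (rule LIMSEQ_le_const[OF lim]) (use partial in \<open>auto intro!: exI[of _ 1]\<close>)
  then show ?thesis unfolding R by (simp add: S_def)
qed

lemma nn_integral_lborel_affine:
  fixes f :: "'a::euclidean_space \<Rightarrow> ennreal"
  assumes [measurable]: "f \<in> borel_measurable borel" and c: "c \<noteq> 0"
  shows "(\<integral>\<^sup>+x. f x \<partial>lborel) = ennreal (\<bar>c\<bar> ^ DIM('a)) * (\<integral>\<^sup>+x. f (a + c *\<^sub>R x) \<partial>lborel)"
  by (subst lborel_affine[OF c, of a])
     (simp add: nn_integral_density nn_integral_distr nn_integral_cmult)

text \<open>An approximate identity. After Fubini and the substitution of
  \<open>x - w / (n + 1)\<close> for \<open>a\<close>, the test function is integrated against a
  fixed Gaussian in \<open>w\<close>, and dominated convergence applies first in \<open>w\<close>,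
  then in \<open>x\<close>. The mass \<open>Z\<close> is not computed: its positivity is enough to
  cancel it later.\<close>

lemma gaussian_convolution_limit:
  fixes h :: "'a::euclidean_space \<Rightarrow> real" and \<mu> :: "'a measure"
  assumes "finite_measure \<mu>" and [measurable_cong]: "sets \<mu> = sets borel"
    and h: "continuous_on UNIV h" "\<And>x. 0 \<le> h x" "\<And>x. h x \<le> 1"
  defines "Z \<equiv> \<integral>w. exp (- (norm (w::'a))\<^sup>2 / 2) \<partial>lborel"
  shows "0 < Z"
    and "(\<lambda>n. ennreal (real (Suc n) ^ DIM('a)) *
      (\<integral>\<^sup>+a. ennreal (h a) * (\<integral>\<^sup>+x. ennreal (exp (- (norm (real (Suc n) *\<^sub>R (x - a)))\<^sup>2 / 2)) \<partial>\<mu>) \<partial>lborel))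
      \<longlonglongrightarrow> ennreal Z * (\<integral>\<^sup>+x. ennreal (h x) \<partial>\<mu>)"
proof -
  interpret finite_measure \<mu> by fact
  interpret P: pair_sigma_finite \<mu> "lborel :: 'a measure" ..
  have [measurable]: "h \<in> borel_measurable borel" using h(1) by (rule borel_measurable_continuous_onI)
  let ?g = "\<lambda>w::'a. exp (- (norm w)\<^sup>2 / 2)"
  have int: "integrable lborel ?g"
    using nn_integral_gaussian_finite[where 'a='a] by (intro integrableI_nonneg) auto
  show Zpos: "0 < Z"
  proof -
    have "Z \<noteq> 0"
    proof
      assume "Z = 0"
      then have "AE w in lborel. ?g w = 0"
        using integral_nonneg_eq_0_iff_AE[OF int] by (simp add: Z_def)
      then have "AE w in (lborel::'a measure). False" by eventually_elim simp
      then show False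
        by (subst (asm) AE_iff_measurable[OF _ refl]) (simp_all add: emeasure_lborel_UNIV)
    qed
    moreover have "0 \<le> Z" unfolding Z_def by simp
    ultimately show ?thesis by simp
  qed
  let ?I = "\<lambda>n x. \<integral>w. h (x - w /\<^sub>R real (Suc n)) * ?g w \<partial>lborel"
  have bd: "\<bar>h y * ?g w\<bar> \<le> ?g w" for y w
    using h(2,3)[of y] by (simp add: abs_mult mult_left_le_one_le)
  have int': "integrable lborel (\<lambda>w. h (x - w /\<^sub>R real (Suc n)) * ?g w)" for x n
    by (rule Bochner_Integration.integrable_bound[OF int]) (use bd in auto)
  have I_le: "\<bar>?I n x\<bar> \<le> Z" and I_nonneg: "0 \<le> ?I n x" for n x
  proof -
    show "0 \<le> ?I n x" using h by (intro integral_nonneg_AE) auto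
    have "?I n x \<le> Z" unfolding Z_def
      by (intro integral_mono int int' order_trans[OF abs_ge_self bd])
    then show "\<bar>?I n x\<bar> \<le> Z" using \<open>0 \<le> ?I n x\<close> by simp
  qed
  have I_lim: "(\<lambda>n. ?I n x) \<longlonglongrightarrow> h x * Z" for x
  proof -
    have "(\<lambda>n. ?I n x) \<longlonglongrightarrow> (\<integral>w. h x * ?g w \<partial>lborel)"
    proof (rule integral_dominated_convergence[where w="?g"])
      have "(\<lambda>n. h (x - w /\<^sub>R real (Suc n)) * ?g w) \<longlonglongrightarrow> h x * ?g w" for w
      proof -
        have "(\<lambda>n. x - w /\<^sub>R real (Suc n)) \<longlonglongrightarrow> x - 0 *\<^sub>R w"
          using LIMSEQ_inverse_real_of_nat by (intro tendsto_intros) (simp add: inverse_eq_divide)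
        then have "(\<lambda>n. h (x - w /\<^sub>R real (Suc n))) \<longlonglongrightarrow> h x"
          using h(1) by (auto intro: continuous_on_tendsto_compose)
        then show ?thesis by (intro tendsto_intros)
      qed
      then show "AE w in lborel. (\<lambda>n. h (x - w /\<^sub>R real (Suc n)) * ?g w) \<longlonglongrightarrow> h x * ?g w" by simp
    qed (use int bd in auto)
    then show ?thesis by (simp add: Z_def)
  qed
  have eq: "ennreal (real (Suc n) ^ DIM('a)) *
      (\<integral>\<^sup>+a. ennreal (h a) * (\<integral>\<^sup>+x. ennreal (?g (real (Suc n) *\<^sub>R (x - a))) \<partial>\<mu>) \<partial>lborel) = ennreal (\<integral>x. ?I n x \<partial>\<mu>)" for n
  proof -
    let ?r = "real (Suc n)"
    have "(\<integral>\<^sup>+a. ennreal (h a) * (\<integral>\<^sup>+x. ennreal (?g (?r *\<^sub>R (x - a))) \<partial>\<mu>) \<partial>lborel)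
       = (\<integral>\<^sup>+a. (\<integral>\<^sup>+x. ennreal (h a * ?g (?r *\<^sub>R (x - a))) \<partial>\<mu>) \<partial>lborel)"
      by (subst nn_integral_cmult[symmetric]) (auto simp: ennreal_mult h)
    also have "\<dots> = (\<integral>\<^sup>+x. (\<integral>\<^sup>+a. ennreal (h a * ?g (?r *\<^sub>R (x - a))) \<partial>lborel) \<partial>\<mu>)"
      by (rule P.Fubini') measurable
    also have "\<dots> = (\<integral>\<^sup>+x. ennreal (inverse ?r ^ DIM('a)) * ennreal (?I n x) \<partial>\<mu>)"
    proof (intro nn_integral_cong)
      fix x
      have "(\<integral>\<^sup>+a. ennreal (h a * ?g (?r *\<^sub>R (x - a))) \<partial>lborel) =
         ennreal (\<bar>- inverse ?r\<bar> ^ DIM('a)) * (\<integral>\<^sup>+w. ennreal (h (x + (- inverse ?r) *\<^sub>R w) * ?g (?r *\<^sub>R (x - (x + (- inverse ?r) *\<^sub>R w)))) \<partial>lborel)"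
        by (rule nn_integral_lborel_affine) auto
      also have "(\<integral>\<^sup>+w. ennreal (h (x + (- inverse ?r) *\<^sub>R w) * ?g (?r *\<^sub>R (x - (x + (- inverse ?r) *\<^sub>R w)))) \<partial>lborel)
         = (\<integral>\<^sup>+w. ennreal (h (x - w /\<^sub>R ?r) * ?g w) \<partial>lborel)"
        by (intro nn_integral_cong) (simp del: of_nat_Suc)
      also have "\<dots> = ennreal (?I n x)"
        by (rule nn_integral_eq_integral) (use int' h in auto)
      finally show "(\<integral>\<^sup>+a. ennreal (h a * ?g (?r *\<^sub>R (x - a))) \<partial>lborel) = ennreal (inverse ?r ^ DIM('a)) * ennreal (?I n x)"
        by simp
    qed
    also have "\<dots> = ennreal (inverse ?r ^ DIM('a)) * (\<integral>\<^sup>+x. ennreal (?I n x) \<partial>\<mu>)"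
      by (rule nn_integral_cmult) measurable
    also have "(\<integral>\<^sup>+x. ennreal (?I n x) \<partial>\<mu>) = ennreal (\<integral>x. ?I n x \<partial>\<mu>)"
      by (rule nn_integral_eq_integral) (use I_le I_nonneg in \<open>auto intro!: integrable_bounded_finite_measure[where B=Z] finite_measure_axioms\<close>)
    finally have "(\<integral>\<^sup>+a. ennreal (h a) * (\<integral>\<^sup>+x. ennreal (?g (?r *\<^sub>R (x - a))) \<partial>\<mu>) \<partial>lborel)
      = ennreal (inverse ?r ^ DIM('a)) * ennreal (\<integral>x. ?I n x \<partial>\<mu>)" .
    then show ?thesis
      by (simp only: mult.assoc[symmetric]) (simp add: ennreal_mult'[symmetric] power_inverse del: of_nat_Suc)
  qed
  have "(\<lambda>n. \<integral>x. ?I n x \<partial>\<mu>) \<longlonglongrightarrow> (\<integral>x. h x * Z \<partial>\<mu>)"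
    by (rule integral_dominated_convergence[where w="\<lambda>_. Z"]) (use I_lim I_le in auto)
  then have "(\<lambda>n. ennreal (\<integral>x. ?I n x \<partial>\<mu>)) \<longlonglongrightarrow> ennreal (\<integral>x. h x * Z \<partial>\<mu>)"
    by (rule tendsto_ennrealI)
  moreover have "ennreal (\<integral>x. h x * Z \<partial>\<mu>) = ennreal Z * (\<integral>\<^sup>+x. ennreal (h x) \<partial>\<mu>)"
    using h Zpos by (subst nn_integral_eq_integral)
      (auto simp: ennreal_mult'[symmetric] mult.commute intro!: integrable_bounded_finite_measure[where B=1] finite_measure_axioms)
  ultimately show "(\<lambda>n. ennreal (real (Suc n) ^ DIM('a)) *
      (\<integral>\<^sup>+a. ennreal (h a) * (\<integral>\<^sup>+x. ennreal (?g (real (Suc n) *\<^sub>R (x - a))) \<partial>\<mu>) \<partial>lborel))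
      \<longlonglongrightarrow> ennreal Z * (\<integral>\<^sup>+x. ennreal (h x) \<partial>\<mu>)"
    unfolding eq by simp
qed

text \<open>The indicator of a closed set is a limit of continuous cutoffs of the distance to it;
  compact inner regularity carries the inequality on to Borel sets.\<close>

lemma emeasure_le_if_continuous_le:
  fixes \<mu>1 \<mu>2 :: "'a::euclidean_space measure" and c :: real
  assumes fin: "finite_measure \<mu>1" "finite_measure \<mu>2"
    and sets[measurable_cong]: "sets \<mu>1 = sets borel" "sets \<mu>2 = sets borel"
    and le: "\<And>h. continuous_on UNIV h \<Longrightarrow> (\<And>x. 0 \<le> h x) \<Longrightarrow> (\<And>x. h x \<le> 1) \<Longrightarrow>
      (\<integral>\<^sup>+x. ennreal (h x) \<partial>\<mu>1) \<le> ennreal c * (\<integral>\<^sup>+x. ennreal (h x) \<partial>\<mu>2)"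
    and A: "A \<in> sets borel"
  shows "emeasure \<mu>1 A \<le> ennreal c * emeasure \<mu>2 A"
proof -
  have closed: "emeasure \<mu>1 C \<le> ennreal c * emeasure \<mu>2 C" if C: "closed C" for C
  \<comment> \<open>By convention \<open>infdist x {} = 0\<close>, which would make every cutoff
    constantly 1, so the empty set goes separately.\<close>
  proof (cases "C = {}")
    case False
    define h where "h n x = max 0 (1 - real n * infdist x C)" for n x
    have h: "continuous_on UNIV (h n)" "0 \<le> h n x" "h n x \<le> 1" for n x
      by (auto simp: h_def infdist_nonneg intro!: continuous_intros)
    then have [measurable]: "h n \<in> borel_measurable borel" for n by (intro borel_measurable_continuous_onI)
    have [measurable]: "C \<in> sets borel" using C by simp
    have h_lim: "(\<lambda>n. ennreal (h n x)) \<longlonglongrightarrow> indicator C x" for x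
    proof (cases "x \<in> C")
      case True
      then show ?thesis by (simp add: h_def)
    next
      case False
      then have pos: "infdist x C > 0"
        using C \<open>C \<noteq> {}\<close> by (metis in_closed_iff_infdist_zero infdist_nonneg less_le)
      obtain N where N: "1 < real N * infdist x C" using ex_less_of_nat_mult[OF pos] by auto
      have "h n x = 0" if "n \<ge> N" for n
      proof -
        have "real N * infdist x C \<le> real n * infdist x C" using pos that by (intro mult_right_mono) auto
        then show ?thesis using N by (simp add: h_def)
      qed
      then have "\<forall>\<^sub>F n in sequentially. ennreal (h n x) = 0"
        by (intro eventually_sequentiallyI[of N]) simp
      then show ?thesis using False by (simp add: tendsto_eventually)
    qed
    have lim: "(\<lambda>n. \<integral>\<^sup>+x. ennreal (h n x) \<partial>\<mu>) \<longlonglongrightarrow> emeasure \<mu> C"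
      if "finite_measure \<mu>" and [measurable_cong]: "sets \<mu> = sets borel" for \<mu>
    proof -
      have "(\<lambda>n. \<integral>\<^sup>+x. ennreal (h n x) \<partial>\<mu>) \<longlonglongrightarrow> (\<integral>\<^sup>+x. indicator C x \<partial>\<mu>)"
        using h_lim h finite_measure.emeasure_finite[OF that(1)]
        by (intro nn_integral_dominated_convergence[where w="\<lambda>_. 1"]) (auto simp: top.not_eq_extremum[symmetric])
      then show ?thesis by simp
    qed
    have "(\<lambda>n. ennreal c * (\<integral>\<^sup>+x. ennreal (h n x) \<partial>\<mu>2)) \<longlonglongrightarrow> ennreal c * emeasure \<mu>2 C"
      by (intro ennreal_tendsto_cmult lim fin sets) simp
    then show ?thesis
      by (rule LIMSEQ_le[OF lim[OF fin(1) sets(1)]]) (use le h in blast)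
  qed simp
  have "emeasure \<mu>1 A = (SUP K \<in> {K. K \<subseteq> A \<and> compact K}. emeasure \<mu>1 K)"
    by (rule inner_regular) (use sets fin A in \<open>auto simp: finite_measure.emeasure_finite\<close>)
  also have "\<dots> \<le> ennreal c * emeasure \<mu>2 A"
  proof (rule SUP_least)
    fix K assume K: "K \<in> {K. K \<subseteq> A \<and> compact K}"
    then have "emeasure \<mu>1 K \<le> ennreal c * emeasure \<mu>2 K" by (intro closed) (simp add: compact_imp_closed)
    also have "\<dots> \<le> ennreal c * emeasure \<mu>2 A" using K A sets by (intro mult_left_mono emeasure_mono) auto
    finally show "emeasure \<mu>1 K \<le> ennreal c * emeasure \<mu>2 A" .
  qed
  finally show ?thesis .
qed

text \<open>Kernel domination applies to Gaussians of every width and centre, because the transform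
  of a Gaussian is again a positive Gaussian. Integrating over the centre against a test function
  and shrinking the width removes the kernel. The phase \<theta> in the hypothesis encodes the real
  and imaginary parts of the characteristic functions together.\<close>

lemma fourier_domination:
  fixes \<mu>1 \<mu>2 \<sigma> :: "'a::euclidean_space measure" and c t :: real
  assumes fin: "finite_measure \<mu>1" "finite_measure \<mu>2" "finite_measure \<sigma>"
    and sets[measurable_cong]: "sets \<mu>1 = sets borel" "sets \<mu>2 = sets borel" "sets \<sigma> = sets borel"
    and t: "t \<ge> 0" and c: "c \<ge> 0"
    and char: "\<And>u \<theta>. c * (\<integral>x. cos (u \<bullet> x + \<theta>) \<partial>\<mu>2) =
      exp (t * (\<integral>z. cos (u \<bullet> z) \<partial>\<sigma>)) * (\<integral>x. cos (u \<bullet> x + \<theta>) \<partial>\<mu>1)"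
    and A: "A \<in> sets borel"
  shows "emeasure \<mu>1 A \<le> ennreal c * emeasure \<mu>2 A"
proof (rule emeasure_le_if_continuous_le[OF fin(1,2) sets(1,2) _ A])
  fix h :: "'a \<Rightarrow> real" assume h: "continuous_on UNIV h" "\<And>x. 0 \<le> h x" "\<And>x. h x \<le> 1"
  have [measurable]: "h \<in> borel_measurable borel" using h(1) by (rule borel_measurable_continuous_onI)
  obtain \<gamma> :: "'a measure" where g: "prob_space \<gamma>" and [measurable_cong]: "sets \<gamma> = sets borel"
    and gchar: "\<And>v. (\<integral>u. cos (u \<bullet> v) \<partial>\<gamma>) = exp (- (norm v)\<^sup>2 / 2)"
    by (rule gaussian_char_measure) blast
  interpret g: prob_space \<gamma> by fact
  interpret m1: finite_measure \<mu>1 by fact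
  interpret m2: finite_measure \<mu>2 by fact
  define K where "K n x = exp (- (norm (real (Suc n) *\<^sub>R x))\<^sup>2 / 2)" for n and x :: 'a
  have [measurable]: "K n \<in> borel_measurable borel" for n unfolding K_def by measurable
  have K1: "0 \<le> K n x" "K n x \<le> 1" for n x by (auto simp: K_def)
  have ker: "(\<integral>\<^sup>+x. ennreal (K n (x - a)) \<partial>\<mu>1) \<le> ennreal c * (\<integral>\<^sup>+x. ennreal (K n (x - a)) \<partial>\<mu>2)" for n a
  proof -
    \<comment> \<open>Stretching the Gaussian by \<open>n + 1\<close> in frequency narrows its
      transform by the same factor; the result is \<open>K n\<close>.\<close>
    define \<gamma>' where "\<gamma>' = distr \<gamma> borel (\<lambda>u. real (Suc n) *\<^sub>R u)"
    have K': "(\<integral>u. cos (u \<bullet> x) \<partial>\<gamma>') = K n x" for x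
    proof -
      have "(\<integral>u. cos (u \<bullet> x) \<partial>\<gamma>') = (\<integral>u. cos (u \<bullet> (real (Suc n) *\<^sub>R x)) \<partial>\<gamma>)"
        unfolding \<gamma>'_def by (subst integral_distr) auto
      then show ?thesis unfolding gchar K_def .
    qed
    have "(\<integral>x. (\<integral>u. cos (u \<bullet> (x - a)) \<partial>\<gamma>') \<partial>\<mu>1) \<le> c * (\<integral>x. (\<integral>u. cos (u \<bullet> (x - a)) \<partial>\<gamma>') \<partial>\<mu>2)"
    proof (rule fourier_kernel_domination[OF fin _ sets _ t char])
      show "finite_measure \<gamma>'" unfolding \<gamma>'_def by (intro g.finite_measure_distr) measurable
      show "sets \<gamma>' = sets borel" by (simp add: \<gamma>'_def)
    qed (simp add: K' K1)
    then have "(\<integral>x. K n (x - a) \<partial>\<mu>1) \<le> c * (\<integral>x. K n (x - a) \<partial>\<mu>2)" by (simp add: K')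
    moreover have "integrable \<mu>1 (\<lambda>x. K n (x - a))" "integrable \<mu>2 (\<lambda>x. K n (x - a))"
      by (intro integrable_bounded_finite_measure[where B=1] fin; use K1 in auto)+
    ultimately show ?thesis
      using K1 c by (simp add: nn_integral_eq_integral ennreal_mult'[symmetric])
  qed
  let ?Z = "\<integral>w. exp (- (norm (w::'a))\<^sup>2 / 2) \<partial>lborel"
  note lim1 = gaussian_convolution_limit[OF fin(1) sets(1) h, folded K_def]
  note lim2 = gaussian_convolution_limit[OF fin(2) sets(2) h, folded K_def]
  have le: "ennreal (real (Suc n) ^ DIM('a)) * (\<integral>\<^sup>+a. ennreal (h a) * (\<integral>\<^sup>+x. ennreal (K n (x - a)) \<partial>\<mu>1) \<partial>lborel)
     \<le> ennreal c * (ennreal (real (Suc n) ^ DIM('a)) * (\<integral>\<^sup>+a. ennreal (h a) * (\<integral>\<^sup>+x. ennreal (K n (x - a)) \<partial>\<mu>2) \<partial>lborel))" for n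
  proof -
    have "(\<integral>\<^sup>+a. ennreal (h a) * (\<integral>\<^sup>+x. ennreal (K n (x - a)) \<partial>\<mu>1) \<partial>lborel)
      \<le> (\<integral>\<^sup>+a. ennreal c * (ennreal (h a) * (\<integral>\<^sup>+x. ennreal (K n (x - a)) \<partial>\<mu>2)) \<partial>lborel)"
      using ker by (intro nn_integral_mono) (simp add: mult.left_commute[of "ennreal c"] mult_left_mono)
    also have "\<dots> = ennreal c * (\<integral>\<^sup>+a. ennreal (h a) * (\<integral>\<^sup>+x. ennreal (K n (x - a)) \<partial>\<mu>2) \<partial>lborel)"
      by (rule nn_integral_cmult) measurable
    finally show ?thesis
      by (simp add: mult.left_commute[of "ennreal c"] mult_left_mono)
  qed
  have "ennreal ?Z * (\<integral>\<^sup>+x. ennreal (h x) \<partial>\<mu>1) \<le> ennreal c * (ennreal ?Z * (\<integral>\<^sup>+x. ennreal (h x) \<partial>\<mu>2))"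
    by (rule LIMSEQ_le[OF lim1(2) ennreal_tendsto_cmult[OF _ lim2(2)]]) (use le in auto)
  then show "(\<integral>\<^sup>+x. ennreal (h x) \<partial>\<mu>1) \<le> ennreal c * (\<integral>\<^sup>+x. ennreal (h x) \<partial>\<mu>2)"
    using lim1(1) by (simp add: mult.left_commute[of "ennreal c"] ennreal_mult_le_mult_iff)
qed

lemma cos_plus_1_nonneg: "0 \<le> 1 + cos (r::real)"
  using cos_ge_minus_one[of r] by linarith

text \<open>The functions \<open>1 + cos (u \<bullet> x + \<theta>)\<close> play the role of a nonnegative real characteristic function;
  \<open>u = 0\<close> recovers the total mass.\<close>

lemma measure_eqI_cos:
  fixes \<mu>1 \<mu>2 :: "'a::euclidean_space measure"
  assumes fin: "finite_measure \<mu>1" "finite_measure \<mu>2"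
    and sets[measurable_cong]: "sets \<mu>1 = sets borel" "sets \<mu>2 = sets borel"
    and eq: "\<And>u \<theta>. (\<integral>\<^sup>+x. ennreal (1 + cos (u \<bullet> x + \<theta>)) \<partial>\<mu>1) = (\<integral>\<^sup>+x. ennreal (1 + cos (u \<bullet> x + \<theta>)) \<partial>\<mu>2)"
  shows "\<mu>1 = \<mu>2"
proof -
  have nn: "(\<integral>\<^sup>+x. ennreal (1 + cos (u \<bullet> x + \<theta>)) \<partial>\<mu>) = ennreal (measure \<mu> (space \<mu>) + (\<integral>x. cos (u \<bullet> x + \<theta>) \<partial>\<mu>))"
    if "finite_measure \<mu>" and [measurable_cong]: "sets \<mu> = sets borel" for \<mu> :: "'a measure" and u \<theta>
  proof -
    interpret finite_measure \<mu> by fact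
    have i: "integrable \<mu> (\<lambda>x. cos (u \<bullet> x + \<theta>))"
      by (intro integrable_bounded_finite_measure[where B=1] finite_measure_axioms) auto
    then have "(\<integral>\<^sup>+x. ennreal (1 + cos (u \<bullet> x + \<theta>)) \<partial>\<mu>) = ennreal (\<integral>x. 1 + cos (u \<bullet> x + \<theta>) \<partial>\<mu>)"
      by (intro nn_integral_eq_integral) (auto simp: cos_plus_1_nonneg)
    also have "(\<integral>x. 1 + cos (u \<bullet> x + \<theta>) \<partial>\<mu>) = measure \<mu> (space \<mu>) + (\<integral>x. cos (u \<bullet> x + \<theta>) \<partial>\<mu>)"
      using i by simp
    finally show ?thesis .
  qed
  have ge: "0 \<le> measure \<mu> (space \<mu>) + (\<integral>x. cos (u \<bullet> x + \<theta>) \<partial>\<mu>)"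
    if "finite_measure \<mu>" and [measurable_cong]: "sets \<mu> = sets borel" for \<mu> :: "'a measure" and u \<theta>
  proof -
    interpret finite_measure \<mu> by fact
    have i: "integrable \<mu> (\<lambda>x. cos (u \<bullet> x + \<theta>))"
      by (intro integrable_bounded_finite_measure[where B=1] finite_measure_axioms) auto
    have "0 \<le> (\<integral>x. 1 + cos (u \<bullet> x + \<theta>) \<partial>\<mu>)" by (intro integral_nonneg_AE) (auto simp: cos_plus_1_nonneg)
    with i show ?thesis by simp
  qed
  have e: "measure \<mu>1 (space \<mu>1) + (\<integral>x. cos (u \<bullet> x + \<theta>) \<partial>\<mu>1) = measure \<mu>2 (space \<mu>2) + (\<integral>x. cos (u \<bullet> x + \<theta>) \<partial>\<mu>2)" for u \<theta>
    using eq[of u \<theta>] ge[OF fin(1) sets(1)] ge[OF fin(2) sets(2)]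
    by (simp add: nn[OF fin(1) sets(1)] nn[OF fin(2) sets(2)])
  have mass: "measure \<mu>1 (space \<mu>1) = measure \<mu>2 (space \<mu>2)"
    using e[of 0 0] by simp
  have cos: "(\<integral>x. cos (u \<bullet> x + \<theta>) \<partial>\<mu>1) = (\<integral>x. cos (u \<bullet> x + \<theta>) \<partial>\<mu>2)" for u \<theta>
    using e[of u \<theta>] mass by simp
  show ?thesis
  proof (rule measure_eqI)
    fix A assume "A \<in> sets \<mu>1"
    then have A: "A \<in> sets borel" by (simp add: sets)
    \<comment> \<open>At \<open>t = 0\<close> the exponential factor is 1 whatever \<sigma> is, so
      \<open>\<mu>1\<close> is inserted as a placeholder. Equality is domination both ways with
      \<open>c = 1\<close>.\<close>
    have "emeasure \<mu>1 A \<le> ennreal 1 * emeasure \<mu>2 A"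
      by (rule fourier_domination[where t=0 and \<sigma>=\<mu>1]) (use fin sets A cos in auto)
    moreover have "emeasure \<mu>2 A \<le> ennreal 1 * emeasure \<mu>1 A"
      by (rule fourier_domination[where t=0 and \<sigma>=\<mu>1]) (use fin sets A cos in auto)
    ultimately show "emeasure \<mu>1 A = emeasure \<mu>2 A" by simp
  qed (simp add: sets)
qed

section \<open>Grid approximations of the killed process\<close>

lemma prod_indicator:
  "(\<Prod>j\<le>N::nat. indicator A (f j)) = (if \<forall>j\<le>N. f j \<in> A then 1 else (0::ennreal))"
  by (induction N) (auto simp: indicator_def le_Suc_eq)

locale levy_domain =
  fixes M :: "'b measure" and X :: "real \<Rightarrow> 'b \<Rightarrow> 'a::euclidean_space" and p :: "real \<Rightarrow> 'a \<Rightarrow> real"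
    and \<nu> :: "'a measure" and D :: "'a set"
  assumes levy: "levy_process M X" and triplet: "has_triplet_0_nu_0 M X \<nu>"
    and dens: "bounded_transition_density M X p" and openD: "open D" and boundedD: "bounded D"
begin

sublocale prob_space M using levy by (simp add: levy_process_def)

sublocale complete_measure M using levy by (simp add: levy_process_def)

lemma X_measurable[measurable]: "0 \<le> t \<Longrightarrow> X t \<in> borel_measurable M"
  using levy by (simp add: levy_process_def)

lemma X_0[simp]: "\<omega> \<in> space M \<Longrightarrow> X 0 \<omega> = 0"
  using levy by (simp add: levy_process_def)

section \<open>One-time laws and the Markov property along a grid\<close>

definition law :: "real \<Rightarrow> 'a measure" where "law h = distr M borel (X h)"

lemma sets_law[simp, measurable_cong]: "sets (law h) = sets borel"
  by (simp add: law_def)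

lemma space_law[simp]: "space (law h) = UNIV"
  by (simp add: law_def)

lemma prob_space_law: "0 \<le> h \<Longrightarrow> prob_space (law h)"
  unfolding law_def by (intro prob_space_distr) measurable

lemma nn_integral_law:
  "0 \<le> h \<Longrightarrow> f \<in> borel_measurable borel \<Longrightarrow> (\<integral>\<^sup>+z. f z \<partial>law h) = (\<integral>\<^sup>+\<omega>. f (X h \<omega>) \<partial>M)"
  unfolding law_def by (rule nn_integral_distr) auto

text \<open>The positions on the grid are functions of the first \<open>N\<close> increments, which
  are independent of the next one. The length \<open>h\<close> of that last increment is free, so
  one can also step from a grid point to a time off the grid.\<close>

lemma grid_markov:
  assumes "0 \<le> \<delta>" "0 \<le> h"
    and k[measurable]: "k \<in> borel_measurable (PiM {..N} (\<lambda>_. borel) \<Otimes>\<^sub>M borel)"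
  shows "(\<integral>\<^sup>+\<omega>. k (\<lambda>j\<in>{..N}. X (real j * \<delta>) \<omega>, X (real N * \<delta> + h) \<omega> - X (real N * \<delta>) \<omega>) \<partial>M) =
    (\<integral>\<^sup>+\<omega>. (\<integral>\<^sup>+z. k (\<lambda>j\<in>{..N}. X (real j * \<delta>) \<omega>, z) \<partial>law h) \<partial>M)"
proof -
  \<comment> \<open>Grid points up to index \<open>N\<close>, then one last increment of the
    different length \<open>h\<close>.\<close>
  define s where "s i = (if i \<le> N then real i * \<delta> else real N * \<delta> + h)" for i
  define I where "I i \<omega> = X (s (Suc i)) \<omega> - X (s i) \<omega>" for i \<omega>
  have s_mono: "s i \<le> s (Suc i)" if "i < Suc N" for i
    using that assms(1,2) by (auto simp: s_def mult_right_mono not_less_eq_eq le_Suc_eq)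
  have ind: "indep_vars (\<lambda>_. borel) I {..<Suc N}"
  proof -
    have "0 \<le> s 0 \<and> (\<forall>i<Suc N. s i \<le> s (Suc i)) \<longrightarrow>
        indep_vars (\<lambda>_. borel) (\<lambda>i \<omega>. X (s (Suc i)) \<omega> - X (s i) \<omega>) {..<Suc N}"
      using levy unfolding levy_process_def by blast
    moreover have "0 \<le> s 0" by (simp add: s_def)
    ultimately show ?thesis using s_mono unfolding I_def by blast
  qed
  define A where "A \<omega> = restrict (\<lambda>i. I i \<omega>) {..<N}" for \<omega>
  define B where "B \<omega> = restrict (\<lambda>i. I i \<omega>) {N}" for \<omega>
  have ind2: "indep_var (PiM {..<N} (\<lambda>_. borel)) A (PiM {N} (\<lambda>_. borel)) B"
    unfolding A_def B_def by (rule indep_var_restrict[OF ind]) auto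
  \<comment> \<open>Partial sums recover positions from increments because the process starts at
    0.\<close>
  define c where "c f = (\<lambda>j\<in>{..N}. \<Sum>i<j. f i)" for f :: "nat \<Rightarrow> 'a"
  have c: "c \<in> PiM {..<N} (\<lambda>_. borel) \<rightarrow>\<^sub>M PiM {..N} (\<lambda>_. borel)"
    unfolding c_def by (intro measurable_restrict borel_measurable_sum) auto
  have "indep_var (PiM {..N} (\<lambda>_. borel)) (c \<circ> A) (PiM {N} (\<lambda>_. borel)) (id \<circ> B)"
    by (rule indep_var_compose[OF ind2 c]) simp
  then have ind3: "random_variable (PiM {..N} (\<lambda>_. borel)) (c \<circ> A)"
      "random_variable (PiM {N} (\<lambda>_. borel)) B"
     "distr M (PiM {..N} (\<lambda>_. borel)) (c \<circ> A) \<Otimes>\<^sub>M distr M (PiM {N} (\<lambda>_. borel)) B =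
      distr M (PiM {..N} (\<lambda>_. borel) \<Otimes>\<^sub>M PiM {N} (\<lambda>_. borel)) (\<lambda>x. ((c \<circ> A) x, B x))"
    by (simp_all add: indep_var_distribution_eq)
  note [measurable] = ind3(1,2)
  have B_eq: "B \<omega> N = X (real N * \<delta> + h) \<omega> - X (real N * \<delta>) \<omega>" for \<omega>
    by (auto simp: B_def I_def s_def)
  have B_law: "distr M borel (\<lambda>\<omega>. B \<omega> N) = law h"
    unfolding B_eq law_def using levy assms by (simp add: levy_process_def)
  have [measurable]: "(\<lambda>v. v N) \<in> borel_measurable (PiM {N} (\<lambda>_. borel::'a measure))"
    by (rule measurable_component_singleton) simp
  have [measurable]: "(\<lambda>\<omega>. B \<omega> N) \<in> borel_measurable M"
    by (rule measurable_compose[OF ind3(2)]) measurable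
  have A_eq: "(c \<circ> A) \<omega> = (\<lambda>j\<in>{..N}. X (real j * \<delta>) \<omega>)" if "\<omega> \<in> space M" for \<omega>
  proof
    fix j
    show "(c \<circ> A) \<omega> j = (\<lambda>j\<in>{..N}. X (real j * \<delta>) \<omega>) j"
    proof (cases "j \<le> N")
      case True
      have "(\<Sum>i<j. A \<omega> i) = (\<Sum>i<j. X (s (Suc i)) \<omega> - X (s i) \<omega>)"
        using True by (intro sum.cong) (auto simp: A_def I_def)
      also have "\<dots> = X (s j) \<omega> - X (s 0) \<omega>" by (rule sum_lessThan_telescope)
      also have "\<dots> = X (real j * \<delta>) \<omega>" using True that by (simp add: s_def)
      finally show ?thesis using True by (simp add: c_def)
    qed (simp add: c_def)
  qed
  interpret L: prob_space "law h" by (rule prob_space_law) fact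
  let ?dB = "distr M (PiM {N} (\<lambda>_. borel)) B"
  interpret dB: prob_space ?dB by (rule prob_space_distr) measurable
  have pm: "(\<lambda>x. ((c \<circ> A) x, B x)) \<in> M \<rightarrow>\<^sub>M PiM {..N} (\<lambda>_. borel) \<Otimes>\<^sub>M PiM {N} (\<lambda>_. borel)"
    by measurable
  have "(\<integral>\<^sup>+\<omega>. k (\<lambda>j\<in>{..N}. X (real j * \<delta>) \<omega>, X (real N * \<delta> + h) \<omega> - X (real N * \<delta>) \<omega>) \<partial>M)
     = (\<integral>\<^sup>+\<omega>. k ((c \<circ> A) \<omega>, B \<omega> N) \<partial>M)"
    using A_eq by (intro nn_integral_cong) (simp add: B_eq)
  also have "\<dots> = (\<integral>\<^sup>+v. k (fst v, snd v N) \<partial>distr M (PiM {..N} (\<lambda>_. borel) \<Otimes>\<^sub>M PiM {N} (\<lambda>_. borel)) (\<lambda>x. ((c \<circ> A) x, B x)))"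
    by (subst nn_integral_distr[OF pm]) auto
  also have "\<dots> = (\<integral>\<^sup>+v. k (fst v, snd v N) \<partial>(distr M (PiM {..N} (\<lambda>_. borel)) (c \<circ> A) \<Otimes>\<^sub>M ?dB))"
    by (simp only: ind3(3)[symmetric])
  also have "\<dots> = (\<integral>\<^sup>+v. (\<integral>\<^sup>+z. k (v, z N) \<partial>?dB) \<partial>distr M (PiM {..N} (\<lambda>_. borel)) (c \<circ> A))"
    by (subst dB.nn_integral_fst[symmetric]) auto
  also have "\<dots> = (\<integral>\<^sup>+\<omega>. (\<integral>\<^sup>+z. k ((c \<circ> A) \<omega>, z N) \<partial>?dB) \<partial>M)"
    by (rule nn_integral_distr) measurable
  also have "\<dots> = (\<integral>\<^sup>+\<omega>. (\<integral>\<^sup>+z. k ((c \<circ> A) \<omega>, z) \<partial>law h) \<partial>M)"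
  proof (rule nn_integral_cong)
    fix \<omega> assume "\<omega> \<in> space M"
    then have [measurable]: "(c \<circ> A) \<omega> \<in> space (PiM {..N} (\<lambda>_. borel))"
      using ind3(1) by (rule measurable_space[rotated])
    then have km: "(\<lambda>z. k ((c \<circ> A) \<omega>, z)) \<in> borel_measurable borel"
      by (intro measurable_compose[OF measurable_Pair1' k])
    have "(\<integral>\<^sup>+z. k ((c \<circ> A) \<omega>, z N) \<partial>?dB) = (\<integral>\<^sup>+\<omega>'. k ((c \<circ> A) \<omega>, B \<omega>' N) \<partial>M)"
      by (rule nn_integral_distr) measurable
    also have "\<dots> = (\<integral>\<^sup>+z. k ((c \<circ> A) \<omega>, z) \<partial>law h)"
      unfolding B_law[symmetric]
      by (rule nn_integral_distr[symmetric]) (simp_all add: km[unfolded o_apply])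
    finally show "(\<integral>\<^sup>+z. k ((c \<circ> A) \<omega>, z N) \<partial>?dB) = (\<integral>\<^sup>+z. k ((c \<circ> A) \<omega>, z) \<partial>law h)" .
  qed
  also have "\<dots> = (\<integral>\<^sup>+\<omega>. (\<integral>\<^sup>+z. k (\<lambda>j\<in>{..N}. X (real j * \<delta>) \<omega>, z) \<partial>law h) \<partial>M)"
    using A_eq by (intro nn_integral_cong) (simp only:)
  finally show ?thesis .
qed

lemma grid_proj_measurable[measurable]:
  "j \<le> N \<Longrightarrow> (\<lambda>x. fst x j) \<in> borel_measurable (PiM {..N} (\<lambda>_. borel::'a measure) \<Otimes>\<^sub>M (borel :: 'c::topological_space measure))"
  by (rule measurable_compose[OF measurable_fst measurable_component_singleton]) auto

section \<open>Characteristic functions, symmetry and densities of the one-time laws\<close>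

abbreviation psi :: "'a \<Rightarrow> real" where "psi \<equiv> levy_exponent \<nu>"

text \<open>The characteristic function is real, so the sine integral vanishes and the phase only
  contributes the factor \<open>cos \<theta>\<close>.\<close>

lemma integral_cos_law:
  assumes "0 \<le> h"
  shows "(\<integral>z. cos (u \<bullet> z + \<theta>) \<partial>law h) = cos \<theta> * exp (- h * psi u)"
proof -
  have c: "(\<integral>\<omega>. cis (u \<bullet> X h \<omega>) \<partial>M) = complex_of_real (exp (- h * psi u))"
    using triplet assms by (simp add: has_triplet_0_nu_0_def)
  have [measurable]: "X h \<in> borel_measurable M" using assms by simp
  have i: "integrable M (\<lambda>\<omega>. cis (u \<bullet> X h \<omega>))"
    by (rule integrable_const_bound[where B=1]) (auto simp: cis_conv_exp)
  have C: "(\<integral>\<omega>. cos (u \<bullet> X h \<omega>) \<partial>M) = exp (- h * psi u)"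
    using integral_Re[OF i] c by simp
  have S: "(\<integral>\<omega>. sin (u \<bullet> X h \<omega>) \<partial>M) = 0"
    using integral_Im[OF i] c by simp
  have ic: "integrable M (\<lambda>\<omega>. cos (u \<bullet> X h \<omega>))" and isn: "integrable M (\<lambda>\<omega>. sin (u \<bullet> X h \<omega>))"
    by (rule integrable_const_bound[where B=1]; auto)+
  have "(\<integral>z. cos (u \<bullet> z + \<theta>) \<partial>law h) = (\<integral>\<omega>. cos (u \<bullet> X h \<omega>) * cos \<theta> - sin (u \<bullet> X h \<omega>) * sin \<theta> \<partial>M)"
    unfolding law_def by (subst integral_distr) (auto simp: cos_add)
  also have "\<dots> = (\<integral>\<omega>. cos (u \<bullet> X h \<omega>) \<partial>M) * cos \<theta> - (\<integral>\<omega>. sin (u \<bullet> X h \<omega>) \<partial>M) * sin \<theta>"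
    using ic isn by simp
  finally show ?thesis by (simp add: C S)
qed

lemma nn_integral_cos_law:
  assumes "0 \<le> h"
  shows "(\<integral>\<^sup>+z. ennreal (1 + cos (u \<bullet> z + \<theta>)) \<partial>law h) = ennreal (1 + cos \<theta> * exp (- h * psi u))"
proof -
  interpret L: prob_space "law h" by (rule prob_space_law) fact
  have i: "integrable (law h) (\<lambda>z. cos (u \<bullet> z + \<theta>))"
    by (rule L.integrable_const_bound[where B=1]) auto
  have "(\<integral>\<^sup>+z. ennreal (1 + cos (u \<bullet> z + \<theta>)) \<partial>law h) = ennreal (\<integral>z. 1 + cos (u \<bullet> z + \<theta>) \<partial>law h)"
    using i by (intro nn_integral_eq_integral) (auto simp: cos_plus_1_nonneg)
  also have "(\<integral>z. 1 + cos (u \<bullet> z + \<theta>) \<partial>law h) = 1 + cos \<theta> * exp (- h * psi u)"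
    using i L.prob_space by (simp add: integral_cos_law[OF assms])
  finally show ?thesis .
qed

text \<open>The exponent is even because the cosine is; uniqueness for cosine transforms then gives
  the symmetry of the law.\<close>

lemma law_reflect:
  assumes "0 \<le> h"
  shows "distr (law h) borel uminus = law h"
proof (rule measure_eqI_cos)
  interpret L: prob_space "law h" by (rule prob_space_law) fact
  show "finite_measure (law h)" by (rule L.finite_measure_axioms)
  show "finite_measure (distr (law h) borel uminus)" by (intro L.finite_measure_distr) measurable
  fix u \<theta>
  have "psi (- u) = psi u" by (simp add: levy_exponent_def)
  moreover have "(\<integral>\<^sup>+x. ennreal (1 + cos (u \<bullet> x + \<theta>)) \<partial>distr (law h) borel uminus)
    = (\<integral>\<^sup>+x. ennreal (1 + cos ((- u) \<bullet> x + \<theta>)) \<partial>law h)"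
    by (subst nn_integral_distr) auto
  ultimately show "(\<integral>\<^sup>+x. ennreal (1 + cos (u \<bullet> x + \<theta>)) \<partial>distr (law h) borel uminus) = (\<integral>\<^sup>+x. ennreal (1 + cos (u \<bullet> x + \<theta>)) \<partial>law h)"
    by (simp only: nn_integral_cos_law[OF assms])
qed auto

lemma nn_integral_law_reflect:
  assumes "0 \<le> h" and [measurable]: "f \<in> borel_measurable borel"
  shows "(\<integral>\<^sup>+z. f (- z) \<partial>law h) = (\<integral>\<^sup>+z. f z \<partial>law h)"
proof -
  have "(\<integral>\<^sup>+z. f (- z) \<partial>law h) = (\<integral>\<^sup>+z. f z \<partial>distr (law h) borel uminus)"
    by (subst nn_integral_distr) auto
  then show ?thesis by (simp only: law_reflect[OF assms(1)])
qed

lemma law_density: "0 < h \<Longrightarrow> law h = density lborel (\<lambda>z. ennreal (p h z))"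
  using dens by (simp add: law_def bounded_transition_density_def)

lemma p_nonneg: "0 < h \<Longrightarrow> 0 \<le> p h z"
  using dens by (simp add: bounded_transition_density_def)

lemma p_measurable2: "(\<lambda>(t, z). p t z) \<in> borel_measurable borel"
  using dens by (simp add: bounded_transition_density_def)

lemma p_measurable[measurable (raw)]:
  assumes "f \<in> borel_measurable N" "g \<in> borel_measurable N"
  shows "(\<lambda>x. p (f x) (g x)) \<in> borel_measurable N"
proof -
  have "(\<lambda>x. (f x, g x)) \<in> N \<rightarrow>\<^sub>M borel"
    using assms by (rule borel_measurable_Pair)
  from measurable_compose[OF this p_measurable2] show ?thesis by simp
qed

text \<open>The bound on the density may depend on time. Splitting off a last increment of length 1
  and averaging over its starting point lets the bound for \<open>p 1\<close> serve all
  \<open>s \<ge> 1\<close>.\<close>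

lemma transition_bound:
  obtains B :: real where "0 \<le> B"
    "\<And>s g x. 1 \<le> s \<Longrightarrow> g \<in> borel_measurable borel \<Longrightarrow> (\<integral>\<^sup>+\<omega>. g (x + X s \<omega>) \<partial>M) \<le> ennreal B * (\<integral>\<^sup>+z. g z \<partial>lborel)"
proof -
  obtain B where B: "\<And>z. p 1 z \<le> B"
    using dens by (fastforce simp: bounded_transition_density_def)
  have B0: "0 \<le> B" using B[of 0] p_nonneg[of 1 0] by simp
  have one: "(\<integral>\<^sup>+z. g (x + z) \<partial>law 1) \<le> ennreal B * (\<integral>\<^sup>+z. g z \<partial>lborel)"
    if [measurable]: "g \<in> borel_measurable borel" for g :: "'a \<Rightarrow> ennreal" and x
  proof -
    have "(\<integral>\<^sup>+z. g (x + z) \<partial>law 1) = (\<integral>\<^sup>+z. ennreal (p 1 z) * g (x + z) \<partial>lborel)"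
      by (subst law_density) (auto simp: nn_integral_density)
    also have "\<dots> \<le> (\<integral>\<^sup>+z. ennreal B * g (x + z) \<partial>lborel)"
      by (intro nn_integral_mono mult_right_mono ennreal_leI B) auto
    also have "\<dots> = ennreal B * (\<integral>\<^sup>+z. g (x + z) \<partial>lborel)"
      by (rule nn_integral_cmult) measurable
    also have "(\<integral>\<^sup>+z. g (x + z) \<partial>lborel) = (\<integral>\<^sup>+z. g z \<partial>lborel)"
      using nn_integral_lborel_affine[of g 1 x] by simp
    finally show ?thesis .
  qed
  have "(\<integral>\<^sup>+\<omega>. g (x + X s \<omega>) \<partial>M) \<le> ennreal B * (\<integral>\<^sup>+z. g z \<partial>lborel)"
    if s: "1 \<le> s" and [measurable]: "g \<in> borel_measurable borel" for s g x
  proof -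
    have "(\<integral>\<^sup>+\<omega>. g (x + X s \<omega>) \<partial>M) = (\<integral>\<^sup>+\<omega>. (\<lambda>(w, z). g (x + w 1 + z)) (\<lambda>j\<in>{..1}. X (real j * (s - 1)) \<omega>, X (real 1 * (s - 1) + 1) \<omega> - X (real 1 * (s - 1)) \<omega>) \<partial>M)"
      by (intro nn_integral_cong) simp
    also have "\<dots> = (\<integral>\<^sup>+\<omega>. (\<integral>\<^sup>+z. g (x + X (s - 1) \<omega> + z) \<partial>law 1) \<partial>M)"
      using s by (subst grid_markov) (auto simp: case_prod_unfold)
    also have "\<dots> \<le> (\<integral>\<^sup>+\<omega>. ennreal B * (\<integral>\<^sup>+z. g z \<partial>lborel) \<partial>M)"
      by (intro nn_integral_mono one) measurable
    also have "\<dots> = ennreal B * (\<integral>\<^sup>+z. g z \<partial>lborel)"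
      by (simp add: emeasure_space_1)
    finally show ?thesis .
  qed
  with B0 that show thesis by blast
qed

text \<open>For a small frequency \<xi> the cosine of \<open>\<xi> \<bullet> z\<close> is at least
  1/2 for all displacements \<open>z\<close> within \<open>D\<close>, whereas its mean
  \<open>exp (- s * psi \<xi>)\<close> becomes small as \<open>s\<close> grows; so mass must leave.
  Here \<open>psi \<xi> > 0\<close>, since otherwise \<open>law 1\<close> would live on the
  countably many hyperplanes where the cosine is 1, a Lebesgue null set, contrary to having a
  density.\<close>

lemma escape:
  obtains q s0 :: real where "0 \<le> q" "q < 1" "0 < s0"
    "\<And>x. x \<in> D \<Longrightarrow> (\<integral>\<^sup>+z. indicator D (x + z) \<partial>law s0) \<le> ennreal q"
proof -
  obtain R where R: "0 < R" "\<And>y. y \<in> D \<Longrightarrow> norm y \<le> R"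
    using boundedD bounded_pos by blast
  obtain b :: 'a where b: "b \<in> Basis" using nonempty_Basis by blast
  \<comment> \<open>Two points of \<open>D\<close> differ by a vector of norm at most
    \<open>2 * R\<close>; this length keeps the phase within [-1, 1].\<close>
  define \<xi> where "\<xi> = (1 / (2 * R)) *\<^sub>R b"
  have \<xi>0: "\<xi> \<noteq> 0" using R b by (auto simp: \<xi>_def)
  have \<xi>1: "\<bar>\<xi> \<bullet> z\<bar> \<le> 1" if "norm z \<le> 2 * R" for z
  proof -
    have "\<bar>\<xi> \<bullet> z\<bar> \<le> norm \<xi> * norm z" by (rule Cauchy_Schwarz_ineq2)
    also have "\<dots> \<le> norm \<xi> * (2 * R)" using that by (intro mult_left_mono) auto
    also have "\<dots> = 1" using R b by (simp add: \<xi>_def)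
    finally show ?thesis .
  qed
  have cos_half: "1 / 2 \<le> cos r" if "\<bar>r\<bar> \<le> 1" for r :: real
  proof -
    have "cos (pi / 3) \<le> cos \<bar>r\<bar>" using that pi_gt3 by (intro cos_monotone_0_pi_le) auto
    then show ?thesis by (simp add: cos_60)
  qed
  have psi_pos: "0 < psi \<xi>"
  proof (rule ccontr)
    assume "\<not> 0 < psi \<xi>"
    then have ge: "1 \<le> exp (- 1 * psi \<xi>)" by simp
    interpret L: prob_space "law 1" by (rule prob_space_law) simp
    have i: "integrable (law 1) (\<lambda>z. cos (\<xi> \<bullet> z))"
      by (rule L.integrable_const_bound[where B=1]) auto
    have "(\<integral>z. 1 - cos (\<xi> \<bullet> z) \<partial>law 1) = 1 - exp (- 1 * psi \<xi>)"
      using i integral_cos_law[of 1 \<xi> 0] L.prob_space by simp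
    moreover have "0 \<le> (\<integral>z. 1 - cos (\<xi> \<bullet> z) \<partial>law 1)" by (intro integral_nonneg_AE) auto
    ultimately have "(\<integral>z. 1 - cos (\<xi> \<bullet> z) \<partial>law 1) = 0" using ge by simp
    then have "AE z in law 1. 1 - cos (\<xi> \<bullet> z) = 0"
      using i by (subst (asm) integral_nonneg_eq_0_iff_AE) auto
    then have "AE z in lborel. ennreal (p 1 z) > 0 \<longrightarrow> 1 - cos (\<xi> \<bullet> z) = 0"
      by (subst (asm) law_density) (auto simp: AE_density)
    moreover have "AE z in lborel. cos (\<xi> \<bullet> z) \<noteq> 1"
    proof -
      have "(\<Union>n::int. {z. \<xi> \<bullet> z = of_int n * 2 * pi}) \<in> null_sets lborel"
      proof (intro null_sets_UN')
        fix n :: int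
        have "negligible {z. \<xi> \<bullet> z = of_int n * 2 * pi}" using \<xi>0 by (intro negligible_hyperplane) auto
        then show "{z. \<xi> \<bullet> z = of_int n * 2 * pi} \<in> null_sets lborel"
          by (auto simp: negligible_iff_null_sets null_sets_completion_iff closed_hyperplane)
      qed auto
      then have "AE z in lborel. z \<notin> (\<Union>n::int. {z. \<xi> \<bullet> z = of_int n * 2 * pi})" by (rule AE_not_in)
      then show ?thesis by eventually_elim (auto simp: cos_one_2pi_int)
    qed
    ultimately have "AE z in lborel. ennreal (p 1 z) = 0" by eventually_elim (auto simp: not_gr_zero[symmetric])
    then have "(\<integral>\<^sup>+z. ennreal (p 1 z) \<partial>lborel) = 0" by (subst nn_integral_0_iff_AE) auto
    moreover have "emeasure (law 1) UNIV = (\<integral>\<^sup>+z. ennreal (p 1 z) \<partial>lborel)"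
      by (subst law_density) (auto simp: emeasure_density)
    ultimately show False using L.emeasure_space_1 by simp
  qed
  \<comment> \<open>Chosen to make the mean of the cosine 1/4. With \<open>?a\<close> the mass of
    the ball, \<open>3 / 2 * ?a - 1 \<le> 1 / 4\<close> then gives \<open>?a \<le> 5 / 6\<close>,
    the value of \<open>q\<close>.\<close>
  define s0 where "s0 = ln 4 / psi \<xi>"
  have s0: "0 < s0" using psi_pos by (simp add: s0_def)
  have e: "exp (- s0 * psi \<xi>) = 1 / 4" using psi_pos by (simp add: s0_def exp_minus)
  interpret L: prob_space "law s0" by (rule prob_space_law) (use s0 in simp)
  have i: "integrable (law s0) (\<lambda>z. cos (\<xi> \<bullet> z))"
    by (rule L.integrable_const_bound[where B=1]) auto
  let ?a = "measure (law s0) (cball 0 (2 * R))"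
  have i2: "integrable (law s0) (\<lambda>z. 3 / 2 * indicator (cball 0 (2 * R)) z :: real)"
    by (intro integrable_mult_right integrable_real_indicator) (auto simp: L.emeasure_finite top.not_eq_extremum[symmetric])
  \<comment> \<open>The integrand on the right is 1/2 on the ball and -1 off it, a lower bound for
    the cosine in both cases.\<close>
  have "3 / 2 * ?a - 1 = (\<integral>z. 3 / 2 * indicator (cball 0 (2 * R)) z - 1 \<partial>law s0)"
    using L.prob_space by (subst Bochner_Integration.integral_diff[OF i2]) auto
  also have "\<dots> \<le> (\<integral>z. cos (\<xi> \<bullet> z) \<partial>law s0)"
  proof (intro integral_mono i)
    fix z
    show "3 / 2 * indicator (cball 0 (2 * R)) z - 1 \<le> cos (\<xi> \<bullet> z)"
      using cos_half[OF \<xi>1[of z]] by (auto simp: indicator_def)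
  qed (use i2 in simp)
  also have "\<dots> = 1 / 4" using integral_cos_law[of s0 \<xi> 0] s0 e by simp
  finally have a: "?a \<le> 5 / 6" by simp
  show thesis
  proof (rule that[of "5/6" s0])
    fix x assume x: "x \<in> D"
    have "(\<integral>\<^sup>+z. indicator D (x + z) \<partial>law s0) \<le> (\<integral>\<^sup>+z. indicator (cball 0 (2 * R)) z \<partial>law s0)"
    proof (intro nn_integral_mono)
      fix z
      have "norm z \<le> 2 * R" if "x + z \<in> D"
        using R(2)[OF x] R(2)[OF that] norm_triangle_ineq4[of "x + z" x] by simp
      then show "indicator D (x + z) \<le> (indicator (cball 0 (2 * R)) z :: ennreal)"
        by (auto simp: indicator_def)
    qed
    also have "\<dots> = emeasure (law s0) (cball 0 (2 * R))" by simp
    also have "\<dots> \<le> ennreal (5 / 6)" using a by (simp add: L.emeasure_eq_measure)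
    finally show "(\<integral>\<^sup>+z. indicator D (x + z) \<partial>law s0) \<le> ennreal (5/6)" .
  qed (use s0 in auto)
qed

text \<open>The closed sets \<open>F k\<close> exhaust \<open>D\<close>. Unlike \<open>D\<close> itself, each of them contains a
  right-continuous path as soon as it contains the path at all dyadic times.\<close>

definition F :: "nat \<Rightarrow> 'a set" where "F k = {y. \<forall>z\<in>-D. 1 / real (Suc k) \<le> dist y z}"

lemma F_closed: "closed (F k)"
proof -
  have "F k = (\<Inter>z\<in>-D. {y. 1 / real (Suc k) \<le> dist y z})" by (auto simp: F_def)
  then show ?thesis by (auto intro!: closed_Collect_le continuous_intros)
qed

lemma F_measurable[measurable]: "F k \<in> sets borel" using F_closed by simp

lemma F_subset: "F k \<subseteq> D"
proof
  fix y assume y: "y \<in> F k"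
  show "y \<in> D"
  proof (rule ccontr)
    assume "y \<notin> D"
    with y have "1 / real (Suc k) \<le> dist y y" unfolding F_def by blast
    then show False by simp
  qed
qed

text \<open>Consecutive levels are separated by a positive gap, so a path converging to a point of
  \<open>F k\<close> must enter \<open>F (Suc k)\<close>. This is how limits are handled although
  \<open>F k\<close> is only closed.\<close>

lemma F_thick:
  assumes "y \<in> F k" "dist y' y < 1 / real (Suc k) - 1 / real (Suc (Suc k))"
  shows "y' \<in> F (Suc k)"
  unfolding F_def
proof (intro CollectI ballI)
  fix z assume "z \<in> - D"
  then have "1 / real (Suc k) \<le> dist y z" using assms(1) by (auto simp: F_def)
  also have "\<dots> \<le> dist y' y + dist y' z" using dist_triangle[of y z y'] by (simp add: dist_commute)
  finally show "1 / real (Suc (Suc k)) \<le> dist y' z" using assms(2) by linarith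
qed

lemma F_gap: "0 < 1 / real (Suc k) - 1 / real (Suc (Suc k))"
proof -
  have "1 / real (Suc (Suc k)) < 1 / real (Suc k)" by (intro divide_strict_left_mono) auto
  then show ?thesis by simp
qed

lemma F_mono: "k \<le> l \<Longrightarrow> F k \<subseteq> F l"
proof (rule lift_Suc_mono_le[of F])
  show "F n \<subseteq> F (Suc n)" for n using F_thick[of _ n] F_gap[of n] by fastforce
qed

lemma D_eq_F: "D = (\<Union>k. F k)"
proof
  show "(\<Union>k. F k) \<subseteq> D" using F_subset by blast
  show "D \<subseteq> (\<Union>k. F k)"
  proof
    fix y assume "y \<in> D"
    then obtain e where e: "0 < e" "ball y e \<subseteq> D" using openD open_contains_ball by blast
    obtain k where k: "1 / real (Suc k) < e" using e(1) nat_approx_posE by blast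
    have "y \<in> F k" using e k by (force simp: F_def)
    then show "y \<in> (\<Union>k. F k)" by blast
  qed
qed

section \<open>The grid semigroup killed off \<open>F k\<close>\<close>

definition T :: "nat \<Rightarrow> real \<Rightarrow> ('a \<Rightarrow> ennreal) \<Rightarrow> 'a \<Rightarrow> ennreal" where
  "T k h f x = indicator (F k) x * (\<integral>\<^sup>+z. f (x + z) * indicator (F k) (x + z) \<partial>law h)"

lemma T_measurable[measurable]:
  assumes "0 \<le> h" and [measurable]: "f \<in> borel_measurable borel"
  shows "T k h f \<in> borel_measurable borel"
proof -
  interpret L: prob_space "law h" by (rule prob_space_law) fact
  show ?thesis unfolding T_def by measurable
qed

lemma T_pow_measurable[measurable]:
  "0 \<le> h \<Longrightarrow> f \<in> borel_measurable borel \<Longrightarrow> (T k h ^^ n) f \<in> borel_measurable borel"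
  by (induction n) (auto intro: T_measurable)

lemma T_mono: "(\<And>y. f y \<le> g y) \<Longrightarrow> T k h f x \<le> T k h g x"
  unfolding T_def by (intro mult_left_mono nn_integral_mono mult_right_mono) auto

lemma T_pow_mono: "(\<And>y. f y \<le> g y) \<Longrightarrow> (T k h ^^ n) f x \<le> (T k h ^^ n) g x"
  by (induction n arbitrary: x) (auto intro: T_mono)

lemma T_cmult:
  assumes "0 \<le> h" and [measurable]: "f \<in> borel_measurable borel"
  shows "T k h (\<lambda>y. c * f y) x = c * T k h f x"
  unfolding T_def by (simp add: mult.assoc nn_integral_cmult mult.left_commute)

text \<open>Translation invariance of Lebesgue measure moves the shift to the other factor with the
  opposite sign, and the symmetry of \<open>law h\<close> restores the sign. The cutoff at both ends
  in \<open>T\<close> makes the operator itself symmetric.\<close>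

lemma T_adjoint:
  assumes h: "0 \<le> h" and [measurable]: "f \<in> borel_measurable borel" "g \<in> borel_measurable borel"
  shows "(\<integral>\<^sup>+x. g x * T k h f x \<partial>lborel) = (\<integral>\<^sup>+x. T k h g x * f x \<partial>lborel)"
proof -
  interpret L: prob_space "law h" by (rule prob_space_law) fact
  interpret P: pair_sigma_finite "law h" "lborel :: 'a measure" ..
  let ?i = "\<lambda>x. indicator (F k) x :: ennreal"
  have "(\<integral>\<^sup>+x. g x * T k h f x \<partial>lborel) = (\<integral>\<^sup>+x. (\<integral>\<^sup>+z. g x * ?i x * (f (x + z) * ?i (x + z)) \<partial>law h) \<partial>lborel)"
    unfolding T_def by (intro nn_integral_cong) (simp add: nn_integral_cmult mult.assoc)
  also have "\<dots> = (\<integral>\<^sup>+z. (\<integral>\<^sup>+x. g x * ?i x * (f (x + z) * ?i (x + z)) \<partial>lborel) \<partial>law h)"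
    by (rule P.Fubini') measurable
  also have "\<dots> = (\<integral>\<^sup>+z. (\<integral>\<^sup>+x. g (x - z) * ?i (x - z) * (f x * ?i x) \<partial>lborel) \<partial>law h)"
  proof (rule nn_integral_cong)
    fix z
    have "(\<integral>\<^sup>+x. g x * ?i x * (f (x + z) * ?i (x + z)) \<partial>lborel) =
      ennreal (\<bar>1\<bar> ^ DIM('a)) * (\<integral>\<^sup>+x. g (- z + 1 *\<^sub>R x) * ?i (- z + 1 *\<^sub>R x) * (f (- z + 1 *\<^sub>R x + z) * ?i (- z + 1 *\<^sub>R x + z)) \<partial>lborel)"
      by (rule nn_integral_lborel_affine) auto
    then show "(\<integral>\<^sup>+x. g x * ?i x * (f (x + z) * ?i (x + z)) \<partial>lborel) = (\<integral>\<^sup>+x. g (x - z) * ?i (x - z) * (f x * ?i x) \<partial>lborel)"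
      by simp
  qed
  also have "\<dots> = (\<integral>\<^sup>+x. (\<integral>\<^sup>+z. g (x - z) * ?i (x - z) * (f x * ?i x) \<partial>law h) \<partial>lborel)"
    by (rule P.Fubini'[symmetric]) measurable
  also have "\<dots> = (\<integral>\<^sup>+x. T k h g x * f x \<partial>lborel)"
  proof (intro nn_integral_cong)
    fix x
    have "(\<integral>\<^sup>+z. g (x - z) * ?i (x - z) * (f x * ?i x) \<partial>law h) = (\<integral>\<^sup>+z. g (x - z) * ?i (x - z) \<partial>law h) * (f x * ?i x)"
      by (rule nn_integral_multc) measurable
    also have "(\<integral>\<^sup>+z. g (x - z) * ?i (x - z) \<partial>law h) = (\<integral>\<^sup>+z. g (x + z) * ?i (x + z) \<partial>law h)"
      using nn_integral_law_reflect[OF h, of "\<lambda>z. g (x + z) * ?i (x + z)"] by simp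
    finally show "(\<integral>\<^sup>+z. g (x - z) * ?i (x - z) * (f x * ?i x) \<partial>law h) = T k h g x * f x"
      by (simp add: T_def mult_ac)
  qed
  finally show ?thesis .
qed

lemma T_pow_adjoint:
  assumes h: "0 \<le> h" and [measurable]: "f \<in> borel_measurable borel" "g \<in> borel_measurable borel"
  shows "(\<integral>\<^sup>+x. g x * (T k h ^^ n) f x \<partial>lborel) = (\<integral>\<^sup>+x. (T k h ^^ n) g x * f x \<partial>lborel)"
  using assms(3)
proof (induction n arbitrary: g)
  case (Suc n)
  note [measurable] = Suc.prems
  have "(\<integral>\<^sup>+x. g x * (T k h ^^ Suc n) f x \<partial>lborel) = (\<integral>\<^sup>+x. T k h g x * (T k h ^^ n) f x \<partial>lborel)"
    by (simp add: T_adjoint h)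
  also have "\<dots> = (\<integral>\<^sup>+x. (T k h ^^ n) (T k h g) x * f x \<partial>lborel)"
    by (rule Suc.IH) (simp add: h)
  finally show ?case by (simp add: funpow_swap1)
qed simp

text \<open>\<open>W k h n g x\<close> is the expectation of \<open>g\<close> at time \<open>n h\<close> over the paths from \<open>x\<close> that lie in \<open>F k\<close> at the
  times \<open>0, h, \<dots>, n h\<close>; it is a power of the one-step operator \<open>T\<close>.\<close>

definition W :: "nat \<Rightarrow> real \<Rightarrow> nat \<Rightarrow> ('a \<Rightarrow> ennreal) \<Rightarrow> 'a \<Rightarrow> ennreal" where
  "W k h n g = (T k h ^^ n) (\<lambda>y. indicator (F k) y * g y)"

lemma W_measurable[measurable]:
  "0 \<le> h \<Longrightarrow> g \<in> borel_measurable borel \<Longrightarrow> W k h n g \<in> borel_measurable borel"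
  unfolding W_def by (intro T_pow_measurable) auto

lemma W_supp: "indicator (F k) y * W k h n g y = W k h n g y"
  by (cases n) (auto simp: W_def T_def indicator_def)

lemma W_add: "W k h (m + n) g = W k h m (W k h n g)"
  unfolding W_def[of k h m] W_supp by (simp add: W_def funpow_add)

lemma W_mono: "(\<And>y. f y \<le> g y) \<Longrightarrow> W k h n f x \<le> W k h n g x"
  unfolding W_def by (intro T_pow_mono mult_left_mono) auto

lemma W_cmult:
  assumes "0 \<le> h" "g \<in> borel_measurable borel"
  shows "W k h n (\<lambda>y. c * g y) x = c * W k h n g x"
proof (induction n arbitrary: x)
  case (Suc n)
  then have "W k h n (\<lambda>y. c * g y) = (\<lambda>x. c * W k h n g x)" by auto
  then show ?case using assms by (simp add: W_def T_cmult)
qed (simp add: W_def mult.left_commute)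

text \<open>Time reversal: integrating over the starting point exchanges the two ends of the path.
  In \<open>Q_three_step\<close> this turns the last third of a path into a survival probability
  started at its end point.\<close>

lemma W_adjoint:
  assumes h: "0 \<le> h" and [measurable]: "g \<in> borel_measurable borel"
  shows "(\<integral>\<^sup>+x. W k h n g x \<partial>lborel) = (\<integral>\<^sup>+x. W k h n (\<lambda>_. 1) x * g x \<partial>lborel)"
proof -
  have "(\<integral>\<^sup>+x. W k h n g x \<partial>lborel) = (\<integral>\<^sup>+x. indicator (F k) x * W k h n g x \<partial>lborel)"
    by (simp only: W_supp)
  also have "\<dots> = (\<integral>\<^sup>+x. (T k h ^^ n) (indicator (F k)) x * (indicator (F k) x * g x) \<partial>lborel)"
    unfolding W_def using h by (intro T_pow_adjoint) auto
  also have "\<dots> = (\<integral>\<^sup>+x. W k h n (\<lambda>_. 1) x * g x \<partial>lborel)"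
  proof (rule nn_integral_cong)
    fix x
    have "(T k h ^^ n) (indicator (F k)) = W k h n (\<lambda>_. 1)" by (simp add: W_def)
    then show "(T k h ^^ n) (indicator (F k)) x * (indicator (F k) x * g x) = W k h n (\<lambda>_. 1) x * g x"
      using W_supp[of k x h n "\<lambda>_. 1"] by (metis mult.assoc mult.commute)
  qed
  finally show ?thesis .
qed

text \<open>The induction peels off the last step, because \<open>grid_markov\<close> integrates out
  the final increment given the past; the induction hypothesis is then applied to \<open>Tg\<close>
  in place of \<open>g\<close>.\<close>

lemma W_eq_expectation:
  assumes h: "0 \<le> h" and "g \<in> borel_measurable borel"
  shows "(\<integral>\<^sup>+\<omega>. (\<Prod>j\<le>N. indicator (F k) (x + X (real j * h) \<omega>)) * g (x + X (real N * h) \<omega>) \<partial>M) = W k h N g x"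
  using assms(2)
proof (induction N arbitrary: g)
  case 0
  have "(\<integral>\<^sup>+\<omega>. (\<Prod>j\<le>0. indicator (F k) (x + X (real j * h) \<omega>)) * g (x + X (real 0 * h) \<omega>) \<partial>M)
    = (\<integral>\<^sup>+\<omega>. indicator (F k) x * g x \<partial>M)" by (intro nn_integral_cong) simp
  then show ?case by (simp add: W_def emeasure_space_1)
next
  case (Suc N)
  note [measurable] = Suc.prems
  let ?i = "\<lambda>x. indicator (F k) x :: ennreal"
  interpret L: prob_space "law h" by (rule prob_space_law) fact
  define Tg where "Tg = T k h (\<lambda>y. ?i y * g y)"
  have [measurable]: "Tg \<in> borel_measurable borel" unfolding Tg_def using h by measurable
  let ?k = "\<lambda>(w, z). (\<Prod>j\<le>N. ?i (x + w j)) * (?i (x + w N + z) * g (x + w N + z))"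
  have "(\<integral>\<^sup>+\<omega>. (\<Prod>j\<le>Suc N. ?i (x + X (real j * h) \<omega>)) * g (x + X (real (Suc N) * h) \<omega>) \<partial>M)
    = (\<integral>\<^sup>+\<omega>. ?k (\<lambda>j\<in>{..N}. X (real j * h) \<omega>, X (real N * h + h) \<omega> - X (real N * h) \<omega>) \<partial>M)"
    by (intro nn_integral_cong) (simp add: algebra_simps)
  also have "\<dots> = (\<integral>\<^sup>+\<omega>. (\<integral>\<^sup>+z. ?k (\<lambda>j\<in>{..N}. X (real j * h) \<omega>, z) \<partial>law h) \<partial>M)"
    using h by (intro grid_markov) (auto simp: case_prod_unfold)
  also have "\<dots> = (\<integral>\<^sup>+\<omega>. (\<Prod>j\<le>N. ?i (x + X (real j * h) \<omega>)) * Tg (x + X (real N * h) \<omega>) \<partial>M)"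
  proof (intro nn_integral_cong)
    fix \<omega>
    have "(\<integral>\<^sup>+z. ?k (\<lambda>j\<in>{..N}. X (real j * h) \<omega>, z) \<partial>law h) =
      (\<Prod>j\<le>N. ?i (x + X (real j * h) \<omega>)) * (\<integral>\<^sup>+z. ?i (x + X (real N * h) \<omega> + z) * g (x + X (real N * h) \<omega> + z) \<partial>law h)"
      by (simp add: nn_integral_cmult)
    also have "\<dots> = (\<Prod>j\<le>N. ?i (x + X (real j * h) \<omega>)) * Tg (x + X (real N * h) \<omega>)"
    proof (cases "x + X (real N * h) \<omega> \<in> F k")
      case True
      then show ?thesis
        unfolding Tg_def T_def
        by (intro arg_cong2[where f="(*)"] refl) (auto intro!: nn_integral_cong simp: indicator_def)
    next
      case False
      then have "(\<Prod>j\<le>N. ?i (x + X (real j * h) \<omega>)) = 0" by (auto simp: prod_indicator)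
      then show ?thesis by (simp only: mult_zero_left)
    qed
    finally show "(\<integral>\<^sup>+z. ?k (\<lambda>j\<in>{..N}. X (real j * h) \<omega>, z) \<partial>law h) = (\<Prod>j\<le>N. ?i (x + X (real j * h) \<omega>)) * Tg (x + X (real N * h) \<omega>)" .
  qed
  also have "\<dots> = W k h N Tg x" by (rule Suc.IH) measurable
  also have "\<dots> = W k h (Suc N) g x"
  proof -
    \<comment> \<open>\<open>Tg\<close> already vanishes off \<open>F k\<close>, so the terminal
      cutoff in \<open>W\<close> does not change it.\<close>
    have "(\<lambda>y. ?i y * Tg y) = Tg" by (auto simp: Tg_def T_def indicator_def)
    then show ?thesis by (simp add: W_def Tg_def funpow_swap1)
  qed
  finally show ?case .
qed

lemma W_le_transition:
  assumes h: "0 \<le> h" and [measurable]: "g \<in> borel_measurable borel"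
  shows "W k h N g x \<le> (\<integral>\<^sup>+\<omega>. g (x + X (real N * h) \<omega>) \<partial>M)"
  unfolding W_eq_expectation[OF assms, symmetric]
  by (intro nn_integral_mono) (simp add: prod_indicator)

end

section \<open>Exit times and the killed semigroup\<close>

context levy_domain
begin

text \<open>Approximating times may equal \<open>t\<close> itself, about which
  \<open>at_right t\<close> says nothing; hence the separate statement.\<close>

lemma right_continuous_path:
  assumes "\<omega> \<in> space M" "0 \<le> t" "(s \<longlongrightarrow> t) G" "\<forall>\<^sub>F n in G. t \<le> s n"
  shows "((\<lambda>n. X (s n) \<omega>) \<longlongrightarrow> X t \<omega>) G"
proof (rule topological_tendstoI)
  fix S assume S: "open S" "X t \<omega> \<in> S"
  have "((\<lambda>t. X t \<omega>) \<longlongrightarrow> X t \<omega>) (at_right t)"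
    using levy assms(1,2) by (simp add: levy_process_def cadlag_path_def continuous_within)
  then have "\<forall>\<^sub>F u in at_right t. X u \<omega> \<in> S" using S by (rule topological_tendstoD)
  then obtain b where b: "t < b" "\<And>u. t < u \<Longrightarrow> u < b \<Longrightarrow> X u \<omega> \<in> S"
    by (auto simp: eventually_at_right_field)
  have "\<forall>\<^sub>F n in G. s n < b" using assms(3) b(1) by (rule order_tendstoD)
  with assms(4) show "\<forall>\<^sub>F n in G. X (s n) \<omega> \<in> S"
    by eventually_elim (use b S in \<open>metis order_le_less\<close>)
qed

lemma left_limit_path:
  assumes "\<omega> \<in> space M" "0 < t"
  obtains l where "((\<lambda>t. X t \<omega>) \<longlongrightarrow> l) (at_left t)"
proof -
  have "cadlag_path (\<lambda>t. X t \<omega>)" using levy assms(1) by (simp add: levy_process_def)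
  then show thesis using that assms(2) unfolding cadlag_path_def by blast
qed

text \<open>Rounding up: dyadic times must approach from above, the side on which paths are
  continuous.\<close>

definition grid_index :: "nat \<Rightarrow> real \<Rightarrow> nat" where "grid_index n s = nat \<lceil>s * 2 ^ n\<rceil>"

lemma grid_index_bounds:
  assumes "0 \<le> s"
  shows "s \<le> real (grid_index n s) / 2 ^ n" "real (grid_index n s) / 2 ^ n \<le> s + 1 / 2 ^ n"
proof -
  have "real (grid_index n s) = of_int \<lceil>s * 2 ^ n\<rceil>" using assms by (simp add: grid_index_def)
  then have "s * 2 ^ n \<le> real (grid_index n s)" "real (grid_index n s) \<le> s * 2 ^ n + 1" by linarith+
  then show "s \<le> real (grid_index n s) / 2 ^ n" "real (grid_index n s) / 2 ^ n \<le> s + 1 / 2 ^ n"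
    by (simp_all add: field_simps)
qed

lemma grid_index_tendsto: "0 \<le> s \<Longrightarrow> (\<lambda>n. real (grid_index n s) / 2 ^ n) \<longlonglongrightarrow> s"
proof (rule tendsto_sandwich[of "\<lambda>_. s" _ _ "\<lambda>n. s + 1 / 2 ^ n"])
  have "(\<lambda>n. (1 / 2 :: real) ^ n) \<longlonglongrightarrow> 0" by (rule LIMSEQ_realpow_zero) auto
  then have "(\<lambda>n. s + (1 / 2) ^ n) \<longlonglongrightarrow> s + 0" by (intro tendsto_add tendsto_const)
  then show "(\<lambda>n. s + 1 / 2 ^ n) \<longlonglongrightarrow> s" by (simp add: power_one_over)
qed (use grid_index_bounds in auto)

text \<open>A countable infimum is measurable, also jointly with the starting point. Time 0 counts
  here, unlike in \<open>exit_time\<close>, so that \<open>D_exit x\<close> vanishes for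
  \<open>x\<close> outside \<open>D\<close>.\<close>

definition grid_exit :: "nat \<Rightarrow> nat \<Rightarrow> 'a \<Rightarrow> 'b \<Rightarrow> ennreal" where
  "grid_exit k n x \<omega> = (INF j. if x + X (real j / 2 ^ n) \<omega> \<notin> F k then ennreal (real j / 2 ^ n) else top)"

definition F_exit :: "nat \<Rightarrow> 'a \<Rightarrow> 'b \<Rightarrow> ennreal" where
  "F_exit k x \<omega> = (INF n. grid_exit k n x \<omega>)"

text \<open>A measurable substitute for \<open>exit_time\<close>. By \<open>less_D_exit_iff\<close>
  it exceeds \<open>t\<close> exactly when the path on [0, t] keeps a positive distance from the
  complement of \<open>D\<close>. It can be strictly earlier than the exit time when a left limit of
  the path touches the boundary; \<open>quasi_left_continuity\<close> shows that this almost surely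
  does not happen.\<close>

definition D_exit :: "'a \<Rightarrow> 'b \<Rightarrow> ennreal" where
  "D_exit x \<omega> = (SUP k. F_exit k x \<omega>)"

lemma grid_exit_measurable2[measurable]:
  "(\<lambda>z. grid_exit k n (fst z) (snd z)) \<in> borel_measurable (borel \<Otimes>\<^sub>M M)"
  unfolding grid_exit_def by measurable

lemma grid_exit_measurable[measurable]: "grid_exit k n x \<in> borel_measurable M"
  unfolding grid_exit_def by measurable

lemma F_exit_measurable[measurable]: "F_exit k x \<in> borel_measurable M"
  unfolding F_exit_def by measurable

lemma D_exit_measurable[measurable]: "D_exit x \<in> borel_measurable M"
  unfolding D_exit_def by measurable

lemma D_exit_measurable2[measurable]:
  "(\<lambda>z. D_exit (fst z) (snd z)) \<in> borel_measurable (borel \<Otimes>\<^sub>M M)"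
  unfolding D_exit_def F_exit_def by measurable

lemma grid_exit_le: "x + X (real j / 2 ^ n) \<omega> \<notin> F k \<Longrightarrow> grid_exit k n x \<omega> \<le> ennreal (real j / 2 ^ n)"
  unfolding grid_exit_def by (rule INF_lower2[of j]) auto

lemma F_exit_le: "x + X (real j / 2 ^ n) \<omega> \<notin> F k \<Longrightarrow> F_exit k x \<omega> \<le> ennreal (real j / 2 ^ n)"
  unfolding F_exit_def by (rule INF_lower2[of n]) (auto intro: grid_exit_le)

lemma grid_exit_antimono: "decseq (\<lambda>n. grid_exit k n x \<omega>)"
proof (rule decseq_SucI)
  fix n
  show "grid_exit k (Suc n) x \<omega> \<le> grid_exit k n x \<omega>"
    unfolding grid_exit_def[of k n]
  proof (rule INF_greatest)
    fix j
    have "real (2 * j) / 2 ^ Suc n = real j / 2 ^ n" by simp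
    then show "grid_exit k (Suc n) x \<omega> \<le> (if x + X (real j / 2 ^ n) \<omega> \<notin> F k then ennreal (real j / 2 ^ n) else top)"
      using grid_exit_le[of x "2 * j" "Suc n" \<omega> k] by (metis top_greatest)
  qed
qed

lemma grid_exit_tendsto: "(\<lambda>n. grid_exit k n x \<omega>) \<longlonglongrightarrow> F_exit k x \<omega>"
  unfolding F_exit_def by (rule LIMSEQ_INF[OF grid_exit_antimono])

lemma F_exit_le_grid: "F_exit k x \<omega> \<le> grid_exit k n x \<omega>"
  unfolding F_exit_def by (rule INF_lower) simp

lemma F_exit_mono: "incseq (\<lambda>k. F_exit k x \<omega>)"
proof (rule monoI)
  fix k l :: nat assume "k \<le> l"
  then have "F k \<subseteq> F l" by (rule F_mono)
  then show "F_exit k x \<omega> \<le> F_exit l x \<omega>"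
    unfolding F_exit_def grid_exit_def by (intro INF_mono' ) auto
qed

lemma F_exit_tendsto: "(\<lambda>k. F_exit k x \<omega>) \<longlonglongrightarrow> D_exit x \<omega>"
  unfolding D_exit_def by (rule LIMSEQ_SUP[OF F_exit_mono])

lemma F_exit_le_D: "F_exit k x \<omega> \<le> D_exit x \<omega>"
  unfolding D_exit_def by (rule SUP_upper) simp

section \<open>Paths that remain in a closed level, and their grid approximation\<close>

definition stay :: "nat \<Rightarrow> real \<Rightarrow> 'a \<Rightarrow> 'b \<Rightarrow> bool" where
  "stay k t x \<omega> \<longleftrightarrow> (\<forall>s\<in>{0..t}. x + X s \<omega> \<in> F k)"

lemma stay_mono: "k \<le> l \<Longrightarrow> stay k t x \<omega> \<Longrightarrow> stay l t x \<omega>"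
  using F_mono unfolding stay_def by blast

lemma closed_path_limit:
  assumes "\<omega> \<in> space M" "0 \<le> s" "r \<longlonglongrightarrow> s" "\<And>n. s \<le> r n" "\<forall>\<^sub>F n in sequentially. x + X (r n) \<omega> \<in> F k"
  shows "x + X s \<omega> \<in> F k"
proof (rule Lim_in_closed_set[OF F_closed assms(5)])
  show "(\<lambda>n. x + X (r n) \<omega>) \<longlonglongrightarrow> x + X s \<omega>"
    by (intro tendsto_intros right_continuous_path assms) (use assms(4) in auto)
qed simp

lemma less_F_exit_imp_stay:
  assumes "\<omega> \<in> space M" "ennreal t < F_exit k x \<omega>"
  shows "stay k t x \<omega>"
  unfolding stay_def
proof
  fix s assume s: "s \<in> {0..t}"
  show "x + X s \<omega> \<in> F k"
  proof (rule closed_path_limit[where r="\<lambda>n. real (grid_index n s) / 2 ^ n"])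
    have "ennreal s < F_exit k x \<omega>" using s assms(2) by (meson atLeastAtMost_iff ennreal_leI le_less_trans)
    moreover have "(\<lambda>n. ennreal (real (grid_index n s) / 2 ^ n)) \<longlonglongrightarrow> ennreal s"
      using s by (intro tendsto_ennrealI grid_index_tendsto) simp
    ultimately have "\<forall>\<^sub>F n in sequentially. ennreal (real (grid_index n s) / 2 ^ n) < F_exit k x \<omega>"
      by (rule order_tendstoD(2)[rotated])
    then show "\<forall>\<^sub>F n in sequentially. x + X (real (grid_index n s) / 2 ^ n) \<omega> \<in> F k"
      by eventually_elim (use F_exit_le not_less in blast)
  qed (use s assms grid_index_tendsto grid_index_bounds in auto)
qed

lemma stay_imp_le_F_exit:
  assumes "stay k t x \<omega>"
  shows "ennreal t \<le> F_exit k x \<omega>"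
  unfolding F_exit_def grid_exit_def
proof (intro INF_greatest)
  fix n j
  show "ennreal t \<le> (if x + X (real j / 2 ^ n) \<omega> \<notin> F k then ennreal (real j / 2 ^ n) else top)"
  proof (cases "x + X (real j / 2 ^ n) \<omega> \<in> F k")
    case False
    then have "\<not> real j / 2 ^ n \<le> t" using assms by (auto simp: stay_def)
    then show ?thesis using False by (auto intro: ennreal_leI)
  qed simp
qed

text \<open>Strict inequality costs one level: by right-continuity the path stays within the gap
  between \<open>F k\<close> and \<open>F (Suc k)\<close> for a short time after
  \<open>t\<close>.\<close>

lemma stay_imp_less_F_exit:
  assumes "\<omega> \<in> space M" "0 \<le> t" "stay k t x \<omega>"
  shows "ennreal t < F_exit (Suc k) x \<omega>"
proof -
  have "((\<lambda>u. x + X u \<omega>) \<longlongrightarrow> x + X t \<omega>) (at_right t)"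
    by (intro tendsto_intros right_continuous_path assms) (auto simp: eventually_at_right_less intro: eventually_mono[OF eventually_at_right_less])
  then have "\<forall>\<^sub>F u in at_right t. dist (x + X u \<omega>) (x + X t \<omega>) < 1 / real (Suc k) - 1 / real (Suc (Suc k))"
    using F_gap by (rule tendstoD)
  then obtain b where b: "t < b" "\<And>u. t < u \<Longrightarrow> u < b \<Longrightarrow> dist (x + X u \<omega>) (x + X t \<omega>) < 1 / real (Suc k) - 1 / real (Suc (Suc k))"
    by (auto simp: eventually_at_right_field)
  have "stay (Suc k) ((t + b) / 2) x \<omega>"
    unfolding stay_def
  proof
    fix s assume s: "s \<in> {0..(t + b) / 2}"
    show "x + X s \<omega> \<in> F (Suc k)"
    proof (cases "s \<le> t")
      case True
      then show ?thesis using assms(3) s F_mono[of k "Suc k"] by (auto simp: stay_def)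
    next
      case False
      then show ?thesis using s b assms(2,3) by (intro F_thick[of "x + X t \<omega>"] b(2)) (auto simp: stay_def)
    qed
  qed
  then have "ennreal ((t + b) / 2) \<le> F_exit (Suc k) x \<omega>" by (rule stay_imp_le_F_exit)
  moreover have "ennreal t < ennreal ((t + b) / 2)" using assms(2) b by (simp add: ennreal_less_iff)
  ultimately show ?thesis by simp
qed

lemma less_D_exit_iff:
  assumes "\<omega> \<in> space M" "0 \<le> t"
  shows "ennreal t < D_exit x \<omega> \<longleftrightarrow> (\<exists>k. stay k t x \<omega>)"
proof
  assume "ennreal t < D_exit x \<omega>"
  then obtain k where "ennreal t < F_exit k x \<omega>" by (auto simp: D_exit_def less_SUP_iff)
  then show "\<exists>k. stay k t x \<omega>" using less_F_exit_imp_stay assms by blast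
next
  assume "\<exists>k. stay k t x \<omega>"
  then obtain k where "stay k t x \<omega>" by blast
  then have "ennreal t < F_exit (Suc k) x \<omega>" using stay_imp_less_F_exit assms by blast
  then show "ennreal t < D_exit x \<omega>" using F_exit_le_D by (rule less_le_trans)
qed

text \<open>The grid is scaled by \<open>t\<close> so that \<open>t\<close> itself is a grid point
  and \<open>2 ^ n\<close> steps of \<open>W\<close> end exactly there.\<close>

lemma stay_iff_grid:
  assumes "\<omega> \<in> space M" "0 \<le> t"
  shows "stay k t x \<omega> \<longleftrightarrow> (\<forall>n. \<forall>j\<le>2 ^ n. x + X (real j * (t / 2 ^ n)) \<omega> \<in> F k)"
proof
  assume *: "stay k t x \<omega>"
  show "\<forall>n. \<forall>j\<le>2 ^ n. x + X (real j * (t / 2 ^ n)) \<omega> \<in> F k"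
  proof (intro allI impI)
    fix n j :: nat assume "j \<le> 2 ^ n"
    then have "real j \<le> 2 ^ n" by (metis of_nat_le_iff of_nat_numeral of_nat_power)
    then have "real j * (t / 2 ^ n) \<le> t"
      using assms(2) by (simp add: field_simps mult_left_mono)
    then show "x + X (real j * (t / 2 ^ n)) \<omega> \<in> F k" using * assms(2) by (simp add: stay_def)
  qed
next
  assume *: "\<forall>n. \<forall>j\<le>2 ^ n. x + X (real j * (t / 2 ^ n)) \<omega> \<in> F k"
  show "stay k t x \<omega>"
    unfolding stay_def
  proof
    fix s assume s: "s \<in> {0..t}"
    show "x + X s \<omega> \<in> F k"
    proof (cases "t = 0")
      case True
      then show ?thesis using s *[rule_format, of 0 0] by simp
    next
      case False
      \<comment> \<open>In units of \<open>t\<close> the time lies in [0, 1], so rounding up never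
        passes the last index \<open>2 ^ n\<close>.\<close>
      define u where "u = s / t"
      have u: "0 \<le> u" "u \<le> 1" using s False assms(2) by (auto simp: u_def)
      have le: "grid_index n u \<le> 2 ^ n" for n
      proof -
        have "\<lceil>u * 2 ^ n\<rceil> \<le> \<lceil>(2::real) ^ n\<rceil>" using u by (intro ceiling_mono) simp
        also have "\<lceil>(2::real) ^ n\<rceil> = 2 ^ n" using ceiling_of_int[of "2 ^ n"] by (simp del: ceiling_of_int)
        finally show ?thesis by (simp add: grid_index_def nat_le_iff)
      qed
      show ?thesis
      proof (rule closed_path_limit[where r="\<lambda>n. real (grid_index n u) * (t / 2 ^ n)"])
        have "(\<lambda>n. real (grid_index n u) / 2 ^ n * t) \<longlonglongrightarrow> u * t" by (intro tendsto_intros grid_index_tendsto u)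
        then show "(\<lambda>n. real (grid_index n u) * (t / 2 ^ n)) \<longlonglongrightarrow> s" using False by (simp add: u_def)
        show "s \<le> real (grid_index n u) * (t / 2 ^ n)" for n
          using mult_right_mono[OF grid_index_bounds(1)[OF u(1), of n] assms(2)] False by (simp add: u_def)
      qed (use s assms * le in auto)
    qed
  qed
qed

lemma grid_event_antimono:
  assumes "\<forall>j\<le>2 ^ Suc n. x + X (real j * (t / 2 ^ Suc n)) \<omega> \<in> A" "j \<le> 2 ^ n"
  shows "x + X (real j * (t / 2 ^ n)) \<omega> \<in> A"
proof -
  have "real (2 * j) * (t / 2 ^ Suc n) = real j * (t / 2 ^ n)" by simp
  then show ?thesis using assms(1)[rule_format, of "2 * j"] assms(2) by simp
qed

lemma stay_measurable[measurable]: "0 \<le> t \<Longrightarrow> Measurable.pred M (\<lambda>\<omega>. stay k t x \<omega>)"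
proof -
  assume t: "0 \<le> t"
  then have "Measurable.pred M (\<lambda>\<omega>. stay k t x \<omega>) \<longleftrightarrow>
     Measurable.pred M (\<lambda>\<omega>. \<forall>n. \<forall>j\<le>2 ^ n. x + X (real j * (t / 2 ^ n)) \<omega> \<in> F k)"
    by (intro measurable_cong stay_iff_grid)
  also have "\<dots>"
  proof -
    have [measurable]: "X (real j * (t / 2 ^ n)) \<in> borel_measurable M" for j n
      using t by (intro X_measurable) simp
    show ?thesis by measurable
  qed
  finally show ?thesis .
qed

text \<open>Halving the mesh shrinks the grid events down to \<open>stay\<close>. The bound on
  \<open>g\<close> makes the first integral finite, which monotone convergence from above
  requires.\<close>

lemma stay_expectation:
  assumes t: "0 \<le> t" and [measurable]: "g \<in> borel_measurable borel" and g1: "\<And>y. g y \<le> 1"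
  shows "(\<integral>\<^sup>+\<omega>. indicator {\<omega>. stay k t x \<omega>} \<omega> * g (x + X t \<omega>) \<partial>M) = (INF n. W k (t / 2 ^ n) (2 ^ n) g x)"
proof -
  let ?f = "\<lambda>n \<omega>. (\<Prod>j\<le>2 ^ n. indicator (F k) (x + X (real j * (t / 2 ^ n)) \<omega>)) * g (x + X t \<omega>) :: ennreal"
  have W: "W k (t / 2 ^ n) (2 ^ n) g x = (\<integral>\<^sup>+\<omega>. ?f n \<omega> \<partial>M)" for n
    using W_eq_expectation[of "t / 2 ^ n" g k x "2 ^ n"] t by simp
  have [measurable]: "X (real j * (t / 2 ^ n)) \<in> borel_measurable M" "X t \<in> borel_measurable M" for j n
    using t by (intro X_measurable; simp)+
  have meas[measurable]: "?f n \<in> borel_measurable M" for n by measurable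
  have "(INF n. (\<integral>\<^sup>+\<omega>. ?f n \<omega> \<partial>M)) = (\<integral>\<^sup>+\<omega>. (INF n. ?f n \<omega>) \<partial>M)"
  proof (rule nn_integral_monotone_convergence_INF_decseq[symmetric, where i=0])
    show "decseq (\<lambda>n. ?f n)"
    proof (rule decseq_SucI, rule le_funI)
      fix n \<omega>
      show "?f (Suc n) \<omega> \<le> ?f n \<omega>"
        using grid_event_antimono[of n x t \<omega> "F k"] by (auto simp: prod_indicator simp del: power_Suc)
    qed
    have "(\<integral>\<^sup>+\<omega>. ?f 0 \<omega> \<partial>M) \<le> (\<integral>\<^sup>+\<omega>. 1 \<partial>M)"
      using g1 by (intro nn_integral_mono) (auto simp: prod_indicator)
    then show "(\<integral>\<^sup>+\<omega>. ?f 0 \<omega> \<partial>M) < \<infinity>" by (simp add: emeasure_space_1 le_less_trans)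
  qed (rule meas)
  also have "\<dots> = (\<integral>\<^sup>+\<omega>. indicator {\<omega>. stay k t x \<omega>} \<omega> * g (x + X t \<omega>) \<partial>M)"
  proof (rule nn_integral_cong)
    fix \<omega> assume \<omega>: "\<omega> \<in> space M"
    show "(INF n. ?f n \<omega>) = indicator {\<omega>. stay k t x \<omega>} \<omega> * g (x + X t \<omega>)"
    proof (cases "stay k t x \<omega>")
      case True
      then have "?f n \<omega> = g (x + X t \<omega>)" for n
        using stay_iff_grid[OF \<omega> t] by (auto simp: prod_indicator)
      then show ?thesis using True by simp
    next
      case False
      then obtain n j where "j \<le> 2 ^ n" "x + X (real j * (t / 2 ^ n)) \<omega> \<notin> F k"
        using stay_iff_grid[OF \<omega> t] by blast
      then have "?f n \<omega> = 0" by (auto simp: prod_indicator)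
      then have "(INF n. ?f n \<omega>) \<le> 0" by (intro INF_lower2[of n]) auto
      then show ?thesis using False by simp
    qed
  qed
  finally show ?thesis by (simp add: W)
qed

text \<open>\<open>Q t x g\<close> is the killed semigroup, \<open>E\<^sup>x[g(X\<^sub>t); t < \<tau>\<^sub>D]\<close>.\<close>

definition Q :: "real \<Rightarrow> 'a \<Rightarrow> ('a \<Rightarrow> ennreal) \<Rightarrow> ennreal" where
  "Q t x g = (\<integral>\<^sup>+\<omega>. indicator {\<omega>. ennreal t < D_exit x \<omega>} \<omega> * g (x + X t \<omega>) \<partial>M)"

text \<open>For fixed \<open>k\<close> the grid expressions decrease as the mesh is refined, and the
  resulting limits increase with \<open>k\<close>. Through this formula inequalities for
  \<open>W\<close> pass to the killed semigroup.\<close>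

lemma Q_eq_SUP_INF:
  assumes t: "0 \<le> t" and [measurable]: "g \<in> borel_measurable borel" and g1: "\<And>y. g y \<le> 1"
  shows "Q t x g = (SUP k. INF n. W k (t / 2 ^ n) (2 ^ n) g x)"
proof -
  have "(SUP k. INF n. W k (t / 2 ^ n) (2 ^ n) g x) =
    (SUP k. \<integral>\<^sup>+\<omega>. indicator {\<omega>. stay k t x \<omega>} \<omega> * g (x + X t \<omega>) \<partial>M)"
    by (simp add: stay_expectation[OF assms])
  also have "\<dots> = (\<integral>\<^sup>+\<omega>. (SUP k. indicator {\<omega>. stay k t x \<omega>} \<omega> * g (x + X t \<omega>)) \<partial>M)"
  proof (rule nn_integral_monotone_convergence_SUP[symmetric])
    show "incseq (\<lambda>k \<omega>. indicator {\<omega>. stay k t x \<omega>} \<omega> * g (x + X t \<omega>))"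
      using stay_mono by (auto simp: incseq_def le_fun_def indicator_def)
  qed (use t in measurable)
  also have "\<dots> = Q t x g"
    unfolding Q_def
  proof (rule nn_integral_cong)
    fix \<omega> assume \<omega>: "\<omega> \<in> space M"
    show "(SUP k. indicator {\<omega>. stay k t x \<omega>} \<omega> * g (x + X t \<omega>)) = indicator {\<omega>. ennreal t < D_exit x \<omega>} \<omega> * g (x + X t \<omega>)"
    proof (cases "\<exists>k. stay k t x \<omega>")
      case True
      then obtain k where k: "stay k t x \<omega>" by blast
      have "(SUP k. indicator {\<omega>. stay k t x \<omega>} \<omega> * g (x + X t \<omega>)) = g (x + X t \<omega>)"
      proof (rule antisym)
        show "(SUP k. indicator {\<omega>. stay k t x \<omega>} \<omega> * g (x + X t \<omega>)) \<le> g (x + X t \<omega>)"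
          by (rule SUP_least) (auto simp: indicator_def)
        show "g (x + X t \<omega>) \<le> (SUP k. indicator {\<omega>. stay k t x \<omega>} \<omega> * g (x + X t \<omega>))"
          using k by (intro SUP_upper2[of k]) auto
      qed
      then show ?thesis using less_D_exit_iff[OF \<omega> t] True by simp
    next
      case False
      then show ?thesis using less_D_exit_iff[OF \<omega> t] by simp
    qed
  qed
  finally show ?thesis ..
qed

lemma Q_1_measurable[measurable]: "(\<lambda>x. Q t x (\<lambda>_. 1)) \<in> borel_measurable borel"
proof -
  have "(\<lambda>x. Q t x (\<lambda>_. 1)) = (\<lambda>x. \<integral>\<^sup>+\<omega>. (if ennreal t < D_exit (fst (x, \<omega>)) (snd (x, \<omega>)) then 1 else 0) \<partial>M)"
    unfolding Q_def by (auto intro!: nn_integral_cong)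
  also have "\<dots> \<in> borel_measurable borel"
    by (rule borel_measurable_nn_integral) measurable
  finally show ?thesis .
qed

lemma W_dyadic_tendsto:
  assumes "0 \<le> t"
  shows "(\<lambda>n. W k (t / 2 ^ n) (2 ^ n) (\<lambda>_. 1) y) \<longlonglongrightarrow> (INF n. W k (t / 2 ^ n) (2 ^ n) (\<lambda>_. 1) y)"
proof (rule LIMSEQ_INF, rule decseq_SucI)
  fix n
  have e: "W k (t / 2 ^ n) (2 ^ n) (\<lambda>_. 1) y = (\<integral>\<^sup>+\<omega>. (\<Prod>j\<le>2 ^ n. indicator (F k) (y + X (real j * (t / 2 ^ n)) \<omega>)) * 1 \<partial>M)" for n
    using assms by (subst W_eq_expectation) auto
  show "W k (t / 2 ^ Suc n) (2 ^ Suc n) (\<lambda>_. 1) y \<le> W k (t / 2 ^ n) (2 ^ n) (\<lambda>_. 1) y"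
    unfolding e using grid_event_antimono[of n y t _ "F k"]
    by (intro nn_integral_mono) (auto simp: prod_indicator simp del: power_Suc)
qed

text \<open>The path of length \<open>3 * s\<close> is cut into thirds. The first contributes
  survival from \<open>x\<close>, the middle one the density bound \<open>B\<close>, and the last
  one, reversed in time, survival from the end point \<open>y\<close>.\<close>

lemma Q_three_step:
  assumes B: "\<And>s g x. 1 \<le> s \<Longrightarrow> g \<in> borel_measurable borel \<Longrightarrow> (\<integral>\<^sup>+\<omega>. g (x + X s \<omega>) \<partial>M) \<le> ennreal B * (\<integral>\<^sup>+z. g z \<partial>lborel)"
    and s: "1 \<le> s" and [measurable]: "A \<in> sets borel"
  shows "Q (3 * s) x (indicator A) \<le> (\<integral>\<^sup>+y. ennreal B * Q s x (\<lambda>_. 1) * Q s y (\<lambda>_. 1) * indicator A y \<partial>lborel)"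
proof -
  let ?g = "indicator A :: 'a \<Rightarrow> ennreal"
  have step: "(\<integral>\<^sup>+\<omega>. indicator {\<omega>. stay k (3 * s) x \<omega>} \<omega> * ?g (x + X (3 * s) \<omega>) \<partial>M) \<le>
     W k (s / 2 ^ n) (2 ^ n) (\<lambda>_. 1) x * (ennreal B * (\<integral>\<^sup>+y. W k (s / 2 ^ n) (2 ^ n) (\<lambda>_. 1) y * ?g y \<partial>lborel))" for k n
  proof -
    let ?h = "s / 2 ^ n" and ?N = "2 ^ n :: nat"
    have h: "0 \<le> ?h" using s by simp
    have Nh: "real (?N + ?N + ?N) * ?h = 3 * s" by simp
    have "(\<integral>\<^sup>+\<omega>. indicator {\<omega>. stay k (3 * s) x \<omega>} \<omega> * ?g (x + X (3 * s) \<omega>) \<partial>M)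
      \<le> (\<integral>\<^sup>+\<omega>. (\<Prod>j\<le>?N + ?N + ?N. indicator (F k) (x + X (real j * ?h) \<omega>)) * ?g (x + X (real (?N + ?N + ?N) * ?h) \<omega>) \<partial>M)"
      unfolding Nh
    proof (intro nn_integral_mono mult_right_mono)
      fix \<omega>
      have "real j * ?h \<le> 3 * s" if "j \<le> ?N + ?N + ?N" for j
      proof -
        have "real j * ?h \<le> real (?N + ?N + ?N) * ?h" using that h by (intro mult_right_mono of_nat_mono)
        then show ?thesis unfolding Nh .
      qed
      then show "indicator {\<omega>. stay k (3 * s) x \<omega>} \<omega> \<le> ((\<Prod>j\<le>?N + ?N + ?N. indicator (F k) (x + X (real j * ?h) \<omega>)) :: ennreal)"
        unfolding prod_indicator using s by (auto simp: stay_def indicator_def)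
    qed simp
    also have "\<dots> = W k ?h (?N + ?N + ?N) ?g x" by (rule W_eq_expectation[OF h]) measurable
    also have "\<dots> = W k ?h ?N (W k ?h ?N (W k ?h ?N ?g)) x" by (simp only: W_add)
    \<comment> \<open>In the middle third the killing is dropped and the transition density bounded
      by \<open>B\<close>; a constant times survival during the first third remains.\<close>
    also have "\<dots> \<le> W k ?h ?N (\<lambda>_. (ennreal B * (\<integral>\<^sup>+y. W k ?h ?N ?g y \<partial>lborel)) * 1) x"
    proof (rule W_mono)
      fix y
      have "W k ?h ?N (W k ?h ?N ?g) y \<le> (\<integral>\<^sup>+\<omega>. W k ?h ?N ?g (y + X (real ?N * ?h) \<omega>) \<partial>M)"
        by (rule W_le_transition[OF h]) (use h in measurable)
      also have "\<dots> \<le> ennreal B * (\<integral>\<^sup>+y. W k ?h ?N ?g y \<partial>lborel)"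
        by (rule B) (use s h in \<open>auto\<close>)
      finally show "W k ?h ?N (W k ?h ?N ?g) y \<le> (ennreal B * (\<integral>\<^sup>+y. W k ?h ?N ?g y \<partial>lborel)) * 1" by simp
    qed
    also have "\<dots> = (ennreal B * (\<integral>\<^sup>+y. W k ?h ?N ?g y \<partial>lborel)) * W k ?h ?N (\<lambda>_. 1) x"
      by (rule W_cmult[OF h]) simp
    also have "(\<integral>\<^sup>+y. W k ?h ?N ?g y \<partial>lborel) = (\<integral>\<^sup>+y. W k ?h ?N (\<lambda>_. 1) y * ?g y \<partial>lborel)"
      by (rule W_adjoint[OF h]) measurable
    finally show ?thesis by (simp only: mult.commute)
  qed
  let ?w = "\<lambda>k n y. W k (s / 2 ^ n) (2 ^ n) (\<lambda>_. 1) y"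
  note w_lim = W_dyadic_tendsto[of s]
  have w_le: "(INF n. ?w k n y) \<le> Q s y (\<lambda>_. 1)" for k y
    using s by (subst Q_eq_SUP_INF) (auto intro!: SUP_upper2[of k])
  have w_le1: "?w k n y \<le> 1" for k n y
  proof -
    have "?w k n y \<le> (\<integral>\<^sup>+\<omega>. 1 \<partial>M)" by (rule W_le_transition) (use s in auto)
    then show ?thesis by (simp add: emeasure_space_1)
  qed
  have stay_bd: "(\<integral>\<^sup>+\<omega>. indicator {\<omega>. stay k (3 * s) x \<omega>} \<omega> * ?g (x + X (3 * s) \<omega>) \<partial>M) \<le>
     Q s x (\<lambda>_. 1) * (ennreal B * (\<integral>\<^sup>+y. Q s y (\<lambda>_. 1) * ?g y \<partial>lborel))" for k
  proof -
    have [measurable]: "?w k n \<in> borel_measurable borel" for n using s by (intro W_measurable) auto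
    have supp: "?w k n y = indicator (F k) y * ?w k n y" for n y by (simp only: W_supp)
    have w_ind: "?w k n y * ?g y \<le> indicator D y" for n y
    proof -
      have "?w k n y * ?g y \<le> indicator (F k) y * 1"
        by (subst supp, subst mult.assoc, rule mult_left_mono) (use w_le1[of k n y] in \<open>auto simp: indicator_def\<close>)
      also have "\<dots> \<le> indicator D y" using F_subset[of k] by (auto simp: indicator_def)
      finally show ?thesis .
    qed
    \<comment> \<open>A bounded \<open>D\<close> has finite volume, so its indicator dominates the
      grid functions and the mesh may tend to 0 under the integral in \<open>y\<close>.\<close>
    have D_fin: "emeasure lborel D < \<infinity>" using boundedD by (rule emeasure_bounded_finite)
    have [measurable]: "D \<in> sets borel" using openD by simp
    have "(\<lambda>n. \<integral>\<^sup>+y. ?w k n y * ?g y \<partial>lborel) \<longlonglongrightarrow> (\<integral>\<^sup>+y. (INF n. ?w k n y) * ?g y \<partial>lborel)"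
    proof (rule nn_integral_dominated_convergence[where w="indicator D"])
      have "(\<lambda>n. ?w k n y * ?g y) \<longlonglongrightarrow> (INF n. ?w k n y) * ?g y" for y
        using w_lim[of k y] s by (cases "y \<in> A") auto
      then show "AE y in lborel. (\<lambda>n. ?w k n y * ?g y) \<longlonglongrightarrow> (INF n. ?w k n y) * ?g y" by simp
    qed (use D_fin w_ind in auto)
    moreover have "(INF n. ?w k n x) \<noteq> top"
    proof -
      have "(INF n. ?w k n x) \<le> 1" by (rule INF_lower2[of 0]) (use w_le1[of k 0 x] in auto)
      then show ?thesis by (rule neq_top_trans[OF ennreal_one_neq_top])
    qed
    moreover have "(\<integral>\<^sup>+y. (INF n. ?w k n y) * ?g y \<partial>lborel) \<noteq> top"
    proof -
      have "(\<integral>\<^sup>+y. (INF n. ?w k n y) * ?g y \<partial>lborel) \<le> (\<integral>\<^sup>+y. ?w k 0 y * ?g y \<partial>lborel)"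
        by (intro nn_integral_mono mult_right_mono INF_lower) auto
      also have "\<dots> \<le> (\<integral>\<^sup>+y. indicator D y \<partial>lborel)" by (intro nn_integral_mono w_ind)
      also have "\<dots> < top" using D_fin by simp
      finally show ?thesis by simp
    qed
    ultimately have "(\<lambda>n. ?w k n x * (ennreal B * (\<integral>\<^sup>+y. ?w k n y * ?g y \<partial>lborel)))
      \<longlonglongrightarrow> (INF n. ?w k n x) * (ennreal B * (\<integral>\<^sup>+y. (INF n. ?w k n y) * ?g y \<partial>lborel))"
      using w_lim[of k x] s by (intro tendsto_mult_ennreal ennreal_tendsto_cmult) (auto simp: ennreal_mult_eq_top_iff)
    then have "(\<integral>\<^sup>+\<omega>. indicator {\<omega>. stay k (3 * s) x \<omega>} \<omega> * ?g (x + X (3 * s) \<omega>) \<partial>M)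
      \<le> (INF n. ?w k n x) * (ennreal B * (\<integral>\<^sup>+y. (INF n. ?w k n y) * ?g y \<partial>lborel))"
      by (rule LIMSEQ_le_const) (use step in blast)
    also have "\<dots> \<le> Q s x (\<lambda>_. 1) * (ennreal B * (\<integral>\<^sup>+y. Q s y (\<lambda>_. 1) * ?g y \<partial>lborel))"
      by (intro mult_mono nn_integral_mono w_le) auto
    finally show ?thesis .
  qed
  have "Q (3 * s) x ?g = (SUP k. INF n. W k (3 * s / 2 ^ n) (2 ^ n) ?g x)"
    using s by (intro Q_eq_SUP_INF) (auto simp: indicator_def)
  also have "\<dots> = (SUP k. \<integral>\<^sup>+\<omega>. indicator {\<omega>. stay k (3 * s) x \<omega>} \<omega> * ?g (x + X (3 * s) \<omega>) \<partial>M)"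
    using s by (subst stay_expectation) (auto simp: indicator_def)
  also have "\<dots> \<le> Q s x (\<lambda>_. 1) * (ennreal B * (\<integral>\<^sup>+y. Q s y (\<lambda>_. 1) * ?g y \<partial>lborel))"
    by (intro SUP_least stay_bd)
  also have "\<dots> = (\<integral>\<^sup>+y. (ennreal B * Q s x (\<lambda>_. 1)) * (Q s y (\<lambda>_. 1) * ?g y) \<partial>lborel)"
    by (subst nn_integral_cmult) (auto simp: mult_ac)
  also have "\<dots> = (\<integral>\<^sup>+y. ennreal B * Q s x (\<lambda>_. 1) * Q s y (\<lambda>_. 1) * ?g y \<partial>lborel)"
    by (simp add: mult.assoc)
  finally show ?thesis .
qed

text \<open>By the Markov property at time \<open>t\<close>: wherever the surviving path is in
  \<open>D\<close>, it is still in \<open>D\<close> after a further \<open>s0\<close> with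
  probability at most \<open>q\<close>. Iterated, this is exponential decay of survival.\<close>

lemma Q_escape:
  assumes q: "\<And>x. x \<in> D \<Longrightarrow> (\<integral>\<^sup>+z. indicator D (x + z) \<partial>law s0) \<le> ennreal q"
    and s0: "0 \<le> s0" and t: "0 \<le> t"
  shows "Q (t + s0) x (\<lambda>_. 1) \<le> ennreal q * Q t x (\<lambda>_. 1)"
proof -
  have Dm[measurable]: "D \<in> sets borel" using openD by simp
  interpret L: prob_space "law s0" by (rule prob_space_law) fact
  have step: "(\<integral>\<^sup>+\<omega>. indicator {\<omega>. stay k (t + s0) x \<omega>} \<omega> * 1 \<partial>M) \<le> ennreal q * W k (t / 2 ^ n) (2 ^ n) (\<lambda>_. 1) x" for k n
  proof -
    let ?h = "t / 2 ^ n" and ?N = "2 ^ n :: nat"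
    have h: "0 \<le> ?h" using t by simp
    let ?k = "\<lambda>(w, z). (\<Prod>j\<le>?N. indicator (F k) (x + w j)) * indicator D (x + w ?N + z) :: ennreal"
    have "(\<integral>\<^sup>+\<omega>. indicator {\<omega>. stay k (t + s0) x \<omega>} \<omega> * 1 \<partial>M) \<le>
      (\<integral>\<^sup>+\<omega>. ?k (\<lambda>j\<in>{..?N}. X (real j * ?h) \<omega>, X (real ?N * ?h + s0) \<omega> - X (real ?N * ?h) \<omega>) \<partial>M)"
    proof (rule nn_integral_mono)
      fix \<omega>
      have *: "real j * ?h \<le> t + s0" if "j \<le> ?N" for j
      proof -
        have "real j * ?h \<le> real ?N * ?h" using that h by (intro mult_right_mono of_nat_mono)
        then show ?thesis using s0 by simp
      qed
      have "x + X (real j * ?h) \<omega> \<in> F k" if "stay k (t + s0) x \<omega>" "j \<le> ?N" for j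
        using that *[of j] t by (auto simp: stay_def)
      moreover have "x + X (t + s0) \<omega> \<in> D" if "stay k (t + s0) x \<omega>"
        using that s0 t F_subset[of k] by (auto simp: stay_def)
      ultimately show "indicator {\<omega>. stay k (t + s0) x \<omega>} \<omega> * 1 \<le> ?k (\<lambda>j\<in>{..?N}. X (real j * ?h) \<omega>, X (real ?N * ?h + s0) \<omega> - X (real ?N * ?h) \<omega>)"
        by (auto simp: prod_indicator indicator_def)
    qed
    also have "\<dots> = (\<integral>\<^sup>+\<omega>. (\<integral>\<^sup>+z. ?k (\<lambda>j\<in>{..?N}. X (real j * ?h) \<omega>, z) \<partial>law s0) \<partial>M)"
      using h s0 by (intro grid_markov) (auto simp: case_prod_unfold)
    also have "\<dots> \<le> (\<integral>\<^sup>+\<omega>. ennreal q * ((\<Prod>j\<le>?N. indicator (F k) (x + X (real j * ?h) \<omega>)) * 1) \<partial>M)"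
    proof (rule nn_integral_mono)
      fix \<omega>
      have "(\<integral>\<^sup>+z. ?k (\<lambda>j\<in>{..?N}. X (real j * ?h) \<omega>, z) \<partial>law s0) =
         (\<Prod>j\<le>?N. indicator (F k) (x + X (real j * ?h) \<omega>)) * (\<integral>\<^sup>+z. indicator D (x + X t \<omega> + z) \<partial>law s0)"
        by (simp add: nn_integral_cmult)
      also have "\<dots> \<le> (\<Prod>j\<le>?N. indicator (F k) (x + X (real j * ?h) \<omega>)) * ennreal q"
      proof (cases "x + X t \<omega> \<in> F k")
        case True
        then show ?thesis using F_subset q by (intro mult_left_mono) auto
      next
        case False
        then have "(\<Prod>j\<le>?N. indicator (F k) (x + X (real j * ?h) \<omega>)) = (0::ennreal)"
          by (auto simp: prod_indicator intro!: exI[of _ ?N])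
        then show ?thesis by (simp only: mult_zero_left)
      qed
      finally show "(\<integral>\<^sup>+z. ?k (\<lambda>j\<in>{..?N}. X (real j * ?h) \<omega>, z) \<partial>law s0) \<le> ennreal q * ((\<Prod>j\<le>?N. indicator (F k) (x + X (real j * ?h) \<omega>)) * 1)"
        by (simp only: mult.commute[of "ennreal q"] mult_1_right)
    qed
    also have "\<dots> = ennreal q * (\<integral>\<^sup>+\<omega>. (\<Prod>j\<le>?N. indicator (F k) (x + X (real j * ?h) \<omega>)) * 1 \<partial>M)"
    proof (rule nn_integral_cmult)
      have [measurable]: "X (real j * (t / 2 ^ n)) \<in> borel_measurable M" for j n
        using t by (intro X_measurable) simp
      show "(\<lambda>\<omega>. (\<Prod>j\<le>?N. indicator (F k) (x + X (real j * ?h) \<omega>)) * 1 :: ennreal) \<in> borel_measurable M"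
        by measurable
    qed
    also have "(\<integral>\<^sup>+\<omega>. (\<Prod>j\<le>?N. indicator (F k) (x + X (real j * ?h) \<omega>)) * 1 \<partial>M) = W k ?h ?N (\<lambda>_. 1) x"
      by (rule W_eq_expectation[OF h]) simp
    finally show ?thesis .
  qed
  have "Q (t + s0) x (\<lambda>_. 1) = (SUP k. \<integral>\<^sup>+\<omega>. indicator {\<omega>. stay k (t + s0) x \<omega>} \<omega> * 1 \<partial>M)"
    using s0 t by (subst Q_eq_SUP_INF, simp, simp, simp, subst stay_expectation) auto
  also have "\<dots> \<le> (SUP k. ennreal q * (INF n. W k (t / 2 ^ n) (2 ^ n) (\<lambda>_. 1) x))"
  proof (rule SUP_mono')
    fix k
    have "(\<lambda>n. ennreal q * W k (t / 2 ^ n) (2 ^ n) (\<lambda>_. 1) x) \<longlonglongrightarrow> ennreal q * (INF n. W k (t / 2 ^ n) (2 ^ n) (\<lambda>_. 1) x)"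
      by (intro ennreal_tendsto_cmult W_dyadic_tendsto t) simp
    then show "(\<integral>\<^sup>+\<omega>. indicator {\<omega>. stay k (t + s0) x \<omega>} \<omega> * 1 \<partial>M) \<le> ennreal q * (INF n. W k (t / 2 ^ n) (2 ^ n) (\<lambda>_. 1) x)"
      by (rule LIMSEQ_le_const) (use step in blast)
  qed
  also have "\<dots> = ennreal q * Q t x (\<lambda>_. 1)"
    using t by (subst Q_eq_SUP_INF) (auto simp: SUP_mult_left_ennreal)
  finally show ?thesis .
qed

end

section \<open>Quasi-left-continuity\<close>

text \<open>Completeness enters here: exit time and exit position become measurable by agreeing
  almost surely with measurable functions.\<close>

lemma (in complete_measure) borel_measurable_AE_eq:
  fixes f g :: "'a \<Rightarrow> 'c::topological_space"
  assumes "g \<in> borel_measurable M" "AE x in M. f x = g x"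
  shows "f \<in> borel_measurable M"
proof (rule measurableI)
  fix A :: "'c set" assume A: "A \<in> sets borel"
  show "f -` A \<inter> space M \<in> sets M"
  proof (rule in_sets_AE[of "g -` A \<inter> space M"])
    show "AE x in M. x \<in> g -` A \<inter> space M \<longleftrightarrow> x \<in> f -` A \<inter> space M"
      using assms(2) by eventually_elim auto
    show "g -` A \<inter> space M \<in> sets M" using assms(1) A by (rule measurable_sets)
  qed auto
qed simp

context levy_domain
begin

section \<open>First exits on a grid and the discrete strong Markov property\<close>

definition first_exit :: "nat \<Rightarrow> nat \<Rightarrow> nat \<Rightarrow> 'a \<Rightarrow> 'b \<Rightarrow> bool" where
  "first_exit k n j x \<omega> \<longleftrightarrow> (\<forall>i<j. x + X (real i / 2 ^ n) \<omega> \<in> F k) \<and> x + X (real j / 2 ^ n) \<omega> \<notin> F k"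

lemma first_exit_measurable[measurable]: "Measurable.pred M (\<lambda>\<omega>. first_exit k n j x \<omega>)"
  unfolding first_exit_def by measurable

lemma first_exit_unique: "first_exit k n i x \<omega> \<Longrightarrow> first_exit k n j x \<omega> \<Longrightarrow> i = j"
  unfolding first_exit_def by (metis linorder_neqE_nat)

lemma grid_exit_first_exit:
  assumes "first_exit k n j x \<omega>"
  shows "grid_exit k n x \<omega> = ennreal (real j / 2 ^ n)"
proof (rule antisym)
  show "grid_exit k n x \<omega> \<le> ennreal (real j / 2 ^ n)"
    using assms by (intro grid_exit_le) (simp add: first_exit_def)
  show "ennreal (real j / 2 ^ n) \<le> grid_exit k n x \<omega>"
    unfolding grid_exit_def
  proof (rule INF_greatest)
    fix i
    have "j \<le> i" if "x + X (real i / 2 ^ n) \<omega> \<notin> F k"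
      using assms that unfolding first_exit_def by (meson not_less)
    then show "ennreal (real j / 2 ^ n) \<le> (if x + X (real i / 2 ^ n) \<omega> \<notin> F k then ennreal (real i / 2 ^ n) else top)"
      by (auto intro!: ennreal_leI divide_right_mono)
  qed
qed

lemma first_exit_exists:
  assumes "grid_exit k n x \<omega> < top"
  obtains j where "first_exit k n j x \<omega>"
proof -
  have "\<exists>j. x + X (real j / 2 ^ n) \<omega> \<notin> F k"
  proof (rule ccontr)
    assume "\<not> ?thesis"
    then have "grid_exit k n x \<omega> = top" by (simp add: grid_exit_def)
    then show False using assms by simp
  qed
  then show thesis
    using that[of "LEAST j. x + X (real j / 2 ^ n) \<omega> \<notin> F k"]
    unfolding first_exit_def by (metis (mono_tags, lifting) LeastI_ex not_less_Least)
qed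

lemma suminf_first_exit:
  fixes h :: "nat \<Rightarrow> ennreal"
  assumes "first_exit k n j x \<omega>"
  shows "(\<Sum>i. indicator {\<omega>. first_exit k n i x \<omega>} \<omega> * h i) = h j"
proof -
  have "(\<lambda>i. indicator {\<omega>. first_exit k n i x \<omega>} \<omega> * h i) = (\<lambda>i. if i = j then h i else 0)"
  proof
    fix i
    have "first_exit k n i x \<omega> \<longleftrightarrow> i = j" using assms first_exit_unique by blast
    then show "indicator {\<omega>. first_exit k n i x \<omega>} \<omega> * h i = (if i = j then h i else 0)"
      using assms by (cases "i = j") auto
  qed
  then show ?thesis using sums_unique[OF sums_single[of j h]] by simp
qed

lemma suminf_no_exit:
  fixes h :: "nat \<Rightarrow> ennreal"
  assumes "\<not> grid_exit k n x \<omega> < top"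
  shows "(\<Sum>i. indicator {\<omega>. first_exit k n i x \<omega>} \<omega> * h i) = 0"
proof -
  have "\<not> first_exit k n i x \<omega>" for i using assms grid_exit_first_exit[of k n i x \<omega>] by auto
  then show ?thesis by simp
qed

text \<open>The grid exit takes countably many values and the event of a first exit at index
  \<open>j\<close> depends only on the grid positions up to \<open>j\<close>, so
  \<open>grid_markov\<close> applies to each \<open>j\<close>. Both \<open>G\<close> and the lapse
  \<open>h\<close> may depend on \<open>j\<close>, which allows for the time remaining until a fixed
  \<open>t\<close>.\<close>

lemma discrete_strong_markov:
  fixes G :: "nat \<Rightarrow> 'a \<Rightarrow> 'a \<Rightarrow> ennreal"
  assumes [measurable]: "\<And>j. case_prod (G j) \<in> borel_measurable (borel \<Otimes>\<^sub>M borel)" and h: "\<And>j. 0 \<le> h j"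
  shows "(\<integral>\<^sup>+\<omega>. (\<Sum>j. indicator {\<omega>. first_exit k n j x \<omega>} \<omega> *
       G j (X (real j / 2 ^ n) \<omega>) (X (real j / 2 ^ n + h j) \<omega> - X (real j / 2 ^ n) \<omega>)) \<partial>M) =
    (\<integral>\<^sup>+\<omega>. (\<Sum>j. indicator {\<omega>. first_exit k n j x \<omega>} \<omega> * (\<integral>\<^sup>+z. G j (X (real j / 2 ^ n) \<omega>) z \<partial>law (h j))) \<partial>M)"
proof -
  have [measurable]: "X (real j / 2 ^ n) \<in> borel_measurable M" "X (real j / 2 ^ n + h j) \<in> borel_measurable M" for j
    using h by (intro X_measurable; simp)+
  have m1[measurable]: "(\<lambda>\<omega>. G j (f \<omega>) (g \<omega>)) \<in> borel_measurable N"
    if "f \<in> borel_measurable N" "g \<in> borel_measurable N" for f g and N :: "'z measure" and j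
    using measurable_compose[OF measurable_Pair[OF that] assms(1)[of j]] by simp
  have m2: "(\<lambda>\<omega>. \<integral>\<^sup>+z. G j (X (real j / 2 ^ n) \<omega>) z \<partial>law (h j)) \<in> borel_measurable M" for j
  proof -
    interpret L: prob_space "law (h j)" by (rule prob_space_law) (rule h)
    have "(\<lambda>y. \<integral>\<^sup>+z. G j y z \<partial>law (h j)) \<in> borel_measurable borel"
      by (rule L.borel_measurable_nn_integral) (simp cong: measurable_cong_sets sets_pair_measure_cong)
    then show ?thesis by (rule measurable_compose[rotated]) measurable
  qed
  have step: "(\<integral>\<^sup>+\<omega>. indicator {\<omega>. first_exit k n j x \<omega>} \<omega> * G j (X (real j / 2 ^ n) \<omega>) (X (real j / 2 ^ n + h j) \<omega> - X (real j / 2 ^ n) \<omega>) \<partial>M)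
     = (\<integral>\<^sup>+\<omega>. indicator {\<omega>. first_exit k n j x \<omega>} \<omega> * (\<integral>\<^sup>+z. G j (X (real j / 2 ^ n) \<omega>) z \<partial>law (h j)) \<partial>M)" for j
  proof -
    let ?e = "\<lambda>w. if (\<forall>i<j. x + w i \<in> F k) \<and> x + w j \<notin> F k then 1 else 0 :: ennreal"
    let ?k = "\<lambda>wz. ?e (fst wz) * G j (fst wz j) (snd wz)"
    let ?w = "\<lambda>\<omega>. \<lambda>i\<in>{..j}. X (real i * (1 / 2 ^ n)) \<omega>"
    have e: "?e (?w \<omega>) = indicator {\<omega>. first_exit k n j x \<omega>} \<omega>" for \<omega>
      by (auto simp: first_exit_def indicator_def)
    have km: "?k \<in> borel_measurable (PiM {..j} (\<lambda>_. borel) \<Otimes>\<^sub>M borel)"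
    proof -
      have [measurable]: "i < j \<Longrightarrow> (\<lambda>wz. fst wz i) \<in> borel_measurable (PiM {..j} (\<lambda>_. borel::'a measure) \<Otimes>\<^sub>M (borel :: 'a measure))" for i
        by (rule grid_proj_measurable) simp
      have [measurable]: "(\<lambda>wz. fst wz j) \<in> borel_measurable (PiM {..j} (\<lambda>_. borel::'a measure) \<Otimes>\<^sub>M (borel :: 'a measure))"
        by (rule grid_proj_measurable) simp
      show ?thesis
        by (intro borel_measurable_times_ennreal m1) measurable
    qed
    have "(\<integral>\<^sup>+\<omega>. indicator {\<omega>. first_exit k n j x \<omega>} \<omega> * G j (X (real j / 2 ^ n) \<omega>) (X (real j / 2 ^ n + h j) \<omega> - X (real j / 2 ^ n) \<omega>) \<partial>M)
      = (\<integral>\<^sup>+\<omega>. ?k (?w \<omega>, X (real j * (1 / 2 ^ n) + h j) \<omega> - X (real j * (1 / 2 ^ n)) \<omega>) \<partial>M)"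
      unfolding fst_conv snd_conv e by simp
    also have "\<dots> = (\<integral>\<^sup>+\<omega>. (\<integral>\<^sup>+z. ?k (?w \<omega>, z) \<partial>law (h j)) \<partial>M)"
      by (rule grid_markov[OF _ h km]) simp
    also have "\<dots> = (\<integral>\<^sup>+\<omega>. indicator {\<omega>. first_exit k n j x \<omega>} \<omega> * (\<integral>\<^sup>+z. G j (X (real j / 2 ^ n) \<omega>) z \<partial>law (h j)) \<partial>M)"
      unfolding fst_conv snd_conv e by (intro nn_integral_cong) (simp add: nn_integral_cmult)
    finally show ?thesis .
  qed
  show ?thesis
    by (subst (1 2) nn_integral_suminf) (use m2 step in auto)
qed

lemma enn2real_grid_exit_tendsto:
  assumes "F_exit k x \<omega> < top"
  shows "(\<lambda>n. enn2real (grid_exit k n x \<omega>)) \<longlonglongrightarrow> enn2real (F_exit k x \<omega>)"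
    "\<forall>\<^sub>F n in sequentially. grid_exit k n x \<omega> < top"
    "\<forall>\<^sub>F n in sequentially. enn2real (F_exit k x \<omega>) \<le> enn2real (grid_exit k n x \<omega>)"
proof -
  show e: "\<forall>\<^sub>F n in sequentially. grid_exit k n x \<omega> < top"
    using grid_exit_tendsto assms by (rule order_tendstoD)
  show "(\<lambda>n. enn2real (grid_exit k n x \<omega>)) \<longlonglongrightarrow> enn2real (F_exit k x \<omega>)"
    by (rule tendsto_enn2real) (use grid_exit_tendsto assms in auto)
  show "\<forall>\<^sub>F n in sequentially. enn2real (F_exit k x \<omega>) \<le> enn2real (grid_exit k n x \<omega>)"
    using e by eventually_elim (auto intro!: enn2real_mono F_exit_le_grid)
qed

lemma X_grid_exit_tendsto:
  assumes "\<omega> \<in> space M" "F_exit k x \<omega> < top" "0 \<le> s"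
  shows "(\<lambda>n. X (enn2real (grid_exit k n x \<omega>) + s) \<omega>) \<longlonglongrightarrow> X (enn2real (F_exit k x \<omega>) + s) \<omega>"
  using enn2real_grid_exit_tendsto[OF assms(2)] assms
  by (intro right_continuous_path tendsto_add[OF _ tendsto_const]) (auto elim: eventually_mono)

text \<open>At the exit time the path is only a limit of positions outside \<open>F k\<close> and
  may lie on its boundary, so exclusion holds one level down: near a point of \<open>F l\<close>
  with \<open>l < k\<close> there are only points of \<open>F k\<close>.\<close>

lemma F_exit_outside:
  assumes \<omega>: "\<omega> \<in> space M" and fin: "F_exit k x \<omega> < top" and "l < k"
  shows "x + X (enn2real (F_exit k x \<omega>)) \<omega> \<notin> F l"
proof
  assume in_l: "x + X (enn2real (F_exit k x \<omega>)) \<omega> \<in> F l"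
  obtain k' where k': "k = Suc k'" "l \<le> k'" using \<open>l < k\<close> by (cases k) auto
  then have in_k: "x + X (enn2real (F_exit k x \<omega>)) \<omega> \<in> F k'" using in_l F_mono by blast
  have "(\<lambda>n. x + X (enn2real (grid_exit k n x \<omega>)) \<omega>) \<longlonglongrightarrow> x + X (enn2real (F_exit k x \<omega>)) \<omega>"
    using X_grid_exit_tendsto[OF \<omega> fin, of 0] by (intro tendsto_intros) simp
  from tendstoD[OF this F_gap[of k']] enn2real_grid_exit_tendsto(2)[OF fin]
  have "\<forall>\<^sub>F n in sequentially. False"
  proof eventually_elim
    case (elim n)
    then have 1: "x + X (enn2real (grid_exit k n x \<omega>)) \<omega> \<in> F k" using F_thick[OF in_k] k' by simp
    obtain j where j: "first_exit k n j x \<omega>" using first_exit_exists elim by blast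
    then have "enn2real (grid_exit k n x \<omega>) = real j / 2 ^ n" by (simp add: grid_exit_first_exit)
    then show False using 1 j by (simp add: first_exit_def)
  qed
  then show False by simp
qed

lemma enn2real_F_exit_tendsto:
  assumes "D_exit x \<omega> < top"
  shows "(\<lambda>k. enn2real (F_exit k x \<omega>)) \<longlonglongrightarrow> enn2real (D_exit x \<omega>)"
    "enn2real (F_exit k x \<omega>) \<le> enn2real (D_exit x \<omega>)"
  using assms by (auto intro!: tendsto_enn2real enn2real_mono F_exit_le_D F_exit_tendsto)

lemma F_exit_finite: "D_exit x \<omega> < top \<Longrightarrow> F_exit k x \<omega> < top"
  using F_exit_le_D by (rule le_less_trans)

text \<open>A discontinuity of the path at the limit of the announcing times \<open>F_exit k\<close> would be a jump
  that occurs, with positive probability, within an arbitrarily short time after a stopping time.\<close>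

lemma jump_at_D_exit:
  assumes \<omega>: "\<omega> \<in> space M" and fin: "D_exit x \<omega> < top"
    and bad: "\<not> (\<lambda>k. X (enn2real (F_exit k x \<omega>)) \<omega>) \<longlonglongrightarrow> X (enn2real (D_exit x \<omega>)) \<omega>"
  shows "\<exists>r::nat. \<forall>\<^sub>F m in sequentially. \<forall>\<^sub>F k in sequentially. \<forall>\<^sub>F n in sequentially.
     grid_exit k n x \<omega> < top \<and> 1 / real (Suc r) <
       norm (X (enn2real (grid_exit k n x \<omega>) + 1 / real (Suc m)) \<omega> - X (enn2real (grid_exit k n x \<omega>)) \<omega>)"
proof -
  let ?th = "enn2real (D_exit x \<omega>)" and ?tk = "\<lambda>k. enn2real (F_exit k x \<omega>)"
  note lim = enn2real_F_exit_tendsto[OF fin]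
  \<comment> \<open>If an announcing time reached the limit, all later ones would equal it and
    convergence would be trivial, against \<open>bad\<close>.\<close>
  have lt: "?tk k < ?th" for k
  proof (rule ccontr)
    assume "\<not> ?tk k < ?th"
    then have k: "?tk k = ?th" using lim(2)[of k] by simp
    have "?tk l = ?th" if "l \<ge> k" for l
    proof -
      have "?tk k \<le> ?tk l" using F_exit_mono that F_exit_finite[OF fin] by (intro enn2real_mono) (auto simp: incseq_def)
      then show ?thesis using k lim(2)[of l] by simp
    qed
    then have "\<forall>\<^sub>F l in sequentially. X (?tk l) \<omega> = X ?th \<omega>"
      by (intro eventually_sequentiallyI[of k]) simp
    then have "(\<lambda>k. X (?tk k) \<omega>) \<longlonglongrightarrow> X ?th \<omega>" by (rule tendsto_eventually)
    then show False using bad by contradiction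
  qed
  have pos: "0 < ?th" using lt[of 0] by (meson enn2real_nonneg le_less_trans)
  obtain l where l: "((\<lambda>t. X t \<omega>) \<longlongrightarrow> l) (at_left ?th)" by (rule left_limit_path[OF \<omega> pos])
  have "filterlim ?tk (at_left ?th) sequentially"
    using lim(1) lt less_imp_neq[OF lt] by (simp add: filterlim_at)
  then have Xl: "(\<lambda>k. X (?tk k) \<omega>) \<longlonglongrightarrow> l" by (rule filterlim_compose[OF l])
  with bad have "l \<noteq> X ?th \<omega>" by auto
  then have "0 < norm (X ?th \<omega> - l) / 3" by simp
  \<comment> \<open>Less than a third of the jump: after an error below \<open>1 / (r + 1)\<close>
    at each end, more than \<open>1 / (r + 1)\<close> remains.\<close>
  then obtain r :: nat where r: "1 / real (Suc r) < norm (X ?th \<omega> - l) / 3" using nat_approx_posE by blast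
  let ?e = "1 / real (Suc r)"
  have "((\<lambda>u. X u \<omega>) \<longlongrightarrow> X ?th \<omega>) (at_right ?th)"
    using levy \<omega> by (simp add: levy_process_def cadlag_path_def continuous_within)
  then have "\<forall>\<^sub>F u in at_right ?th. dist (X u \<omega>) (X ?th \<omega>) < ?e" by (rule tendstoD) simp
  then obtain b where b: "?th < b" "\<And>u. ?th < u \<Longrightarrow> u < b \<Longrightarrow> dist (X u \<omega>) (X ?th \<omega>) < ?e"
    by (auto simp: eventually_at_right_field)
  have b': "dist (X u \<omega>) (X ?th \<omega>) < ?e" if "?th \<le> u" "u < b" for u
    using b(2)[of u] that by (cases "u = ?th") auto
  have small: "\<forall>\<^sub>F m in sequentially. 1 / real (Suc m) < b - ?th"
    using order_tendstoD(2)[OF LIMSEQ_inverse_real_of_nat, of "b - ?th"] b(1) by (simp add: inverse_eq_divide)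
  show ?thesis
  \<comment> \<open>The order of the quantifiers matters: \<open>m\<close> makes the time lapse
    shorter than the right-continuity neighbourhood of the limit time, \<open>k\<close> then starts
    it close enough to reach that time, and \<open>n\<close> replaces the exit time by its grid
    version.\<close>
  proof (intro exI[of _ r])
    show "\<forall>\<^sub>F m in sequentially. \<forall>\<^sub>F k in sequentially. \<forall>\<^sub>F n in sequentially.
     grid_exit k n x \<omega> < top \<and> ?e <
       norm (X (enn2real (grid_exit k n x \<omega>) + 1 / real (Suc m)) \<omega> - X (enn2real (grid_exit k n x \<omega>)) \<omega>)"
      using small
    proof eventually_elim
      case (elim m)
      let ?s = "1 / real (Suc m)"
      have "\<forall>\<^sub>F k in sequentially. ?th - ?s < ?tk k" using lim(1) by (rule order_tendstoD) simp
      moreover have "\<forall>\<^sub>F k in sequentially. dist (X (?tk k) \<omega>) l < ?e" using Xl by (rule tendstoD) simp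
      ultimately show ?case
      proof eventually_elim
        case (elim k)
        have "dist (X (?tk k + ?s) \<omega>) (X ?th \<omega>) < ?e"
          using elim(1) lt[of k] \<open>?s < b - ?th\<close> by (intro b') auto
        then have n: "?e < norm (X (?tk k + ?s) \<omega> - X (?tk k) \<omega>)"
          using elim(2) r dist_triangle[of "X ?th \<omega>" l "X (?tk k + ?s) \<omega>"]
            dist_triangle[of "X (?tk k + ?s) \<omega>" l "X (?tk k) \<omega>"]
          unfolding dist_norm[of "X ?th \<omega>" l, symmetric] dist_norm[of "X (?tk k + ?s) \<omega>" "X (?tk k) \<omega>", symmetric]
          unfolding dist_commute[of "X (?tk k + ?s) \<omega>" "X ?th \<omega>"] by linarith
        have F: "F_exit k x \<omega> < top" using fin by (rule F_exit_finite)
        have "(\<lambda>n. norm (X (enn2real (grid_exit k n x \<omega>) + ?s) \<omega> - X (enn2real (grid_exit k n x \<omega>) + 0) \<omega>))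
          \<longlonglongrightarrow> norm (X (?tk k + ?s) \<omega> - X (?tk k + 0) \<omega>)"
          by (intro tendsto_intros X_grid_exit_tendsto \<omega> F) auto
        then have "\<forall>\<^sub>F n in sequentially. ?e < norm (X (enn2real (grid_exit k n x \<omega>) + ?s) \<omega> - X (enn2real (grid_exit k n x \<omega>) + 0) \<omega>)"
          using n by (intro order_tendstoD) auto
        with enn2real_grid_exit_tendsto(2)[OF F] show ?case by eventually_elim simp
      qed
    qed
  qed
qed

lemma law_small_time_tendsto: "(\<lambda>m. \<integral>\<^sup>+z. indicator {z. e < norm z} z \<partial>law (1 / real (Suc m))) \<longlonglongrightarrow> 0" if e: "0 < e" for e :: real
proof -
  have [measurable]: "X (1 / real (Suc m)) \<in> borel_measurable M" for m by (intro X_measurable) simp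
  have "(\<lambda>m. \<integral>\<^sup>+\<omega>. indicator {z. e < norm z} (X (1 / real (Suc m)) \<omega>) \<partial>M) \<longlonglongrightarrow> (\<integral>\<^sup>+\<omega>. 0 \<partial>M)"
  proof (rule nn_integral_dominated_convergence[where w="\<lambda>_. 1"])
    show "AE \<omega> in M. (\<lambda>m. indicator {z. e < norm z} (X (1 / real (Suc m)) \<omega>)) \<longlonglongrightarrow> (0::ennreal)"
    proof (rule AE_I2)
      fix \<omega> assume \<omega>: "\<omega> \<in> space M"
      have "(\<lambda>m. X (1 / real (Suc m)) \<omega>) \<longlonglongrightarrow> X 0 \<omega>"
        using LIMSEQ_inverse_real_of_nat
        by (intro right_continuous_path \<omega>) (auto simp: inverse_eq_divide)
      then have "\<forall>\<^sub>F m in sequentially. dist (X (1 / real (Suc m)) \<omega>) (X 0 \<omega>) < e" using e by (rule tendstoD)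
      then have "\<forall>\<^sub>F m in sequentially. indicator {z. e < norm z} (X (1 / real (Suc m)) \<omega>) = (0::ennreal)"
        by eventually_elim (use \<omega> in \<open>simp add: dist_norm\<close>)
      then show "(\<lambda>m. indicator {z. e < norm z} (X (1 / real (Suc m)) \<omega>)) \<longlonglongrightarrow> (0::ennreal)"
        by (rule tendsto_eventually)
    qed
  qed (auto simp: emeasure_space_1 indicator_def)
  moreover have "(\<integral>\<^sup>+z. indicator {z. e < norm z} z \<partial>law (1 / real (Suc m))) =
    (\<integral>\<^sup>+\<omega>. indicator {z. e < norm z} (X (1 / real (Suc m)) \<omega>) \<partial>M)" for m
    by (rule nn_integral_law) auto
  ultimately show ?thesis by (simp only: nn_integral_const mult_zero_left)
qed

text \<open>\<open>Z r m k n\<close> indicates a displacement above \<open>1 / (r + 1)\<close>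
  within \<open>1 / (m + 1)\<close> after the grid exit. By the strong Markov property its mean is
  at most the probability of such a displacement from time 0, uniformly in \<open>k\<close> and
  \<open>n\<close>, and this tends to 0 with \<open>m\<close>. Three applications of Fatou's lemma
  carry the bound to the iterated lower limit, which is at least 1 wherever convergence
  fails.\<close>

lemma quasi_left_continuity:
  "AE \<omega> in M. D_exit x \<omega> < top \<longrightarrow> (\<lambda>k. X (enn2real (F_exit k x \<omega>)) \<omega>) \<longlonglongrightarrow> X (enn2real (D_exit x \<omega>)) \<omega>"
proof -
  define Z where "Z r m k n \<omega> = (\<Sum>j. indicator {\<omega>. first_exit k n j x \<omega>} \<omega> *
     indicator {z. 1 / real (Suc r) < norm z} (X (real j / 2 ^ n + 1 / real (Suc m)) \<omega> - X (real j / 2 ^ n) \<omega>) :: ennreal)" for r m k n \<omega>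
  have Zm[measurable]: "Z r m k n \<in> borel_measurable M" for r m k n
  proof -
    have [measurable]: "X (real j / 2 ^ n + 1 / real (Suc m)) \<in> borel_measurable M" for j by (intro X_measurable) simp
    show ?thesis unfolding Z_def by measurable
  qed
  let ?P = "\<lambda>r m. \<integral>\<^sup>+z. indicator {z. 1 / real (Suc r) < norm z} z \<partial>law (1 / real (Suc m)) :: ennreal"
  have Z_le: "(\<integral>\<^sup>+\<omega>. Z r m k n \<omega> \<partial>M) \<le> ?P r m" for r m k n
  proof -
    have "(\<integral>\<^sup>+\<omega>. Z r m k n \<omega> \<partial>M) = (\<integral>\<^sup>+\<omega>. (\<Sum>j. indicator {\<omega>. first_exit k n j x \<omega>} \<omega> * ?P r m) \<partial>M)"
      unfolding Z_def
      by (rule discrete_strong_markov[where h="\<lambda>_. 1 / real (Suc m)" and G="\<lambda>j y z. indicator {z. 1 / real (Suc r) < norm z} z"]) auto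
    also have "\<dots> \<le> (\<integral>\<^sup>+\<omega>. ?P r m \<partial>M)"
    proof (rule nn_integral_mono)
      fix \<omega>
      show "(\<Sum>j. indicator {\<omega>. first_exit k n j x \<omega>} \<omega> * ?P r m) \<le> ?P r m"
      proof (cases "grid_exit k n x \<omega> < top")
        case True
        then obtain j where "first_exit k n j x \<omega>" using first_exit_exists by blast
        then show ?thesis by (simp only: suminf_first_exit[where h="\<lambda>_. ?P r m"] order_refl)
      next
        case False
        then show ?thesis by (simp only: suminf_no_exit[OF False, of "\<lambda>_. ?P r m"] zero_le)
      qed
    qed
    also have "\<dots> = ?P r m" by (simp add: emeasure_space_1)
    finally show ?thesis .
  qed
  have "AE \<omega> in M. liminf (\<lambda>m. liminf (\<lambda>k. liminf (\<lambda>n. Z r m k n \<omega>))) = 0" for r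
  proof -
    have "(\<integral>\<^sup>+\<omega>. liminf (\<lambda>m. liminf (\<lambda>k. liminf (\<lambda>n. Z r m k n \<omega>))) \<partial>M)
       \<le> liminf (\<lambda>m. \<integral>\<^sup>+\<omega>. liminf (\<lambda>k. liminf (\<lambda>n. Z r m k n \<omega>)) \<partial>M)"
      by (rule nn_integral_liminf) measurable
    also have "\<dots> \<le> liminf (\<lambda>m. liminf (\<lambda>k. \<integral>\<^sup>+\<omega>. liminf (\<lambda>n. Z r m k n \<omega>) \<partial>M))"
      by (intro Liminf_mono always_eventually allI nn_integral_liminf) measurable
    also have "\<dots> \<le> liminf (\<lambda>m. liminf (\<lambda>k. liminf (\<lambda>n. \<integral>\<^sup>+\<omega>. Z r m k n \<omega> \<partial>M)))"
      by (intro Liminf_mono always_eventually allI nn_integral_liminf) measurable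
    also have "\<dots> \<le> liminf (\<lambda>m. liminf (\<lambda>k::nat. liminf (\<lambda>n::nat. ?P r m)))"
      by (intro Liminf_mono always_eventually allI Z_le)
    also have "\<dots> = liminf (\<lambda>m. ?P r m)" by (simp add: Liminf_const)
    also have "\<dots> = 0" using law_small_time_tendsto[of "1 / real (Suc r)"] by (intro lim_imp_Liminf) auto
    finally have "(\<integral>\<^sup>+\<omega>. liminf (\<lambda>m. liminf (\<lambda>k. liminf (\<lambda>n. Z r m k n \<omega>))) \<partial>M) = 0" by simp
    then show ?thesis by (subst (asm) nn_integral_0_iff_AE) auto
  qed
  then have "AE \<omega> in M. \<forall>r. liminf (\<lambda>m. liminf (\<lambda>k. liminf (\<lambda>n. Z r m k n \<omega>))) = 0"
    by (simp add: AE_all_countable)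
  with AE_space show ?thesis
  proof eventually_elim
    case (elim \<omega>)
    show ?case
    proof (rule impI, rule ccontr)
      assume "D_exit x \<omega> < top" "\<not> (\<lambda>k. X (enn2real (F_exit k x \<omega>)) \<omega>) \<longlonglongrightarrow> X (enn2real (D_exit x \<omega>)) \<omega>"
      from jump_at_D_exit[OF elim(1) this] obtain r where r: "\<forall>\<^sub>F m in sequentially. \<forall>\<^sub>F k in sequentially. \<forall>\<^sub>F n in sequentially.
         grid_exit k n x \<omega> < top \<and> 1 / real (Suc r) <
         norm (X (enn2real (grid_exit k n x \<omega>) + 1 / real (Suc m)) \<omega> - X (enn2real (grid_exit k n x \<omega>)) \<omega>)" by blast
      have Z1: "1 \<le> Z r m k n \<omega>" if *: "grid_exit k n x \<omega> < top \<and> 1 / real (Suc r) <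
         norm (X (enn2real (grid_exit k n x \<omega>) + 1 / real (Suc m)) \<omega> - X (enn2real (grid_exit k n x \<omega>)) \<omega>)" for m k n
      proof -
        obtain j where j: "first_exit k n j x \<omega>" using first_exit_exists * by blast
        then have "enn2real (grid_exit k n x \<omega>) = real j / 2 ^ n" by (simp add: grid_exit_first_exit)
        with * show ?thesis unfolding Z_def by (simp add: suminf_first_exit[OF j])
      qed
      have "1 \<le> liminf (\<lambda>m. liminf (\<lambda>k. liminf (\<lambda>n. Z r m k n \<omega>)))"
        by (rule Liminf_bounded, rule eventually_mono[OF r], rule Liminf_bounded, erule eventually_mono,
            rule Liminf_bounded, erule eventually_mono, rule Z1)
      then show False using elim(2) by simp
    qed
  qed
qed

section \<open>Identification of the exit time from \<open>D\<close>\<close>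

lemma D_exit_pos:
  assumes "\<omega> \<in> space M" "x \<in> D"
  shows "0 < D_exit x \<omega>"
proof -
  obtain k where "x \<in> F k" using assms(2) D_eq_F by blast
  then have "stay k 0 x \<omega>" using assms(1) by (simp add: stay_def)
  then show ?thesis using less_D_exit_iff[OF assms(1), of 0] by auto
qed

text \<open>One inequality holds on every path. For the other, the positions at the announcing times
  eventually avoid each fixed level, so their limit, which is the position at \<open>D_exit\<close>
  by quasi-left-continuity, lies outside \<open>D\<close>.\<close>

lemma exit_time_eq_D_exit:
  assumes x: "x \<in> D"
  shows "AE \<omega> in M. exit_time X D x \<omega> = D_exit x \<omega>"
  using AE_space quasi_left_continuity[of x]
proof eventually_elim
  case (elim \<omega>)
  note \<omega> = elim(1)
  show ?case
  proof (rule antisym)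
    show "D_exit x \<omega> \<le> exit_time X D x \<omega>"
      unfolding exit_time_def
    proof (intro INF_greatest)
      fix t assume t: "t \<in> {t. 0 < t \<and> x + X t \<omega> \<notin> D}"
      then have "\<not> stay k t x \<omega>" for k using F_subset[of k] by (auto simp: stay_def)
      then have "\<not> ennreal t < D_exit x \<omega>" using less_D_exit_iff[OF \<omega>] t by simp
      then show "D_exit x \<omega> \<le> ennreal t" by simp
    qed
    show "exit_time X D x \<omega> \<le> D_exit x \<omega>"
    proof (cases "D_exit x \<omega> < top")
      case True
      let ?th = "enn2real (D_exit x \<omega>)"
      have lim: "(\<lambda>k. x + X (enn2real (F_exit k x \<omega>)) \<omega>) \<longlonglongrightarrow> x + X ?th \<omega>"
        using elim(2) True by (intro tendsto_intros) simp
      have "x + X ?th \<omega> \<notin> D"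
      proof
        assume "x + X ?th \<omega> \<in> D"
        then obtain k where k: "x + X ?th \<omega> \<in> F k" using D_eq_F by blast
        have "\<forall>\<^sub>F l in sequentially. Suc k < l" by (rule eventually_gt_at_top)
        with tendstoD[OF lim F_gap[of k]] have "\<forall>\<^sub>F l in sequentially. False"
        proof eventually_elim
          case (elim l)
          then have "x + X (enn2real (F_exit l x \<omega>)) \<omega> \<in> F (Suc k)" using F_thick[OF k] by simp
          then show False using F_exit_outside[OF \<omega> F_exit_finite[OF True] elim(2)] by simp
        qed
        then show False by simp
      qed
      moreover have "0 < ?th" using D_exit_pos[OF \<omega> x] True by (simp add: enn2real_positive_iff)
      ultimately have "exit_time X D x \<omega> \<le> ennreal ?th" unfolding exit_time_def by (intro INF_lower) auto
      then show ?thesis using True by simp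
    qed (simp add: not_less top_unique)
  qed
qed

end

section \<open>The strong Markov property at the exit time\<close>

lemma tendsto_cutoff:
  fixes \<tau> :: "nat \<Rightarrow> ennreal" and a :: "nat \<Rightarrow> ennreal"
  assumes "\<tau> \<longlonglongrightarrow> l" "l \<noteq> t" "l < t \<Longrightarrow> a \<longlonglongrightarrow> b"
  shows "(\<lambda>n. if \<tau> n \<le> t then a n else 0) \<longlonglongrightarrow> (if l \<le> t then b else 0)"
proof (cases "l < t")
  case True
  then have "\<forall>\<^sub>F n in sequentially. \<tau> n < t" using assms(1) by (intro order_tendstoD)
  then have "\<forall>\<^sub>F n in sequentially. (if \<tau> n \<le> t then a n else 0) = a n" by eventually_elim simp
  then show ?thesis using assms(3)[OF True] True by (subst tendsto_cong) auto
next
  case False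
  then have "t < l" using assms(2) by simp
  then have "\<forall>\<^sub>F n in sequentially. t < \<tau> n" using assms(1) by (intro order_tendstoD)
  then have "\<forall>\<^sub>F n in sequentially. (if \<tau> n \<le> t then a n else 0) = 0" by eventually_elim simp
  then show ?thesis using \<open>t < l\<close> by (simp add: tendsto_eventually)
qed

text \<open>Approach from below never crosses \<open>t\<close> when the limit equals
  \<open>t\<close>, so the exclusion \<open>l \<noteq> t\<close> of \<open>tendsto_cutoff\<close>
  becomes unnecessary.\<close>

lemma tendsto_cutoff_below:
  fixes \<tau> :: "nat \<Rightarrow> ennreal" and a :: "nat \<Rightarrow> ennreal"
  assumes "\<tau> \<longlonglongrightarrow> l" "\<And>n. \<tau> n \<le> l" "l \<le> t \<Longrightarrow> a \<longlonglongrightarrow> b"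
  shows "(\<lambda>n. if \<tau> n \<le> t then a n else 0) \<longlonglongrightarrow> (if l \<le> t then b else 0)"
proof (cases "l \<le> t")
  case True
  then have "\<tau> n \<le> t" for n using assms(2)[of n] by simp
  then show ?thesis using assms(3) True by simp
next
  case False
  then show ?thesis using assms(1) by (intro tendsto_cutoff) auto
qed

text \<open>A probability law has at most countably many atoms. The grid exits approach from above
  and could miss an exit exactly at \<open>t\<close>; this is why the density identities below are
  restricted to almost every \<open>t\<close>.\<close>

lemma (in prob_space) AE_lborel_no_atom:
  fixes Z :: "'a \<Rightarrow> ennreal"
  assumes [measurable]: "Z \<in> borel_measurable M"
  shows "AE t in lborel. 0 < t \<longrightarrow> (AE \<omega> in M. Z \<omega> \<noteq> ennreal t)"
proof -
  interpret D: prob_space "distr M borel Z" by (rule prob_space_distr) measurable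
  have "countable {z. D.prob {z} \<noteq> 0}" by (rule D.countable_support)
  moreover have "{t. 0 < t \<and> D.prob {ennreal t} \<noteq> 0} \<subseteq> enn2real ` {z. D.prob {z} \<noteq> 0}"
  proof
    fix t assume "t \<in> {t. 0 < t \<and> D.prob {ennreal t} \<noteq> 0}"
    then have "t = enn2real (ennreal t)" "D.prob {ennreal t} \<noteq> 0" by auto
    then show "t \<in> enn2real ` {z. D.prob {z} \<noteq> 0}" by blast
  qed
  ultimately have "countable {t. 0 < t \<and> D.prob {ennreal t} \<noteq> 0}"
    by (meson countable_image countable_subset)
  then have "AE t in lborel. t \<notin> {t. 0 < t \<and> D.prob {ennreal t} \<noteq> 0}"
    by (intro AE_not_in countable_imp_null_set_lborel)
  then show ?thesis
  proof eventually_elim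
    case (elim t)
    show ?case
    proof
      assume "0 < t"
      with elim have "D.prob {ennreal t} = 0" by simp
      then have "prob (Z -` {ennreal t} \<inter> space M) = 0" by (simp add: measure_distr)
      then have "emeasure M (Z -` {ennreal t} \<inter> space M) = 0" by (simp add: emeasure_eq_measure)
      then have "Z -` {ennreal t} \<inter> space M \<in> null_sets M" by (auto simp: null_sets_def)
      then show "AE \<omega> in M. Z \<omega> \<noteq> ennreal t" using AE_not_in by (auto dest!: AE_not_in)
    qed
  qed
qed

text \<open>Passing to \<open>max f g\<close> turns the inequality into uniqueness of densities,
  which avoids subtracting integrals that may be infinite.\<close>

lemma (in sigma_finite_measure) AE_le_if_set_nn_integral_le:
  assumes [measurable]: "f \<in> borel_measurable M" "g \<in> borel_measurable M"
    and le: "\<And>A. A \<in> sets M \<Longrightarrow> (\<integral>\<^sup>+x. f x * indicator A x \<partial>M) \<le> (\<integral>\<^sup>+x. g x * indicator A x \<partial>M)"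
  shows "AE x in M. f x \<le> (g x :: ennreal)"
proof -
  have "density M (\<lambda>x. max (f x) (g x)) = density M g"
  proof (rule measure_eqI)
    fix A assume "A \<in> sets (density M (\<lambda>x. max (f x) (g x)))"
    then have A[measurable]: "A \<in> sets M" by simp
    define B where "B = {x\<in>space M. g x < f x}"
    have B[measurable]: "B \<in> sets M" unfolding B_def by measurable
    have "(\<integral>\<^sup>+x. max (f x) (g x) * indicator A x \<partial>M) = (\<integral>\<^sup>+x. f x * indicator (A \<inter> B) x + g x * indicator (A - B) x \<partial>M)"
      by (intro nn_integral_cong) (auto simp: B_def indicator_def max_def)
    also have "\<dots> = (\<integral>\<^sup>+x. f x * indicator (A \<inter> B) x \<partial>M) + (\<integral>\<^sup>+x. g x * indicator (A - B) x \<partial>M)"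
      by (intro nn_integral_add) measurable
    also have "\<dots> \<le> (\<integral>\<^sup>+x. g x * indicator (A \<inter> B) x \<partial>M) + (\<integral>\<^sup>+x. g x * indicator (A - B) x \<partial>M)"
      by (intro add_right_mono le) measurable
    also have "\<dots> = (\<integral>\<^sup>+x. g x * indicator (A \<inter> B) x + g x * indicator (A - B) x \<partial>M)"
      by (intro nn_integral_add[symmetric]) measurable
    also have "\<dots> = (\<integral>\<^sup>+x. g x * indicator A x \<partial>M)"
      by (intro nn_integral_cong) (auto simp: indicator_def)
    finally have "(\<integral>\<^sup>+x. max (f x) (g x) * indicator A x \<partial>M) \<le> (\<integral>\<^sup>+x. g x * indicator A x \<partial>M)" .
    moreover have "(\<integral>\<^sup>+x. g x * indicator A x \<partial>M) \<le> (\<integral>\<^sup>+x. max (f x) (g x) * indicator A x \<partial>M)"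
      by (intro nn_integral_mono mult_right_mono) auto
    ultimately show "emeasure (density M (\<lambda>x. max (f x) (g x))) A = emeasure (density M g) A"
      by (simp add: emeasure_density)
  qed simp
  then have "AE x in M. max (f x) (g x) = g x"
    by (intro density_unique) auto
  then show ?thesis by eventually_elim (metis max.cobounded1)
qed

context levy_domain
begin

section \<open>The strong Markov property tested against cosines\<close>

lemma psi_nonneg: "0 \<le> psi u"
  unfolding levy_exponent_def by (intro integral_nonneg_AE) auto

text \<open>\<open>V u \<phi> s y\<close> is the expectation of the test function \<open>1 + cos (u \<bullet> _ + \<phi>)\<close> at time \<open>s\<close> when
  started from \<open>y\<close>; its joint continuity in \<open>(s, y)\<close> makes these the convenient test functions.\<close>

definition V :: "'a \<Rightarrow> real \<Rightarrow> real \<Rightarrow> 'a \<Rightarrow> ennreal" where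
  "V u \<phi> s y = ennreal (1 + cos (u \<bullet> y + \<phi>) * exp (- s * psi u))"

lemma V_le_2: "0 \<le> s \<Longrightarrow> V u \<phi> s y \<le> 2"
proof -
  assume "0 \<le> s"
  then have "cos (u \<bullet> y + \<phi>) * exp (- s * psi u) \<le> 1 * 1"
    using psi_nonneg by (intro mult_mono) auto
  then have "V u \<phi> s y \<le> ennreal 2" unfolding V_def by (intro ennreal_leI) simp
  then show ?thesis by simp
qed

lemma V_measurable[measurable (raw)]:
  assumes [measurable]: "f \<in> borel_measurable N" "g \<in> borel_measurable N"
  shows "(\<lambda>x. V u \<phi> (f x) (g x)) \<in> borel_measurable N"
  unfolding V_def by measurable

lemma V_tendsto:
  assumes "(f \<longlongrightarrow> s) G" "(g \<longlongrightarrow> y) G"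
  shows "((\<lambda>n. V u \<phi> (f n) (g n)) \<longlongrightarrow> V u \<phi> s y) G"
  unfolding V_def 
  by (intro tendsto_ennrealI tendsto_add tendsto_const tendsto_mult isCont_tendsto_compose[OF isCont_cos] tendsto_exp tendsto_minus tendsto_inner assms)

lemma V_eq_expectation:
  assumes "0 \<le> h"
  shows "(\<integral>\<^sup>+z. ennreal (1 + cos (u \<bullet> (y + z) + \<phi>)) \<partial>law h) = V u \<phi> h y"
  using nn_integral_cos_law[OF assms, of u "u \<bullet> y + \<phi>"] by (simp add: V_def inner_add_right algebra_simps)

lemma X_grid_exit_measurable[measurable]: "(\<lambda>\<omega>. X (enn2real (grid_exit k n x \<omega>)) \<omega>) \<in> borel_measurable M"
proof -
  define J where "J \<omega> = nat \<lfloor>enn2real (grid_exit k n x \<omega>) * 2 ^ n\<rfloor>" for \<omega>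
  have J[measurable]: "J \<in> M \<rightarrow>\<^sub>M count_space UNIV" unfolding J_def by measurable
  have "enn2real (grid_exit k n x \<omega>) = real (J \<omega>) / 2 ^ n" for \<omega>
  proof (cases "grid_exit k n x \<omega> < top")
    case True
    then obtain j where "first_exit k n j x \<omega>" using first_exit_exists by blast
    then show ?thesis by (simp add: J_def grid_exit_first_exit)
  next
    case False
    \<comment> \<open>When the path never exits, \<open>enn2real top = 0\<close> on one side and
      \<open>J \<omega> = 0\<close> on the other, so both evaluate the path at time 0.\<close>
    then have "grid_exit k n x \<omega> = top" by (simp add: not_less top_unique)
    then show ?thesis by (simp add: J_def)
  qed
  then have "(\<lambda>\<omega>. X (enn2real (grid_exit k n x \<omega>)) \<omega>) = (\<lambda>\<omega>. X (real (J \<omega>) / 2 ^ n) \<omega>)" by simp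
  also have "\<dots> \<in> borel_measurable M"
    by (rule measurable_compose_countable[OF _ J]) measurable
  finally show ?thesis .
qed

lemma X_grid_exit_tendsto_F_exit:
  assumes "\<omega> \<in> space M"
  shows "(\<lambda>n. X (enn2real (grid_exit k n x \<omega>)) \<omega>) \<longlonglongrightarrow> X (enn2real (F_exit k x \<omega>)) \<omega>"
proof (cases "F_exit k x \<omega> < top")
  case True
  then show ?thesis using X_grid_exit_tendsto[OF assms True, of 0] by simp
next
  case False
  then have "grid_exit k n x \<omega> = F_exit k x \<omega>" for n
    using F_exit_le_grid[of k x \<omega> n] by (simp add: not_less top_unique)
  then show ?thesis by simp
qed

lemma X_F_exit_measurable[measurable]: "(\<lambda>\<omega>. X (enn2real (F_exit k x \<omega>)) \<omega>) \<in> borel_measurable M"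
  by (rule borel_measurable_LIMSEQ_metric[OF X_grid_exit_measurable X_grid_exit_tendsto_F_exit])

text \<open>The position at \<open>D_exit\<close> is almost surely the limit of the positions at the
  announcing times, each of which is measurable as a limit from the grid.\<close>

lemma X_D_exit_measurable[measurable]: "(\<lambda>\<omega>. X (enn2real (D_exit x \<omega>)) \<omega>) \<in> borel_measurable M"
proof (rule borel_measurable_AE_eq)
  show "(\<lambda>\<omega>. if D_exit x \<omega> < top then lim (\<lambda>k. X (enn2real (F_exit k x \<omega>)) \<omega>) else 0) \<in> borel_measurable M"
    using borel_measurable_lim_metric[of "\<lambda>k \<omega>. X (enn2real (F_exit k x \<omega>)) \<omega>" M] by measurable
  show "AE \<omega> in M. X (enn2real (D_exit x \<omega>)) \<omega> = (if D_exit x \<omega> < top then lim (\<lambda>k. X (enn2real (F_exit k x \<omega>)) \<omega>) else 0)"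
    using AE_space quasi_left_continuity[of x]
    by eventually_elim (auto simp: limI not_less top_unique)
qed

lemma grid_strong_markov:
  assumes t: "0 \<le> t"
  shows "(\<integral>\<^sup>+\<omega>. (if grid_exit k n x \<omega> \<le> ennreal t then ennreal (1 + cos (u \<bullet> (x + X t \<omega>) + \<phi>)) else 0) \<partial>M) =
    (\<integral>\<^sup>+\<omega>. (if grid_exit k n x \<omega> \<le> ennreal t then
       V u \<phi> (t - enn2real (grid_exit k n x \<omega>)) (x + X (enn2real (grid_exit k n x \<omega>)) \<omega>) else 0) \<partial>M)"
proof -
  \<comment> \<open>Truncated at 0 to remain a legitimate time; where truncation occurs,
    \<open>G j\<close> vanishes.\<close>
  define h where "h j = max 0 (t - real j / 2 ^ n)" for j :: nat
  define G where "G j y z = (if real j / 2 ^ n \<le> t then ennreal (1 + cos (u \<bullet> (x + y + z) + \<phi>)) else 0)" for j :: nat and y z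
  have Gm: "case_prod (G j) \<in> borel_measurable (borel \<Otimes>\<^sub>M borel)" for j
    unfolding G_def by measurable
  have G_int: "(\<integral>\<^sup>+z. G j y z \<partial>law (h j)) = (if real j / 2 ^ n \<le> t then V u \<phi> (t - real j / 2 ^ n) (x + y) else 0)" for j y
    using V_eq_expectation[of "t - real j / 2 ^ n" u "x + y" \<phi>] by (simp add: G_def h_def)
  have l: "(if grid_exit k n x \<omega> \<le> ennreal t then ennreal (1 + cos (u \<bullet> (x + X t \<omega>) + \<phi>)) else 0) =
     (\<Sum>j. indicator {\<omega>. first_exit k n j x \<omega>} \<omega> * G j (X (real j / 2 ^ n) \<omega>) (X (real j / 2 ^ n + h j) \<omega> - X (real j / 2 ^ n) \<omega>))" for \<omega>
  proof (cases "grid_exit k n x \<omega> < top")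
    case True
    then obtain j where j: "first_exit k n j x \<omega>" using first_exit_exists by blast
    show ?thesis
      unfolding suminf_first_exit[OF j] grid_exit_first_exit[OF j]
      using t by (auto simp: G_def h_def ennreal_le_iff)
  next
    case False
    then have "\<not> grid_exit k n x \<omega> \<le> ennreal t" by (metis ennreal_less_top le_less_trans)
    then show ?thesis by (simp only: suminf_no_exit[OF False] if_False)
  qed
  have r: "(if grid_exit k n x \<omega> \<le> ennreal t then V u \<phi> (t - enn2real (grid_exit k n x \<omega>)) (x + X (enn2real (grid_exit k n x \<omega>)) \<omega>) else 0) =
     (\<Sum>j. indicator {\<omega>. first_exit k n j x \<omega>} \<omega> * (\<integral>\<^sup>+z. G j (X (real j / 2 ^ n) \<omega>) z \<partial>law (h j)))" for \<omega>
  proof (cases "grid_exit k n x \<omega> < top")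
    case True
    then obtain j where j: "first_exit k n j x \<omega>" using first_exit_exists by blast
    show ?thesis
      unfolding suminf_first_exit[OF j] grid_exit_first_exit[OF j] G_int
      using t by (auto simp: ennreal_le_iff)
  next
    case False
    then have "\<not> grid_exit k n x \<omega> \<le> ennreal t" by (metis ennreal_less_top le_less_trans)
    then show ?thesis by (simp only: suminf_no_exit[OF False] if_False)
  qed
  show ?thesis
    unfolding l r by (rule discrete_strong_markov) (auto simp: Gm h_def)
qed

text \<open>Two limits from the grid. As the mesh is refined, exit times decrease, right-continuity
  suffices, and \<open>na\<close> excludes an exit exactly at \<open>t\<close>. As \<open>k\<close>
  grows, exit times increase and \<open>quasi_left_continuity\<close> supplies the convergence of
  the positions.\<close>

lemma strong_markov:
  assumes t: "0 \<le> t" and na: "\<And>k. AE \<omega> in M. F_exit k x \<omega> \<noteq> ennreal t"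
  shows "(\<integral>\<^sup>+\<omega>. (if D_exit x \<omega> \<le> ennreal t then ennreal (1 + cos (u \<bullet> (x + X t \<omega>) + \<phi>)) else 0) \<partial>M) =
    (\<integral>\<^sup>+\<omega>. (if D_exit x \<omega> \<le> ennreal t then
       V u \<phi> (t - enn2real (D_exit x \<omega>)) (x + X (enn2real (D_exit x \<omega>)) \<omega>) else 0) \<partial>M)"
proof -
  let ?g = "\<lambda>\<omega>. ennreal (1 + cos (u \<bullet> (x + X t \<omega>) + \<phi>))"
  let ?L = "\<lambda>T. \<integral>\<^sup>+\<omega>. (if T \<omega> \<le> ennreal t then ?g \<omega> else 0) \<partial>M"
  let ?R = "\<lambda>T. \<integral>\<^sup>+\<omega>. (if T \<omega> \<le> ennreal t then V u \<phi> (t - enn2real (T \<omega>)) (x + X (enn2real (T \<omega>)) \<omega>) else 0) \<partial>M"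
  have [measurable]: "X t \<in> borel_measurable M" using t by simp
  have g2: "?g \<omega> \<le> 2" for \<omega>
  proof -
    have "?g \<omega> \<le> ennreal 2" by (intro ennreal_leI) simp
    then show ?thesis by simp
  qed
  have V2: "(if T \<le> ennreal t then V u \<phi> (t - enn2real T) y else 0) \<le> 2" for T y
    using t by (auto intro!: V_le_2 simp: enn2real_leI)
  have fin: "(\<integral>\<^sup>+\<omega>. 2 \<partial>M) < (\<infinity>::ennreal)" by (simp add: emeasure_space_1)
  have F: "?L (F_exit k x) = ?R (F_exit k x)" for k
  proof (rule LIMSEQ_unique)
    show "(\<lambda>n. ?L (grid_exit k n x)) \<longlonglongrightarrow> ?L (F_exit k x)"
    proof (rule nn_integral_dominated_convergence[where w="\<lambda>_. 2"])
      show "AE \<omega> in M. (\<lambda>n. if grid_exit k n x \<omega> \<le> ennreal t then ?g \<omega> else 0) \<longlonglongrightarrow> (if F_exit k x \<omega> \<le> ennreal t then ?g \<omega> else 0)"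
        using na[of k] by eventually_elim (rule tendsto_cutoff[OF grid_exit_tendsto], auto)
    qed (use g2 fin in auto)
    show "(\<lambda>n. ?L (grid_exit k n x)) \<longlonglongrightarrow> ?R (F_exit k x)"
      unfolding grid_strong_markov[OF t]
    proof (rule nn_integral_dominated_convergence[where w="\<lambda>_. 2"])
      show "AE \<omega> in M. (\<lambda>n. if grid_exit k n x \<omega> \<le> ennreal t then V u \<phi> (t - enn2real (grid_exit k n x \<omega>)) (x + X (enn2real (grid_exit k n x \<omega>)) \<omega>) else 0)
         \<longlonglongrightarrow> (if F_exit k x \<omega> \<le> ennreal t then V u \<phi> (t - enn2real (F_exit k x \<omega>)) (x + X (enn2real (F_exit k x \<omega>)) \<omega>) else 0)"
        using AE_space na[of k]
      proof eventually_elim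
        case (elim \<omega>)
        show ?case
        proof (rule tendsto_cutoff[OF grid_exit_tendsto])
          assume "F_exit k x \<omega> < ennreal t"
          then have "F_exit k x \<omega> < top" by (rule less_trans) simp
          then show "(\<lambda>n. V u \<phi> (t - enn2real (grid_exit k n x \<omega>)) (x + X (enn2real (grid_exit k n x \<omega>)) \<omega>))
            \<longlonglongrightarrow> V u \<phi> (t - enn2real (F_exit k x \<omega>)) (x + X (enn2real (F_exit k x \<omega>)) \<omega>)"
            using elim(1)
            by (intro V_tendsto tendsto_diff tendsto_add tendsto_const X_grid_exit_tendsto_F_exit enn2real_grid_exit_tendsto(1))
        qed (use elim in simp)
      qed
    qed (use V2 fin in auto)
  qed
  show ?thesis
  proof (rule LIMSEQ_unique)
    show "(\<lambda>k. ?L (F_exit k x)) \<longlonglongrightarrow> ?L (D_exit x)"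
    proof (rule nn_integral_dominated_convergence[where w="\<lambda>_. 2"])
      show "AE \<omega> in M. (\<lambda>k. if F_exit k x \<omega> \<le> ennreal t then ?g \<omega> else 0) \<longlonglongrightarrow> (if D_exit x \<omega> \<le> ennreal t then ?g \<omega> else 0)"
        by (intro AE_I2 tendsto_cutoff_below[OF F_exit_tendsto F_exit_le_D] tendsto_const)
    qed (use g2 fin in auto)
    show "(\<lambda>k. ?L (F_exit k x)) \<longlonglongrightarrow> ?R (D_exit x)"
      unfolding F
    proof (rule nn_integral_dominated_convergence[where w="\<lambda>_. 2"])
      show "AE \<omega> in M. (\<lambda>k. if F_exit k x \<omega> \<le> ennreal t then V u \<phi> (t - enn2real (F_exit k x \<omega>)) (x + X (enn2real (F_exit k x \<omega>)) \<omega>) else 0)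
         \<longlonglongrightarrow> (if D_exit x \<omega> \<le> ennreal t then V u \<phi> (t - enn2real (D_exit x \<omega>)) (x + X (enn2real (D_exit x \<omega>)) \<omega>) else 0)"
        using quasi_left_continuity[of x]
      proof eventually_elim
        case (elim \<omega>)
        show ?case
        proof (rule tendsto_cutoff_below[OF F_exit_tendsto F_exit_le_D])
          assume "D_exit x \<omega> \<le> ennreal t"
          then have "D_exit x \<omega> < top" by (rule le_less_trans) simp
          then show "(\<lambda>k. V u \<phi> (t - enn2real (F_exit k x \<omega>)) (x + X (enn2real (F_exit k x \<omega>)) \<omega>))
            \<longlonglongrightarrow> V u \<phi> (t - enn2real (D_exit x \<omega>)) (x + X (enn2real (D_exit x \<omega>)) \<omega>)"
            using elim
            by (intro V_tendsto tendsto_diff tendsto_add tendsto_const enn2real_F_exit_tendsto(1)) auto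
        qed
      qed
    qed (use V2 fin in auto)
  qed
qed

section \<open>The part of the transition density carried by paths that have left
  \<open>D\<close>\<close>

definition exit_density :: "real \<Rightarrow> 'a \<Rightarrow> 'a \<Rightarrow> ennreal" where
  "exit_density t x y = (\<integral>\<^sup>+\<omega>. (if D_exit x \<omega> \<le> ennreal t then
     ennreal (p (t - enn2real (D_exit x \<omega>)) (y - (x + X (enn2real (D_exit x \<omega>)) \<omega>))) else 0) \<partial>M)"

lemma exit_density_measurable[measurable]: "exit_density t x \<in> borel_measurable borel"
  unfolding exit_density_def by measurable

text \<open>Both measures have the same cosine transforms, by the strong Markov property. The
  condition \<open>naD\<close> keeps the remaining time positive, since \<open>p 0\<close> is not a
  density of anything.\<close>

lemma density_exit_density:
  assumes t: "0 < t" and naF: "\<And>k. AE \<omega> in M. F_exit k x \<omega> \<noteq> ennreal t"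
    and naD: "AE \<omega> in M. D_exit x \<omega> \<noteq> ennreal t"
  shows "density lborel (exit_density t x) =
    distr (density M (\<lambda>\<omega>. if D_exit x \<omega> \<le> ennreal t then 1 else 0)) borel (\<lambda>\<omega>. x + X t \<omega>)"
proof -
  let ?Y = "\<lambda>\<omega>. x + X (enn2real (D_exit x \<omega>)) \<omega>" and ?th = "\<lambda>\<omega>. enn2real (D_exit x \<omega>)"
  let ?M = "density M (\<lambda>\<omega>. if D_exit x \<omega> \<le> ennreal t then 1 else 0 :: ennreal)"
  interpret P: pair_sigma_finite M "lborel :: 'a measure" ..
  have [measurable]: "X t \<in> borel_measurable M" using t by simp
  have L: "(\<integral>\<^sup>+y. ennreal (1 + cos (u \<bullet> y + \<phi>)) \<partial>density lborel (exit_density t x)) =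
     (\<integral>\<^sup>+\<omega>. (if D_exit x \<omega> \<le> ennreal t then V u \<phi> (t - ?th \<omega>) (?Y \<omega>) else 0) \<partial>M)" for u \<phi>
  proof -
    have "(\<integral>\<^sup>+y. ennreal (1 + cos (u \<bullet> y + \<phi>)) \<partial>density lborel (exit_density t x)) =
      (\<integral>\<^sup>+y. exit_density t x y * ennreal (1 + cos (u \<bullet> y + \<phi>)) \<partial>lborel)"
      by (rule nn_integral_density) measurable
    also have "\<dots> = (\<integral>\<^sup>+y. (\<integral>\<^sup>+\<omega>. (if D_exit x \<omega> \<le> ennreal t then ennreal (p (t - ?th \<omega>) (y - ?Y \<omega>)) else 0) * ennreal (1 + cos (u \<bullet> y + \<phi>)) \<partial>M) \<partial>lborel)"
      unfolding exit_density_def by (intro nn_integral_cong nn_integral_multc[symmetric]) measurable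
    also have "\<dots> = (\<integral>\<^sup>+\<omega>. (\<integral>\<^sup>+y. (if D_exit x \<omega> \<le> ennreal t then ennreal (p (t - ?th \<omega>) (y - ?Y \<omega>)) else 0) * ennreal (1 + cos (u \<bullet> y + \<phi>)) \<partial>lborel) \<partial>M)"
      by (rule P.Fubini') measurable
    also have "\<dots> = (\<integral>\<^sup>+\<omega>. (if D_exit x \<omega> \<le> ennreal t then V u \<phi> (t - ?th \<omega>) (?Y \<omega>) else 0) \<partial>M)"
    proof (rule nn_integral_cong_AE)
      show "AE \<omega> in M. (\<integral>\<^sup>+y. (if D_exit x \<omega> \<le> ennreal t then ennreal (p (t - ?th \<omega>) (y - ?Y \<omega>)) else 0) * ennreal (1 + cos (u \<bullet> y + \<phi>)) \<partial>lborel)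
        = (if D_exit x \<omega> \<le> ennreal t then V u \<phi> (t - ?th \<omega>) (?Y \<omega>) else 0)"
        using naD
      proof eventually_elim
        case (elim \<omega>)
        show ?case
        proof (cases "D_exit x \<omega> \<le> ennreal t")
          case True
          with elim have lt: "D_exit x \<omega> < ennreal t" by simp
          then have pos: "0 < t - ?th \<omega>"
            using t by (cases "D_exit x \<omega>") (auto simp: ennreal_less_iff)
          have "(\<integral>\<^sup>+y. ennreal (p (t - ?th \<omega>) (y - ?Y \<omega>)) * ennreal (1 + cos (u \<bullet> y + \<phi>)) \<partial>lborel)
            = ennreal (\<bar>1\<bar> ^ DIM('a)) * (\<integral>\<^sup>+z. ennreal (p (t - ?th \<omega>) (?Y \<omega> + 1 *\<^sub>R z - ?Y \<omega>)) * ennreal (1 + cos (u \<bullet> (?Y \<omega> + 1 *\<^sub>R z) + \<phi>)) \<partial>lborel)"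
            by (rule nn_integral_lborel_affine) auto
          also have "\<dots> = (\<integral>\<^sup>+z. ennreal (p (t - ?th \<omega>) z) * ennreal (1 + cos (u \<bullet> (?Y \<omega> + z) + \<phi>)) \<partial>lborel)"
            by simp
          also have "\<dots> = (\<integral>\<^sup>+z. ennreal (1 + cos (u \<bullet> (?Y \<omega> + z) + \<phi>)) \<partial>law (t - ?th \<omega>))"
            unfolding law_density[OF pos] by (rule nn_integral_density[symmetric]) measurable
          also have "\<dots> = V u \<phi> (t - ?th \<omega>) (?Y \<omega>)" using pos by (intro V_eq_expectation) simp
          finally show ?thesis using True by simp
        qed simp
      qed
    qed
    finally show ?thesis .
  qed
  have R: "(\<integral>\<^sup>+y. ennreal (1 + cos (u \<bullet> y + \<phi>)) \<partial>distr ?M borel (\<lambda>\<omega>. x + X t \<omega>)) =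
     (\<integral>\<^sup>+\<omega>. (if D_exit x \<omega> \<le> ennreal t then ennreal (1 + cos (u \<bullet> (x + X t \<omega>) + \<phi>)) else 0) \<partial>M)" for u \<phi>
  proof -
    have "(\<integral>\<^sup>+y. ennreal (1 + cos (u \<bullet> y + \<phi>)) \<partial>distr ?M borel (\<lambda>\<omega>. x + X t \<omega>)) =
       (\<integral>\<^sup>+\<omega>. ennreal (1 + cos (u \<bullet> (x + X t \<omega>) + \<phi>)) \<partial>?M)"
      by (rule nn_integral_distr) measurable
    also have "\<dots> = (\<integral>\<^sup>+\<omega>. (if D_exit x \<omega> \<le> ennreal t then 1 else 0) * ennreal (1 + cos (u \<bullet> (x + X t \<omega>) + \<phi>)) \<partial>M)"
      by (rule nn_integral_density) measurable
    also have "\<dots> = (\<integral>\<^sup>+\<omega>. (if D_exit x \<omega> \<le> ennreal t then ennreal (1 + cos (u \<bullet> (x + X t \<omega>) + \<phi>)) else 0) \<partial>M)"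
      by (intro nn_integral_cong) simp
    finally show ?thesis .
  qed
  show ?thesis
  proof (rule measure_eqI_cos)
    show "finite_measure (distr ?M borel (\<lambda>\<omega>. x + X t \<omega>))"
    proof (rule finite_measure.finite_measure_distr)
      have "(\<integral>\<^sup>+\<omega>. (if D_exit x \<omega> \<le> ennreal t then 1 else 0) \<partial>M) \<le> (\<integral>\<^sup>+\<omega>. 1 \<partial>M)" by (intro nn_integral_mono) auto
      also have "\<dots> < top" by (simp add: emeasure_space_1)
      finally show "finite_measure ?M" by (intro finite_measureI) (auto simp: emeasure_density less_top cong: nn_integral_cong)
    qed measurable
    show "finite_measure (density lborel (exit_density t x))"
    \<comment> \<open>At \<open>u = 0\<close> and \<open>\<phi> = 0\<close> the test function is
      constantly 2, so the transform already computed bounds the total mass.\<close>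
    proof (rule finite_measureI)
      have "(\<integral>\<^sup>+y. 2 \<partial>density lborel (exit_density t x)) = (\<integral>\<^sup>+\<omega>. (if D_exit x \<omega> \<le> ennreal t then V 0 0 (t - ?th \<omega>) (?Y \<omega>) else 0) \<partial>M)"
        using L[of 0 0] by simp
      also have "\<dots> \<le> (\<integral>\<^sup>+\<omega>. 2 \<partial>M)"
        using t by (intro nn_integral_mono) (auto intro!: V_le_2 simp: enn2real_leI)
      also have "\<dots> < top" by (simp add: emeasure_space_1)
      finally show "emeasure (density lborel (exit_density t x)) (space (density lborel (exit_density t x))) \<noteq> \<infinity>"
        by (auto simp: ennreal_mult_less_top)
    qed
    show "(\<integral>\<^sup>+y. ennreal (1 + cos (u \<bullet> y + \<phi>)) \<partial>density lborel (exit_density t x)) =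
      (\<integral>\<^sup>+y. ennreal (1 + cos (u \<bullet> y + \<phi>)) \<partial>distr ?M borel (\<lambda>\<omega>. x + X t \<omega>))" for u \<phi>
      unfolding L R using strong_markov[of t x u \<phi>] t naF by simp
  qed auto
qed

end

section \<open>Killed densities, Green functions and mean exit times\<close>

context levy_domain
begin

lemma exit_time_measurable: "x \<in> D \<Longrightarrow> exit_time X D x \<in> borel_measurable M"
  by (rule borel_measurable_AE_eq[OF D_exit_measurable exit_time_eq_D_exit])

lemma X_exit_time_measurable: "x \<in> D \<Longrightarrow> (\<lambda>\<omega>. X (enn2real (exit_time X D x \<omega>)) \<omega>) \<in> borel_measurable M"
  by (rule borel_measurable_AE_eq[OF X_D_exit_measurable])
    (auto intro: eventually_mono[OF exit_time_eq_D_exit])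

lemma killed_density_measurable:
  assumes x: "x \<in> D" and "f \<in> borel_measurable N" "g \<in> borel_measurable N"
  shows "(\<lambda>z. killed_density M X p D (f z) x (g z)) \<in> borel_measurable N"
proof -
  note [measurable] = exit_time_measurable[OF x] X_exit_time_measurable[OF x] assms(2,3)
  show ?thesis unfolding killed_density_def by measurable
qed

lemma nn_integral_translated_density:
  assumes t: "0 < t" and [measurable]: "A \<in> sets borel"
  shows "(\<integral>\<^sup>+y. ennreal (p t (y - x)) * indicator A y \<partial>lborel) = (\<integral>\<^sup>+\<omega>. indicator A (x + X t \<omega>) \<partial>M)"
proof -
  have "(\<integral>\<^sup>+y. ennreal (p t (y - x)) * indicator A y \<partial>lborel) =
    ennreal (\<bar>1\<bar> ^ DIM('a)) * (\<integral>\<^sup>+z. ennreal (p t (x + 1 *\<^sub>R z - x)) * indicator A (x + 1 *\<^sub>R z) \<partial>lborel)"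
    by (rule nn_integral_lborel_affine) auto
  also have "\<dots> = (\<integral>\<^sup>+z. ennreal (p t z) * indicator A (x + z) \<partial>lborel)" by simp
  also have "\<dots> = (\<integral>\<^sup>+z. indicator A (x + z) \<partial>law t)"
    unfolding law_density[OF t] by (rule nn_integral_density[symmetric]) measurable
  also have "\<dots> = (\<integral>\<^sup>+\<omega>. indicator A (x + X t \<omega>) \<partial>M)"
    using t by (intro nn_integral_law) auto
  finally show ?thesis .
qed

lemma killed_density_eq_exit_density:
  assumes x: "x \<in> D" and t: "0 < t" and na: "AE \<omega> in M. D_exit x \<omega> \<noteq> ennreal t"
  shows "killed_density M X p D t x y = p t (y - x) - enn2real (exit_density t x y)"
proof -
  note [measurable] = exit_time_measurable[OF x] X_exit_time_measurable[OF x]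
  let ?f = "\<lambda>\<omega>. if D_exit x \<omega> \<le> ennreal t then p (t - enn2real (D_exit x \<omega>)) (y - (x + X (enn2real (D_exit x \<omega>)) \<omega>)) else 0"
  have "(\<integral>\<omega>. (if exit_time X D x \<omega> \<le> ennreal t
            then p (t - enn2real (exit_time X D x \<omega>)) (y - (x + X (enn2real (exit_time X D x \<omega>)) \<omega>))
            else 0) \<partial>M) = (\<integral>\<omega>. ?f \<omega> \<partial>M)"
    by (rule integral_cong_AE) (use exit_time_eq_D_exit[OF x] in auto)
  also have "\<dots> = enn2real (\<integral>\<^sup>+\<omega>. ennreal (?f \<omega>) \<partial>M)"
  proof (rule integral_eq_nn_integral)
    show "AE \<omega> in M. 0 \<le> ?f \<omega>"
      using na
    proof eventually_elim
      case (elim \<omega>)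
      have "0 < t - enn2real (D_exit x \<omega>)" if "D_exit x \<omega> \<le> ennreal t"
        using that elim t by (cases "D_exit x \<omega>") (auto simp: ennreal_le_iff ennreal_inj less_le)
      then show ?case using p_nonneg by auto
    qed
  qed measurable
  also have "(\<integral>\<^sup>+\<omega>. ennreal (?f \<omega>) \<partial>M) = exit_density t x y"
    unfolding exit_density_def by (intro nn_integral_cong) auto
  finally show ?thesis unfolding killed_density_def by simp
qed

text \<open>The transition density splits into the killed density and \<open>exit_density\<close>,
  while the event at time \<open>t\<close> splits into survival and exit; the exit parts agree and
  are finite, so they cancel. The exceptional times come from atoms of the exit times and do not
  depend on \<open>A\<close>.\<close>

lemma killed_density_Q:
  assumes x: "x \<in> D"
  shows "AE t in lborel. 0 < t \<longrightarrow> (\<forall>A\<in>sets borel.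
    (\<integral>\<^sup>+y. ennreal (killed_density M X p D t x y) * indicator A y \<partial>lborel) = Q t x (indicator A))"
proof -
  have "AE t in lborel. \<forall>k. 0 < t \<longrightarrow> (AE \<omega> in M. F_exit k x \<omega> \<noteq> ennreal t)"
    by (rule AE_all_countable[THEN iffD2], rule allI, rule AE_lborel_no_atom) measurable
  moreover have "AE t in lborel. 0 < t \<longrightarrow> (AE \<omega> in M. D_exit x \<omega> \<noteq> ennreal t)"
    by (rule AE_lborel_no_atom) measurable
  ultimately show ?thesis
  proof eventually_elim
    case (elim t)
    show ?case
    proof (intro impI ballI)
      assume t: "0 < t"
      fix A :: "'a set" assume A[measurable]: "A \<in> sets borel"
      have [measurable]: "X t \<in> borel_measurable M" using t by simp
      have km[measurable]: "(\<lambda>y. killed_density M X p D t x y) \<in> borel_measurable borel"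
        by (rule killed_density_measurable[OF x]) measurable
      note E = density_exit_density[OF t, of x]
      have R: "(\<integral>\<^sup>+y. exit_density t x y * indicator C y \<partial>lborel) =
         (\<integral>\<^sup>+\<omega>. (if D_exit x \<omega> \<le> ennreal t then 1 else 0) * indicator C (x + X t \<omega>) \<partial>M)" if [measurable]: "C \<in> sets borel" for C
      proof -
        have "(\<integral>\<^sup>+y. exit_density t x y * indicator C y \<partial>lborel) = emeasure (density lborel (exit_density t x)) C"
          by (simp add: emeasure_density)
        also have "\<dots> = emeasure (distr (density M (\<lambda>\<omega>. if D_exit x \<omega> \<le> ennreal t then 1 else 0)) borel (\<lambda>\<omega>. x + X t \<omega>)) C"
          using E elim t by simp
        also have "\<dots> = (\<integral>\<^sup>+y. indicator C y \<partial>distr (density M (\<lambda>\<omega>. if D_exit x \<omega> \<le> ennreal t then 1 else 0)) borel (\<lambda>\<omega>. x + X t \<omega>))"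
          by simp
        also have "\<dots> = (\<integral>\<^sup>+\<omega>. indicator C (x + X t \<omega>) \<partial>density M (\<lambda>\<omega>. if D_exit x \<omega> \<le> ennreal t then 1 else 0))"
          by (rule nn_integral_distr) measurable
        also have "\<dots> = (\<integral>\<^sup>+\<omega>. (if D_exit x \<omega> \<le> ennreal t then 1 else 0) * indicator C (x + X t \<omega>) \<partial>M)"
          by (rule nn_integral_density) measurable
        finally show ?thesis .
      qed
      \<comment> \<open>This makes the killed density nonnegative almost everywhere, so that nothing
        is lost when \<open>ennreal\<close> truncates negative values to 0.\<close>
      have le: "AE y in lborel. exit_density t x y \<le> ennreal (p t (y - x))"
      proof (rule lborel.AE_le_if_set_nn_integral_le)
        fix C :: "'a set" assume "C \<in> sets lborel"
        then have [measurable]: "C \<in> sets borel" by simp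
        show "(\<integral>\<^sup>+y. exit_density t x y * indicator C y \<partial>lborel) \<le> (\<integral>\<^sup>+y. ennreal (p t (y - x)) * indicator C y \<partial>lborel)"
          unfolding nn_integral_translated_density[OF t \<open>C \<in> sets borel\<close>] R[OF \<open>C \<in> sets borel\<close>]
          by (intro nn_integral_mono) auto
      qed measurable
      have fin: "(\<integral>\<^sup>+y. exit_density t x y * indicator A y \<partial>lborel) < top"
      proof -
        have "(\<integral>\<^sup>+y. exit_density t x y * indicator A y \<partial>lborel) \<le> (\<integral>\<^sup>+\<omega>. 1 \<partial>M)"
          unfolding R[OF A] by (intro nn_integral_mono) (auto simp: indicator_def)
        then show ?thesis by (simp add: emeasure_space_1 le_less_trans)
      qed
      have "(\<integral>\<^sup>+y. ennreal (killed_density M X p D t x y) * indicator A y \<partial>lborel) + (\<integral>\<^sup>+y. exit_density t x y * indicator A y \<partial>lborel)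
        = (\<integral>\<^sup>+y. ennreal (killed_density M X p D t x y) * indicator A y + exit_density t x y * indicator A y \<partial>lborel)"
        by (rule nn_integral_add[symmetric]) measurable
      also have "\<dots> = (\<integral>\<^sup>+y. ennreal (p t (y - x)) * indicator A y \<partial>lborel)"
      proof (rule nn_integral_cong_AE)
        show "AE y in lborel. ennreal (killed_density M X p D t x y) * indicator A y + exit_density t x y * indicator A y = ennreal (p t (y - x)) * indicator A y"
          using le
        proof eventually_elim
          case (elim y)
          then have ft: "exit_density t x y < top" by (rule le_less_trans) simp
          have "enn2real (exit_density t x y) \<le> p t (y - x)"
            using elim p_nonneg[OF t] by (intro enn2real_leI)
          then have "ennreal (p t (y - x) - enn2real (exit_density t x y)) + ennreal (enn2real (exit_density t x y)) = ennreal (p t (y - x))"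
            by (subst ennreal_plus[symmetric]) auto
          then have "ennreal (killed_density M X p D t x y) + exit_density t x y = ennreal (p t (y - x))"
            using ft killed_density_eq_exit_density[OF x t] \<open>0 < t \<longrightarrow> (AE \<omega> in M. D_exit x \<omega> \<noteq> ennreal t)\<close> t by simp
          then show ?case by (auto simp: indicator_def)
        qed
      qed
      also have "\<dots> = (\<integral>\<^sup>+\<omega>. indicator A (x + X t \<omega>) \<partial>M)" by (rule nn_integral_translated_density[OF t A])
      also have "\<dots> = (\<integral>\<^sup>+\<omega>. indicator {\<omega>. ennreal t < D_exit x \<omega>} \<omega> * indicator A (x + X t \<omega>) + (if D_exit x \<omega> \<le> ennreal t then 1 else 0) * indicator A (x + X t \<omega>) \<partial>M)"
        by (intro nn_integral_cong) (auto simp: indicator_def)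
      also have "\<dots> = Q t x (indicator A) + (\<integral>\<^sup>+\<omega>. (if D_exit x \<omega> \<le> ennreal t then 1 else 0) * indicator A (x + X t \<omega>) \<partial>M)"
        unfolding Q_def by (rule nn_integral_add) measurable
      finally show "(\<integral>\<^sup>+y. ennreal (killed_density M X p D t x y) * indicator A y \<partial>lborel) = Q t x (indicator A)"
        using fin unfolding R[OF A] add.commute[of _ "\<integral>\<^sup>+\<omega>. _ \<omega> \<partial>M"] by (auto simp: ennreal_add_left_cancel)
    qed
  qed
qed

section \<open>Mean exit times and finiteness of the Green function\<close>

definition mean_exit :: "'a \<Rightarrow> ennreal" where "mean_exit x = (\<integral>\<^sup>+\<omega>. D_exit x \<omega> \<partial>M)"

lemma mean_exit_measurable[measurable]: "mean_exit \<in> borel_measurable borel"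
proof -
  have "mean_exit = (\<lambda>x. \<integral>\<^sup>+\<omega>. D_exit (fst (x, \<omega>)) (snd (x, \<omega>)) \<partial>M)" by (auto simp: mean_exit_def)
  also have "\<dots> \<in> borel_measurable borel" by (rule borel_measurable_nn_integral) measurable
  finally show ?thesis .
qed

lemma expected_exit_eq_mean_exit: "x \<in> D \<Longrightarrow> expected_exit M X D x = mean_exit x"
  unfolding expected_exit_def mean_exit_def by (rule nn_integral_cong_AE) (rule exit_time_eq_D_exit)

text \<open>Property A concerns only \<open>y \<in> D\<close>; for other \<open>y\<close> the
  product of mean exit times vanishes, so the same bound holds.\<close>

lemma mean_exit_outside: "x \<notin> D \<Longrightarrow> mean_exit x = 0"
proof -
  assume "x \<notin> D"
  have "D_exit x \<omega> = 0" if "\<omega> \<in> space M" for \<omega>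
  proof -
    have "F_exit k x \<omega> \<le> 0" for k
      using F_exit_le[of x 0 0 \<omega> k] F_subset[of k] \<open>x \<notin> D\<close> that by auto
    then show ?thesis by (simp add: D_exit_def)
  qed
  then show ?thesis unfolding mean_exit_def by (simp cong: nn_integral_cong)
qed

text \<open>Markov's inequality for the exit time.\<close>

lemma Q_le_mean_exit: "0 < s \<Longrightarrow> Q s x (\<lambda>_. 1) \<le> ennreal (1 / s) * mean_exit x"
proof -
  assume s: "0 < s"
  have "ennreal s * Q s x (\<lambda>_. 1) = (\<integral>\<^sup>+\<omega>. ennreal s * indicator {\<omega>. ennreal s < D_exit x \<omega>} \<omega> \<partial>M)"
    unfolding Q_def by (subst nn_integral_cmult[symmetric]) auto
  also have "\<dots> \<le> mean_exit x" unfolding mean_exit_def by (intro nn_integral_mono) (auto simp: indicator_def)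
  finally have "ennreal (1 / s) * (ennreal s * Q s x (\<lambda>_. 1)) \<le> ennreal (1 / s) * mean_exit x"
    by (rule mult_left_mono) simp
  moreover have "ennreal (1 / s) * ennreal s = 1" using s by (simp add: ennreal_mult'[symmetric])
  ultimately show ?thesis by (simp add: mult.assoc[symmetric])
qed

lemma Q_time_measurable[measurable]: "(\<lambda>t. Q t x (\<lambda>_. 1)) \<in> borel_measurable borel"
proof -
  have "(\<lambda>t. Q t x (\<lambda>_. 1)) = (\<lambda>t. \<integral>\<^sup>+\<omega>. (if ennreal t < D_exit x \<omega> then 1 else 0) \<partial>M)"
    unfolding Q_def by (auto intro!: nn_integral_cong)
  also have "\<dots> \<in> borel_measurable borel" by measurable
  finally show ?thesis .
qed

text \<open>Layer-cake formula, with infinite exit times included.\<close>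

lemma mean_exit_eq_integral_Q: "mean_exit x = (\<integral>\<^sup>+t. Q t x (\<lambda>_. 1) * indicator {0<..} t \<partial>lborel)"
proof -
  interpret P: pair_sigma_finite M "lborel :: real measure" ..
  have layer: "(\<integral>\<^sup>+t. (if ennreal t < z then 1 else 0) * indicator {0<..} t \<partial>lborel) = z" for z :: ennreal
  proof (cases z)
    case (real r)
    then have "(\<integral>\<^sup>+t. (if ennreal t < z then 1 else 0) * indicator {0<..} t \<partial>lborel) = (\<integral>\<^sup>+t. indicator {0<..<r} t \<partial>lborel)"
      by (intro nn_integral_cong) (auto simp: indicator_def ennreal_less_iff)
    then show ?thesis using real by simp
  next
    case top
    then have "(\<integral>\<^sup>+t. (if ennreal t < z then 1 else 0) * indicator {0<..} t \<partial>lborel) = (\<integral>\<^sup>+t. indicator {0::real<..} t \<partial>lborel)"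
      by (intro nn_integral_cong) auto
    also have "\<dots> = emeasure lborel {0::real<..}" by simp
    also have "\<dots> = top"
    proof -
      have "ennreal (real n) \<le> emeasure lborel {0::real<..}" for n :: nat
      proof -
        have "ennreal (real n) = emeasure lborel {0<..<real n}" by simp
        also have "\<dots> \<le> emeasure lborel {0::real<..}" by (intro emeasure_mono) auto
        finally show ?thesis .
      qed
      then show ?thesis using ennreal_Ex_less_of_nat[of "emeasure lborel {0::real<..}"]
        by (metis ennreal_of_nat_eq_real_of_nat leD less_top)
    qed
    finally show ?thesis using top by simp
  qed
  have "mean_exit x = (\<integral>\<^sup>+\<omega>. (\<integral>\<^sup>+t. (if ennreal t < D_exit x \<omega> then 1 else 0) * indicator {0<..} t \<partial>lborel) \<partial>M)"
    unfolding mean_exit_def layer ..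
  also have "\<dots> = (\<integral>\<^sup>+t. (\<integral>\<^sup>+\<omega>. (if ennreal t < D_exit x \<omega> then 1 else 0) * indicator {0<..} t \<partial>M) \<partial>lborel)"
    by (rule P.Fubini'[symmetric]) measurable
  also have "\<dots> = (\<integral>\<^sup>+t. Q t x (\<lambda>_. 1) * indicator {0<..} t \<partial>lborel)"
    unfolding Q_def by (intro nn_integral_cong, subst nn_integral_multc) (auto intro!: nn_integral_cong arg_cong2[where f="(*)"])
  finally show ?thesis .
qed

lemma Q_le_1: "Q t x (\<lambda>_. 1) \<le> 1"
proof -
  have "Q t x (\<lambda>_. 1) \<le> (\<integral>\<^sup>+\<omega>. 1 \<partial>M)" unfolding Q_def by (intro nn_integral_mono) (auto simp: indicator_def)
  then show ?thesis by (simp add: emeasure_space_1)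
qed

text \<open>Shifting time by \<open>s0\<close> multiplies survival by at most \<open>q\<close>, so
  the integral beyond \<open>s0\<close> is at most \<open>q\<close> times the whole. Reducing to a
  bounded time interval matters because the comparison factor \<open>exp (L * t)\<close> of the two
  processes is useless over all times.\<close>

lemma mean_exit_le_short_time:
  assumes q: "0 \<le> q" "q < 1" "0 < s0" "\<And>x. x \<in> D \<Longrightarrow> (\<integral>\<^sup>+z. indicator D (x + z) \<partial>law s0) \<le> ennreal q"
  shows "mean_exit x \<le> ennreal (1 / (1 - q)) * (\<integral>\<^sup>+t. Q t x (\<lambda>_. 1) * indicator {0<..s0} t \<partial>lborel)"
proof -
  let ?A = "\<integral>\<^sup>+t. Q t x (\<lambda>_. 1) * indicator {0<..s0} t \<partial>lborel"
  let ?I = "\<lambda>m::nat. \<integral>\<^sup>+t. Q t x (\<lambda>_. 1) * indicator {0<..real m} t \<partial>lborel"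
  \<comment> \<open>Truncating at time \<open>m\<close> makes the integral finite, so its
    \<open>q\<close>-fold can be absorbed on the left; monotone convergence removes \<open>m\<close>
    afterwards.\<close>
  have I_fin: "?I m < top" for m
  proof -
    have "?I m \<le> (\<integral>\<^sup>+t. indicator {0<..real m} t \<partial>lborel)"
      using Q_le_1 by (intro nn_integral_mono) (auto simp: indicator_def)
    then show ?thesis by (simp add: le_less_trans)
  qed
  have A_fin: "?A < top"
  proof -
    have "?A \<le> (\<integral>\<^sup>+t. indicator {0<..s0} t \<partial>lborel)"
      using Q_le_1 by (intro nn_integral_mono) (auto simp: indicator_def)
    then show ?thesis using q(3) by (simp add: le_less_trans)
  qed
  have I_le: "?I m \<le> ?A + ennreal q * ?I m" for m
  proof -
    have "?I m \<le> (\<integral>\<^sup>+t. Q t x (\<lambda>_. 1) * indicator {0<..s0} t + Q t x (\<lambda>_. 1) * indicator {s0<..real m} t \<partial>lborel)"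
      by (intro nn_integral_mono) (auto simp: indicator_def)
    also have "\<dots> = ?A + (\<integral>\<^sup>+t. Q t x (\<lambda>_. 1) * indicator {s0<..real m} t \<partial>lborel)"
      by (rule nn_integral_add) measurable
    also have "(\<integral>\<^sup>+t. Q t x (\<lambda>_. 1) * indicator {s0<..real m} t \<partial>lborel) =
      ennreal \<bar>1\<bar> * (\<integral>\<^sup>+t. Q (s0 + 1 * t) x (\<lambda>_. 1) * indicator {s0<..real m} (s0 + 1 * t) \<partial>lborel)"
      by (rule nn_integral_real_affine) auto
    also have "\<dots> \<le> (\<integral>\<^sup>+t. ennreal q * (Q t x (\<lambda>_. 1) * indicator {0<..real m} t) \<partial>lborel)"
    proof (simp, rule nn_integral_mono)
      fix t
      show "Q (s0 + t) x (\<lambda>_. 1) * indicator {s0<..real m} (s0 + t) \<le> ennreal q * (Q t x (\<lambda>_. 1) * indicator {0<..real m} t)"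
      proof (cases "0 < t \<and> s0 + t \<le> real m")
        case True
        then have "Q (t + s0) x (\<lambda>_. 1) \<le> ennreal q * Q t x (\<lambda>_. 1)" using q(3) by (intro Q_escape q(4)) auto
        then show ?thesis using True q(3) by (simp add: add.commute)
      qed (auto simp: indicator_def)
    qed
    also have "\<dots> = ennreal q * ?I m" by (rule nn_integral_cmult) measurable
    finally show ?thesis by (simp add: add_left_mono)
  qed
  have I_bd: "?I m \<le> ennreal (1 / (1 - q)) * ?A" for m
  proof -
    obtain i where i: "0 \<le> i" "?I m = ennreal i" using I_fin[of m] by (cases "?I m") auto
    obtain a where a: "0 \<le> a" "?A = ennreal a" using A_fin by (cases "?A") auto
    have "ennreal i \<le> ennreal (a + q * i)"
      using I_le[of m] i a q(1) by (simp add: ennreal_mult')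
    then have "i \<le> a + q * i" using i a q(1) by (simp add: ennreal_le_iff del: ennreal_plus)
    then have "i \<le> 1 / (1 - q) * a" using q(2) by (simp add: field_simps)
    then have "ennreal i \<le> ennreal (1 / (1 - q) * a)" by (rule ennreal_leI)
    then show ?thesis unfolding i(2) a(2) using q(2) by (subst ennreal_mult'[symmetric]) auto
  qed
  have "mean_exit x = (\<integral>\<^sup>+t. (SUP m. Q t x (\<lambda>_. 1) * indicator {0<..real m} t) \<partial>lborel)"
    unfolding mean_exit_eq_integral_Q
  proof (rule nn_integral_cong)
    fix t :: real
    show "Q t x (\<lambda>_. 1) * indicator {0<..} t = (SUP m. Q t x (\<lambda>_. 1) * indicator {0<..real m} t)"
    proof (cases "0 < t")
      case True
      obtain m :: nat where m: "t \<le> real m" using real_arch_simple[of t] by blast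
      have "(SUP m. Q t x (\<lambda>_. 1) * indicator {0<..real m} t) = Q t x (\<lambda>_. 1)"
      proof (rule antisym)
        show "(SUP m. Q t x (\<lambda>_. 1) * indicator {0<..real m} t) \<le> Q t x (\<lambda>_. 1)"
          by (rule SUP_least) (auto simp: indicator_def)
        show "Q t x (\<lambda>_. 1) \<le> (SUP m. Q t x (\<lambda>_. 1) * indicator {0<..real m} t)"
          by (rule SUP_upper2[of m]) (use True m in auto)
      qed
      then show ?thesis using True by simp
    qed simp
  qed
  also have "\<dots> = (SUP m. ?I m)"
    by (rule nn_integral_monotone_convergence_SUP) (auto simp: incseq_def le_fun_def indicator_def)
  also have "\<dots> \<le> ennreal (1 / (1 - q)) * ?A" by (rule SUP_least) (rule I_bd)
  finally show ?thesis .
qed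

lemma mean_exit_finite: "mean_exit x < top"
proof -
  obtain q s0 :: real where q: "0 \<le> q" "q < 1" "0 < s0" "\<And>x. x \<in> D \<Longrightarrow> (\<integral>\<^sup>+z. indicator D (x + z) \<partial>law s0) \<le> ennreal q"
    using escape by blast
  have "(\<integral>\<^sup>+t. Q t x (\<lambda>_. 1) * indicator {0<..s0} t \<partial>lborel) \<le> (\<integral>\<^sup>+t. indicator {0<..s0} t \<partial>lborel)"
    using Q_le_1 by (intro nn_integral_mono) (auto simp: indicator_def)
  also have "\<dots> < top" using q(3) by simp
  finally have "ennreal (1 / (1 - q)) * (\<integral>\<^sup>+t. Q t x (\<lambda>_. 1) * indicator {0<..s0} t \<partial>lborel) < top"
    by (simp add: ennreal_mult_less_top)
  with mean_exit_le_short_time[OF q, of x] show ?thesis by (rule le_less_trans)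
qed

text \<open>Integrated over \<open>y\<close>, the Green function gives the mean exit time, which is
  finite. The absorption argument in \<open>green_le\<close> relies on this.\<close>

lemma green_finite:
  assumes x: "x \<in> D"
  shows "AE y in lborel. green M X p D x y < top"
proof -
  note [measurable (raw)] = killed_density_measurable[OF x]
  have gm: "(\<lambda>(t, y). ennreal (killed_density M X p D t x y) * indicator {0<..} t) \<in> borel_measurable (lborel \<Otimes>\<^sub>M lborel)"
    by measurable
  have m: "green M X p D x \<in> borel_measurable lborel"
    unfolding green_def by measurable
  have "(\<integral>\<^sup>+y. green M X p D x y \<partial>lborel) = (\<integral>\<^sup>+t. (\<integral>\<^sup>+y. ennreal (killed_density M X p D t x y) * indicator {0<..} t \<partial>lborel) \<partial>lborel)"
    unfolding green_def by (rule lborel_pair.Fubini'[OF gm])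
  also have "\<dots> = (\<integral>\<^sup>+t. Q t x (\<lambda>_. 1) * indicator {0<..} t \<partial>lborel)"
  proof (rule nn_integral_cong_AE)
    show "AE t in lborel. (\<integral>\<^sup>+y. ennreal (killed_density M X p D t x y) * indicator {0<..} t \<partial>lborel) = Q t x (\<lambda>_. 1) * indicator {0<..} t"
      using killed_density_Q[OF x]
    proof eventually_elim
      case (elim t)
      show ?case
      proof (cases "0 < t")
        case True
        have "(\<integral>\<^sup>+y. ennreal (killed_density M X p D t x y) * indicator UNIV y \<partial>lborel) = Q t x (indicator UNIV)"
          by (rule elim[rule_format, OF True]) simp
        then show ?thesis using True by (simp add: Q_def)
      qed simp
    qed
  qed
  also have "\<dots> = mean_exit x" by (rule mean_exit_eq_integral_Q[symmetric])
  also have "\<dots> < top" by (rule mean_exit_finite)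
  finally have "(\<integral>\<^sup>+y. green M X p D x y \<partial>lborel) \<noteq> \<infinity>" by simp
  with m have "AE y in lborel. green M X p D x y \<noteq> \<infinity>" by (rule nn_integral_PInf_AE)
  then show ?thesis by eventually_elim (simp add: less_top)
qed

end

section \<open>Comparison of the two processes\<close>

lemma nn_integral_sum_measure:
  assumes "sets M = sets K" "sets N = sets K"
    and "\<And>A. A \<in> sets K \<Longrightarrow> emeasure K A = emeasure M A + emeasure N A"
    and "f \<in> borel_measurable K"
  shows "(\<integral>\<^sup>+x. f x \<partial>K) = (\<integral>\<^sup>+x. f x \<partial>M) + (\<integral>\<^sup>+x. f x \<partial>N)"
  using assms(4)
proof (induction rule: borel_measurable_induct)
  note [measurable_cong] = assms(1,2)
  have sp: "space M = space K" "space N = space K" using assms(1,2) by (auto dest: sets_eq_imp_space_eq)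
  {
    case (cong f g)
    have "(\<integral>\<^sup>+x. f x \<partial>L) = (\<integral>\<^sup>+x. g x \<partial>L)" if "space L = space K" for L
      by (intro nn_integral_cong) (use cong(3) that in auto)
    then show ?case using cong(4) sp by simp
  next
    case (set A)
    then show ?case using assms by simp
  next
    case (mult u c)
    note [measurable] = mult(2)
    show ?case using mult by (simp add: nn_integral_cmult distrib_left)
  next
    case (add u v)
    note [measurable] = add(1,3)
    show ?case using add by (simp add: nn_integral_add algebra_simps)
  next
    case (seq U)
    note [measurable] = seq(1)
    have "(\<integral>\<^sup>+x. (SUP i. U i x) \<partial>L) = (SUP i. \<integral>\<^sup>+x. U i x \<partial>L)" if [measurable_cong]: "sets L = sets K" for L
      by (rule nn_integral_monotone_convergence_SUP) (use seq(3) in auto)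
    moreover have "incseq (\<lambda>i. \<integral>\<^sup>+x. U i x \<partial>L)" for L
      using seq(3) by (auto simp: incseq_def le_fun_def intro!: nn_integral_mono)
    ultimately show ?case
      using seq assms(1,2) by (simp add: image_comp ennreal_SUP_add)
  }
qed

lemma one_minus_cos_le: "1 - cos r \<le> r\<^sup>2 / (2::real)"
proof -
  have "cos r = 1 - 2 * (sin (r / 2))\<^sup>2" using cos_double_sin[of "r / 2"] by simp
  moreover have "(sin (r / 2))\<^sup>2 \<le> (r / 2)\<^sup>2"
    using abs_sin_x_le_abs_x[of "r / 2"] by (subst abs_le_square_iff[symmetric])
  ultimately show ?thesis by (simp add: power_divide)
qed

text \<open>Without finiteness the exponent could be the default value 0 of a Bochner integral, and
  additivity in the Levy measure would fail.\<close>

lemma nn_integral_levy_exponent_finite: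
  fixes \<nu> :: "'a::euclidean_space measure"
  assumes "symmetric_levy_measure \<nu>"
  shows "(\<integral>\<^sup>+z. ennreal (1 - cos (u \<bullet> z)) \<partial>\<nu>) < top"
proof -
  have [measurable_cong]: "sets \<nu> = sets borel" using assms by (simp add: symmetric_levy_measure_def)
  \<comment> \<open>The 2 bounds \<open>1 - cos\<close> globally and the second term covers the
    quadratic bound, so \<open>C\<close> serves both branches of the minimum.\<close>
  define C where "C = 2 + (norm u)\<^sup>2"
  have C: "0 \<le> C" by (simp add: C_def)
  have bd: "1 - cos (u \<bullet> z) \<le> C * min 1 (norm z ^ 2)" for z
  proof -
    have "1 - cos (u \<bullet> z) \<le> 2" using cos_ge_minus_one[of "u \<bullet> z"] by linarith
    then have 1: "1 - cos (u \<bullet> z) \<le> C * 1" by (simp add: C_def add_increasing2)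
    have "1 - cos (u \<bullet> z) \<le> (u \<bullet> z)\<^sup>2 / 2" by (rule one_minus_cos_le)
    also have "\<dots> \<le> (norm u * norm z)\<^sup>2 / 2"
      using Cauchy_Schwarz_ineq2[of u z] by (intro divide_right_mono) (auto simp: abs_le_square_iff[symmetric])
    also have "\<dots> = (norm u)\<^sup>2 / 2 * (norm z)\<^sup>2" by (simp add: power_mult_distrib)
    also have "\<dots> \<le> C * (norm z)\<^sup>2" by (intro mult_right_mono) (auto simp: C_def)
    finally show ?thesis using 1 by (auto simp: min_def)
  qed
  have "(\<integral>\<^sup>+z. ennreal (1 - cos (u \<bullet> z)) \<partial>\<nu>) \<le> (\<integral>\<^sup>+z. ennreal C * ennreal (min 1 (norm z ^ 2)) \<partial>\<nu>)"
    using bd C by (intro nn_integral_mono) (auto simp: ennreal_mult'[symmetric] intro!: ennreal_leI)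
  also have "\<dots> = ennreal C * (\<integral>\<^sup>+z. ennreal (min 1 (norm z ^ 2)) \<partial>\<nu>)"
    by (rule nn_integral_cmult) measurable
  also have "\<dots> < top" using assms by (simp add: symmetric_levy_measure_def ennreal_mult_less_top)
  finally show ?thesis .
qed

lemma levy_exponent_add:
  fixes \<nu>X \<nu>Y \<sigma> :: "'a::euclidean_space measure"
  assumes sX: "symmetric_levy_measure \<nu>X" and sY: "symmetric_levy_measure \<nu>Y"
    and fin: "finite_measure \<sigma>" and sets: "sets \<sigma> = sets borel"
    and sum: "\<forall>A\<in>sets borel. emeasure \<nu>X A = emeasure \<nu>Y A + emeasure \<sigma> A"
  shows "levy_exponent \<nu>X u = levy_exponent \<nu>Y u + (measure \<sigma> UNIV - (\<integral>z. cos (u \<bullet> z) \<partial>\<sigma>))"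
proof -
  interpret s: finite_measure \<sigma> by fact
  note [measurable_cong] = sets
  have b: "sets \<nu>X = sets borel" "sets \<nu>Y = sets borel" using sX sY by (simp_all add: symmetric_levy_measure_def)
  note [measurable_cong] = b
  have sp: "space \<sigma> = UNIV" using sets_eq_imp_space_eq[OF sets] by simp
  let ?f = "\<lambda>z. ennreal (1 - cos (u \<bullet> z))"
  have exp: "levy_exponent \<nu> u = enn2real (\<integral>\<^sup>+z. ?f z \<partial>\<nu>)" if [measurable_cong]: "sets \<nu> = sets borel" for \<nu> :: "'a measure"
    unfolding levy_exponent_def by (rule integral_eq_nn_integral) auto
  have i: "integrable \<sigma> (\<lambda>z. cos (u \<bullet> z))"
    by (rule s.integrable_const_bound[where B=1]) auto
  have "(\<integral>\<^sup>+z. ?f z \<partial>\<nu>X) = (\<integral>\<^sup>+z. ?f z \<partial>\<nu>Y) + (\<integral>\<^sup>+z. ?f z \<partial>\<sigma>)"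
    by (rule nn_integral_sum_measure) (use b sets sum in auto)
  moreover have "(\<integral>\<^sup>+z. ?f z \<partial>\<nu>Y) < top" by (rule nn_integral_levy_exponent_finite[OF sY])
  moreover have "(\<integral>\<^sup>+z. ?f z \<partial>\<sigma>) = ennreal (measure \<sigma> UNIV - (\<integral>z. cos (u \<bullet> z) \<partial>\<sigma>))"
  proof -
    have "(\<integral>\<^sup>+z. ?f z \<partial>\<sigma>) = ennreal (\<integral>z. 1 - cos (u \<bullet> z) \<partial>\<sigma>)"
      using i by (intro nn_integral_eq_integral) auto
    then show ?thesis using i by (simp add: sp)
  qed
  moreover have "0 \<le> measure \<sigma> UNIV - (\<integral>z. cos (u \<bullet> z) \<partial>\<sigma>)"
  proof -
    have "0 \<le> (\<integral>z. 1 - cos (u \<bullet> z) \<partial>\<sigma>)" by (intro integral_nonneg_AE) auto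
    then show ?thesis using i by (simp add: sp)
  qed
  ultimately show ?thesis
    unfolding exp[OF b(1)] exp[OF b(2)] by (simp add: enn2real_plus)
qed

section \<open>Domination of laws, grid semigroups and killed semigroups\<close>

locale levy_pair =
  X: levy_domain MX X pX \<nu>X D + Y: levy_domain MY Y pY \<nu>Y D
  for MX :: "'b measure" and MY :: "'c measure"
    and X :: "real \<Rightarrow> 'b \<Rightarrow> 'a::euclidean_space" and Y :: "real \<Rightarrow> 'c \<Rightarrow> 'a"
    and pX pY :: "real \<Rightarrow> 'a \<Rightarrow> real" and \<nu>X \<nu>Y :: "'a measure" and D :: "'a set" +
  fixes \<sigma> :: "'a measure"
  assumes fin_sigma: "finite_measure \<sigma>" and sets_sigma: "sets \<sigma> = sets borel"
    and sum_sigma: "\<forall>A\<in>sets borel. emeasure \<nu>X A = emeasure \<nu>Y A + emeasure \<sigma> A"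
begin

definition L :: real where "L = measure \<sigma> UNIV"

lemma L_nonneg: "0 \<le> L" by (simp add: L_def)

text \<open>Adding \<sigma> to the Levy measure multiplies the characteristic function by
  \<open>exp (- h * (L - s))\<close>, where \<open>s\<close> is the cosine transform of \<sigma>;
  this is the hypothesis of \<open>fourier_domination\<close> with
  \<open>c = exp (L * h)\<close>.\<close>

lemma nn_integral_law_le:
  assumes h: "0 \<le> h" and [measurable]: "f \<in> borel_measurable borel"
  shows "(\<integral>\<^sup>+z. f z \<partial>Y.law h) \<le> ennreal (exp (L * h)) * (\<integral>\<^sup>+z. f z \<partial>X.law h)"
proof -
  interpret LX: prob_space "X.law h" by (rule X.prob_space_law) fact
  interpret LY: prob_space "Y.law h" by (rule Y.prob_space_law) fact
  have le: "emeasure (Y.law h) A \<le> ennreal (exp (L * h)) * emeasure (X.law h) A" if A: "A \<in> sets borel" for A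
  proof (rule fourier_domination[where \<sigma>=\<sigma> and t=h])
    fix u \<theta>
    have eq: "X.psi u = Y.psi u + (L - (\<integral>z. cos (u \<bullet> z) \<partial>\<sigma>))"
      unfolding L_def using X.triplet Y.triplet
      by (intro levy_exponent_add fin_sigma sets_sigma sum_sigma) (auto simp: has_triplet_0_nu_0_def)
    have "exp (L * h) * exp (- h * X.psi u) = exp (h * (\<integral>z. cos (u \<bullet> z) \<partial>\<sigma>)) * exp (- h * Y.psi u)"
      unfolding exp_add[symmetric] eq by (simp add: algebra_simps)
    then show "exp (L * h) * (\<integral>x. cos (u \<bullet> x + \<theta>) \<partial>X.law h) =
      exp (h * (\<integral>z. cos (u \<bullet> z) \<partial>\<sigma>)) * (\<integral>x. cos (u \<bullet> x + \<theta>) \<partial>Y.law h)"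
      unfolding X.integral_cos_law[OF h] Y.integral_cos_law[OF h] by (simp add: mult.left_commute)
  qed (use h A fin_sigma sets_sigma LX.finite_measure_axioms LY.finite_measure_axioms in auto)
  have "(\<integral>\<^sup>+z. f z \<partial>Y.law h) \<le> (\<integral>\<^sup>+z. f z \<partial>scale_measure (ennreal (exp (L * h))) (X.law h))"
    by (rule nn_integral_mono_measure) (use le in \<open>auto simp: le_measure\<close>)
  also have "\<dots> = ennreal (exp (L * h)) * (\<integral>\<^sup>+z. f z \<partial>X.law h)"
    by (rule nn_integral_scale_measure) measurable
  finally show ?thesis .
qed

text \<open>Each step costs a factor \<open>exp (L * h)\<close>, so the total cost depends only on
  the elapsed time \<open>n * h\<close> and survives refinement of the grid.\<close>

lemma W_le:
  assumes h: "0 \<le> h" and [measurable]: "g \<in> borel_measurable borel"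
  shows "Y.W k h n g x \<le> ennreal (exp (L * (real n * h))) * X.W k h n g x"
proof (induction n arbitrary: x)
  case 0
  then show ?case by (simp add: X.W_def Y.W_def)
next
  case (Suc n)
  let ?c = "ennreal (exp (L * (real n * h)))"
  have mX[measurable]: "X.W k h n g \<in> borel_measurable borel" using h by measurable
  have "Y.W k h (Suc n) g x = Y.T k h (Y.W k h n g) x" by (simp add: Y.W_def)
  also have "\<dots> \<le> Y.T k h (\<lambda>y. ?c * X.W k h n g y) x" by (rule Y.T_mono) (rule Suc.IH)
  also have "\<dots> = ?c * Y.T k h (X.W k h n g) x" by (rule Y.T_cmult[OF h mX])
  also have "\<dots> \<le> ?c * (ennreal (exp (L * h)) * X.T k h (X.W k h n g) x)"
  proof (rule mult_left_mono)
    have "Y.T k h (X.W k h n g) x \<le> indicator (X.F k) x * (ennreal (exp (L * h)) * (\<integral>\<^sup>+z. X.W k h n g (x + z) * indicator (X.F k) (x + z) \<partial>X.law h))"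
      unfolding Y.T_def by (rule mult_left_mono[OF nn_integral_law_le[OF h]]) auto
    then show "Y.T k h (X.W k h n g) x \<le> ennreal (exp (L * h)) * X.T k h (X.W k h n g) x"
      unfolding X.T_def by (simp add: mult.left_commute)
  qed simp
  also have "\<dots> = ennreal (exp (L * (real (Suc n) * h))) * X.W k h (Suc n) g x"
  proof -
    have "?c * ennreal (exp (L * h)) = ennreal (exp (L * (real (Suc n) * h)))"
      by (simp add: ennreal_mult'[symmetric] exp_add[symmetric] algebra_simps)
    then show ?thesis by (simp add: X.W_def mult.assoc[symmetric])
  qed
  finally show ?case .
qed

lemma Q_le:
  assumes t: "0 \<le> t" and [measurable]: "g \<in> borel_measurable borel" and g1: "\<And>y. g y \<le> 1"
  shows "Y.Q t x g \<le> ennreal (exp (L * t)) * X.Q t x g"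
proof -
  \<comment> \<open>Multiplying by the inverse factor first reduces the claim to a lower bound for
    an infimum, so the constant never has to be pulled out of it.\<close>
  let ?e = "ennreal (exp (L * t))" and ?e' = "ennreal (exp (- (L * t)))"
  have e: "?e * ?e' = 1" by (simp add: ennreal_mult'[symmetric] exp_minus)
  have "(INF n. Y.W k (t / 2 ^ n) (2 ^ n) g x) \<le> ?e * (INF n. X.W k (t / 2 ^ n) (2 ^ n) g x)" for k
  proof -
    have "?e' * (INF n. Y.W k (t / 2 ^ n) (2 ^ n) g x) \<le> (INF n. X.W k (t / 2 ^ n) (2 ^ n) g x)"
    proof (rule INF_greatest)
      fix n :: nat
      have "(INF n. Y.W k (t / 2 ^ n) (2 ^ n) g x) \<le> Y.W k (t / 2 ^ n) (2 ^ n) g x" by (rule INF_lower) simp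
      also have "\<dots> \<le> ?e * X.W k (t / 2 ^ n) (2 ^ n) g x"
        using W_le[of "t / 2 ^ n" g k "2 ^ n" x] t by simp
      finally have "?e' * (INF n. Y.W k (t / 2 ^ n) (2 ^ n) g x) \<le> ?e' * (?e * X.W k (t / 2 ^ n) (2 ^ n) g x)"
        by (rule mult_left_mono) simp
      also have "\<dots> = (?e * ?e') * X.W k (t / 2 ^ n) (2 ^ n) g x" by (simp only: mult_ac)
      finally show "?e' * (INF n. Y.W k (t / 2 ^ n) (2 ^ n) g x) \<le> X.W k (t / 2 ^ n) (2 ^ n) g x"
        unfolding e by simp
    qed
    then have "?e * (?e' * (INF n. Y.W k (t / 2 ^ n) (2 ^ n) g x)) \<le> ?e * (INF n. X.W k (t / 2 ^ n) (2 ^ n) g x)"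
      by (rule mult_left_mono) simp
    then show ?thesis unfolding mult.assoc[symmetric] e by simp
  qed
  then show ?thesis
    unfolding X.Q_eq_SUP_INF[OF assms] Y.Q_eq_SUP_INF[OF assms] SUP_mult_left_ennreal
    by (rule SUP_mono')
qed

text \<open>The escape estimate for Y reduces its mean exit time to the survival up to
  \<open>s0\<close>, where \<open>exp (L * t)\<close> is at most
  \<open>exp (L * s0)\<close>.\<close>

lemma mean_exit_le: obtains C :: real where "0 \<le> C" "\<And>x. Y.mean_exit x \<le> ennreal C * X.mean_exit x"
proof -
  obtain q s0 :: real where q: "0 \<le> q" "q < 1" "0 < s0"
    "\<And>x. x \<in> D \<Longrightarrow> (\<integral>\<^sup>+z. indicator D (x + z) \<partial>Y.law s0) \<le> ennreal q"
    using Y.escape by blast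
  let ?C = "1 / (1 - q) * exp (L * s0)"
  have "Y.mean_exit x \<le> ennreal ?C * X.mean_exit x" for x
  proof -
    have "Y.mean_exit x \<le> ennreal (1 / (1 - q)) * (\<integral>\<^sup>+t. Y.Q t x (\<lambda>_. 1) * indicator {0<..s0} t \<partial>lborel)"
      by (rule Y.mean_exit_le_short_time[OF q])
    also have "(\<integral>\<^sup>+t. Y.Q t x (\<lambda>_. 1) * indicator {0<..s0} t \<partial>lborel) \<le> (\<integral>\<^sup>+t. ennreal (exp (L * s0)) * (X.Q t x (\<lambda>_. 1) * indicator {0<..} t) \<partial>lborel)"
    proof (rule nn_integral_mono)
      fix t :: real
      show "Y.Q t x (\<lambda>_. 1) * indicator {0<..s0} t \<le> ennreal (exp (L * s0)) * (X.Q t x (\<lambda>_. 1) * indicator {0<..} t)"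
      proof (cases "0 < t \<and> t \<le> s0")
        case True
        then have "Y.Q t x (\<lambda>_. 1) \<le> ennreal (exp (L * t)) * X.Q t x (\<lambda>_. 1)" by (intro Q_le) auto
        also have "\<dots> \<le> ennreal (exp (L * s0)) * X.Q t x (\<lambda>_. 1)"
          using True L_nonneg by (intro mult_right_mono ennreal_leI) (auto intro: mult_left_mono)
        finally show ?thesis using True by simp
      qed (auto simp: indicator_def)
    qed
    also have "\<dots> = ennreal (exp (L * s0)) * X.mean_exit x"
      unfolding X.mean_exit_eq_integral_Q by (rule nn_integral_cmult) measurable
    finally have "Y.mean_exit x \<le> ennreal (1 / (1 - q)) * (ennreal (exp (L * s0)) * X.mean_exit x)"
      by (simp add: mult_left_mono)
    also have "\<dots> = ennreal ?C * X.mean_exit x"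
      using q(2) by (subst ennreal_mult') (auto simp: mult.assoc)
    finally show ?thesis .
  qed
  moreover have "0 \<le> ?C" using q(2) by simp
  ultimately show thesis using that by blast
qed

lemma green_bound:
  obtains B :: real where "0 \<le> B"
    "\<And>x t0. x \<in> D \<Longrightarrow> 3 \<le> t0 \<Longrightarrow> AE y in lborel. green MY Y pY D x y \<le>
       ennreal (exp (L * t0)) * green MX X pX D x y + ennreal (B / t0) * (Y.mean_exit x * Y.mean_exit y)"
proof -
  obtain B where B: "0 \<le> B"
    "\<And>s g x. 1 \<le> s \<Longrightarrow> g \<in> borel_measurable borel \<Longrightarrow> (\<integral>\<^sup>+\<omega>. g (x + Y s \<omega>) \<partial>MY) \<le> ennreal B * (\<integral>\<^sup>+z. g z \<partial>lborel)"
    using Y.transition_bound by blast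
  have "AE y in lborel. green MY Y pY D x y \<le>
       ennreal (exp (L * t0)) * green MX X pX D x y + ennreal (9 * B / t0) * (Y.mean_exit x * Y.mean_exit y)"
    if x: "x \<in> D" and t0: "3 \<le> t0" for x t0
  proof -
    note [measurable (raw)] = X.killed_density_measurable[OF x] Y.killed_density_measurable[OF x]
    let ?gX = "\<lambda>t y. ennreal (killed_density MX X pX D t x y)"
    let ?gY = "\<lambda>t y. ennreal (killed_density MY Y pY D t x y)"
    let ?b = "\<lambda>t y. ennreal (9 * B / t\<^sup>2) * (Y.mean_exit x * Y.mean_exit y)"
    have "AE t in lborel. AE y in lborel. (0 < t \<longrightarrow> ?gY t y \<le> ennreal (exp (L * t)) * ?gX t y) \<and> (3 \<le> t \<longrightarrow> ?gY t y \<le> ?b t y)"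
      using X.killed_density_Q[OF x] Y.killed_density_Q[OF x]
    proof eventually_elim
      case (elim t)
      have 1: "AE y in lborel. ?gY t y \<le> ennreal (exp (L * t)) * ?gX t y" if t: "0 < t"
      proof (rule lborel.AE_le_if_set_nn_integral_le)
        fix A :: "'a set" assume "A \<in> sets lborel"
        then have A[measurable]: "A \<in> sets borel" by simp
        have "(\<integral>\<^sup>+y. ?gY t y * indicator A y \<partial>lborel) = Y.Q t x (indicator A)" using elim(2) t A by blast
        also have "\<dots> \<le> ennreal (exp (L * t)) * X.Q t x (indicator A)"
          using t by (intro Q_le) (auto simp: indicator_def)
        also have "X.Q t x (indicator A) = (\<integral>\<^sup>+y. ?gX t y * indicator A y \<partial>lborel)" using elim(1) t A by simp
        also have "ennreal (exp (L * t)) * \<dots> = (\<integral>\<^sup>+y. ennreal (exp (L * t)) * (?gX t y * indicator A y) \<partial>lborel)"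
          by (rule nn_integral_cmult[symmetric]) measurable
        finally show "(\<integral>\<^sup>+y. ?gY t y * indicator A y \<partial>lborel) \<le> (\<integral>\<^sup>+y. ennreal (exp (L * t)) * ?gX t y * indicator A y \<partial>lborel)"
          by (simp only: mult.assoc)
      qed measurable
      have 2: "AE y in lborel. ?gY t y \<le> ?b t y" if t: "3 \<le> t"
      proof -
        \<comment> \<open>The assumption \<open>3 \<le> t\<close> makes the middle third at least 1
          long, as the density bound requires. Markov's inequality on the two outer thirds gives
          \<open>(3 / t)^2\<close>, whence the 9.\<close>
        let ?s = "t / 3"
        have "AE y in lborel. ?gY t y \<le> ennreal B * Y.Q ?s x (\<lambda>_. 1) * Y.Q ?s y (\<lambda>_. 1)"
        proof (rule lborel.AE_le_if_set_nn_integral_le)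
          fix A :: "'a set" assume "A \<in> sets lborel"
          then have A[measurable]: "A \<in> sets borel" by simp
          have "(\<integral>\<^sup>+y. ?gY t y * indicator A y \<partial>lborel) = Y.Q (3 * ?s) x (indicator A)" using elim(2) t A by simp
          also have "\<dots> \<le> (\<integral>\<^sup>+y. ennreal B * Y.Q ?s x (\<lambda>_. 1) * Y.Q ?s y (\<lambda>_. 1) * indicator A y \<partial>lborel)"
            by (rule Y.Q_three_step) (use B(2) t in auto)
          finally show "(\<integral>\<^sup>+y. ?gY t y * indicator A y \<partial>lborel) \<le> (\<integral>\<^sup>+y. ennreal B * Y.Q ?s x (\<lambda>_. 1) * Y.Q ?s y (\<lambda>_. 1) * indicator A y \<partial>lborel)" .
        qed measurable
        then show ?thesis
        proof eventually_elim
          case (elim y)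
          also have "ennreal B * Y.Q ?s x (\<lambda>_. 1) * Y.Q ?s y (\<lambda>_. 1) \<le> ennreal B * (ennreal (1 / ?s) * Y.mean_exit x) * (ennreal (1 / ?s) * Y.mean_exit y)"
            using t by (intro mult_mono Y.Q_le_mean_exit order_refl) auto
          also have "\<dots> = (ennreal B * (ennreal (1 / ?s) * ennreal (1 / ?s))) * (Y.mean_exit x * Y.mean_exit y)" by (simp only: mult_ac)
          also have "ennreal B * (ennreal (1 / ?s) * ennreal (1 / ?s)) = ennreal (9 * B / t\<^sup>2)"
            using t B(1) by (simp add: ennreal_mult'[symmetric] power2_eq_square mult.commute)
          finally show ?case .
        qed
      qed
      \<comment> \<open>The conditions on \<open>t\<close> do not involve \<open>y\<close>, so they
        are decided outside the quantifier over \<open>y\<close>.\<close>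
      have "0 < t \<or> \<not> 0 < t" "3 \<le> t \<or> \<not> 3 \<le> t" by auto
      then show ?case using 1 2 by auto
    qed
    \<comment> \<open>The exceptional \<open>y\<close> so far depend on \<open>t\<close>; exchanging
      the quantifiers yields, for almost every \<open>y\<close>, an estimate at almost every time,
      which can be integrated.\<close>
    then have "AE y in lborel. AE t in lborel. (0 < t \<longrightarrow> ?gY t y \<le> ennreal (exp (L * t)) * ?gX t y) \<and> (3 \<le> t \<longrightarrow> ?gY t y \<le> ?b t y)"
      by (subst (asm) lborel_pair.AE_commute) measurable
    then show ?thesis
    proof eventually_elim
      case (elim y)
      have "green MY Y pY D x y \<le> (\<integral>\<^sup>+t. ennreal (exp (L * t0)) * (?gX t y * indicator {0<..} t) + (Y.mean_exit x * Y.mean_exit y) * (ennreal (9 * B / t\<^sup>2) * indicator {t0..} t) \<partial>lborel)"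
        unfolding green_def
      proof (rule nn_integral_mono_AE)
        show "AE t in lborel. ?gY t y * indicator {0<..} t \<le> ennreal (exp (L * t0)) * (?gX t y * indicator {0<..} t) + (Y.mean_exit x * Y.mean_exit y) * (ennreal (9 * B / t\<^sup>2) * indicator {t0..} t)"
          using elim
        proof eventually_elim
          case (elim t)
          show ?case
          proof (cases "0 < t")
            case pos: True
            show ?thesis
            proof (cases "t < t0")
              case True
              have "?gY t y \<le> ennreal (exp (L * t)) * ?gX t y" using elim pos by simp
              also have "\<dots> \<le> ennreal (exp (L * t0)) * ?gX t y"
                using True L_nonneg by (intro mult_right_mono ennreal_leI) (auto intro: mult_left_mono)
              finally show ?thesis using True pos by simp
            next
              case False
              then have "?gY t y \<le> ?b t y" using elim t0 by simp
              then show ?thesis using False pos by (simp add: mult.commute add_increasing)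
            qed
          qed simp
        qed
      qed
      also have "\<dots> = (\<integral>\<^sup>+t. ennreal (exp (L * t0)) * (?gX t y * indicator {0<..} t) \<partial>lborel) + (\<integral>\<^sup>+t. (Y.mean_exit x * Y.mean_exit y) * (ennreal (9 * B / t\<^sup>2) * indicator {t0..} t) \<partial>lborel)"
        by (rule nn_integral_add) measurable
      also have "(\<integral>\<^sup>+t. ennreal (exp (L * t0)) * (?gX t y * indicator {0<..} t) \<partial>lborel) = ennreal (exp (L * t0)) * green MX X pX D x y"
        unfolding green_def by (rule nn_integral_cmult) measurable
      also have "(\<integral>\<^sup>+t. (Y.mean_exit x * Y.mean_exit y) * (ennreal (9 * B / t\<^sup>2) * indicator {t0..} t) \<partial>lborel) = (Y.mean_exit x * Y.mean_exit y) * (\<integral>\<^sup>+t. ennreal (9 * B / t\<^sup>2) * indicator {t0..} t \<partial>lborel)"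
        by (rule nn_integral_cmult) measurable
      also have "(\<integral>\<^sup>+t. ennreal (9 * B / t\<^sup>2) * indicator {t0..} t \<partial>lborel) = ennreal (0 - (- (9 * B) / t0))"
      proof (rule nn_integral_FTC_atLeast)
        show "((\<lambda>t. - (9 * B) / t) \<longlongrightarrow> 0) at_top" by (intro tendsto_divide_0[OF tendsto_const] filterlim_at_top_imp_at_infinity filterlim_ident)
        fix t assume "t0 \<le> t"
        then have "t \<noteq> 0" using t0 by simp
        then show "((\<lambda>t. - (9 * B) / t) has_real_derivative 9 * B / t\<^sup>2) (at t)"
          by (auto intro!: derivative_eq_intros simp: power2_eq_square)
        show "0 \<le> 9 * B / t\<^sup>2" using B(1) by simp
      qed auto
      finally show ?case by (simp add: mult.commute)
    qed
  qed
  then show thesis using that[of "9 * B"] B(1) by simp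
qed

lemma green_le:
  assumes "property_A MX X pX D \<or> property_A MY Y pY D"
  shows "\<exists>C::real. \<forall>x\<in>D. AE y in lborel. green MY Y pY D x y \<le> ennreal C * green MX X pX D x y"
proof -
  obtain B :: real where B: "0 \<le> B"
    "\<And>x t0. x \<in> D \<Longrightarrow> 3 \<le> t0 \<Longrightarrow> AE y in lborel. green MY Y pY D x y \<le>
       ennreal (exp (L * t0)) * green MX X pX D x y + ennreal (B / t0) * (Y.mean_exit x * Y.mean_exit y)"
    using green_bound by blast
  from assms show ?thesis
  proof
    assume "property_A MX X pX D"
    then obtain c where c: "\<And>x y. x \<in> D \<Longrightarrow> y \<in> D \<Longrightarrow> X.mean_exit x * X.mean_exit y \<le> ennreal c * green MX X pX D x y"
      unfolding property_A_def using X.expected_exit_eq_mean_exit by metis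
    obtain C where C: "0 \<le> C" "\<And>x. Y.mean_exit x \<le> ennreal C * X.mean_exit x" using mean_exit_le by blast
    show ?thesis
    \<comment> \<open>Nothing has to be absorbed here, so time is split at the smallest admissible
      point, 3. The factor \<open>C * C\<close> comes from comparing both mean exit times, and
      \<open>max 0 c\<close> is there because Property A leaves the sign of its constant
      open.\<close>
    proof (intro exI[of _ "exp (L * 3) + B / 3 * (C * C) * max 0 c"] ballI)
      fix x assume x: "x \<in> D"
      show "AE y in lborel. green MY Y pY D x y \<le> ennreal (exp (L * 3) + B / 3 * (C * C) * max 0 c) * green MX X pX D x y"
        using B(2)[OF x order_refl]
      proof eventually_elim
        case (elim y)
        have "Y.mean_exit x * Y.mean_exit y \<le> (ennreal C * X.mean_exit x) * (ennreal C * X.mean_exit y)" by (intro mult_mono C) auto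
        also have "\<dots> = ennreal (C * C) * (X.mean_exit x * X.mean_exit y)" using C(1) by (simp add: ennreal_mult mult_ac)
        also have "\<dots> \<le> ennreal (C * C) * (ennreal (max 0 c) * green MX X pX D x y)"
        proof (rule mult_left_mono)
          show "X.mean_exit x * X.mean_exit y \<le> ennreal (max 0 c) * green MX X pX D x y"
          proof (cases "y \<in> D")
            case True
            have "X.mean_exit x * X.mean_exit y \<le> ennreal c * green MX X pX D x y" by (rule c[OF x True])
            also have "\<dots> \<le> ennreal (max 0 c) * green MX X pX D x y" by (intro mult_right_mono ennreal_leI) auto
            finally show ?thesis .
          qed (simp add: X.mean_exit_outside)
        qed simp
        finally have "ennreal (B / 3) * (Y.mean_exit x * Y.mean_exit y) \<le> ennreal (B / 3) * (ennreal (C * C) * (ennreal (max 0 c) * green MX X pX D x y))"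
          by (rule mult_left_mono) simp
        also have "\<dots> = ennreal (B / 3 * (C * C) * max 0 c) * green MX X pX D x y"
        proof -
          have "ennreal (B / 3 * (C * C) * max 0 c) = ennreal (B / 3) * ennreal (C * C) * ennreal (max 0 c)"
            using B(1) C(1) by (subst ennreal_mult, simp, simp, subst ennreal_mult) auto
          then show ?thesis by (simp only: mult.assoc)
        qed
        finally have "green MY Y pY D x y \<le> ennreal (exp (L * 3)) * green MX X pX D x y + ennreal (B / 3 * (C * C) * max 0 c) * green MX X pX D x y"
          using elim by (meson add_left_mono order_trans)
        also have "\<dots> = ennreal (exp (L * 3) + B / 3 * (C * C) * max 0 c) * green MX X pX D x y"
          using B(1) C(1) by (subst ennreal_plus) (auto simp: distrib_right)
        finally show ?case .
      qed
    qed
  next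
    assume "property_A MY Y pY D"
    then obtain c where c: "\<And>x y. x \<in> D \<Longrightarrow> y \<in> D \<Longrightarrow> Y.mean_exit x * Y.mean_exit y \<le> ennreal c * green MY Y pY D x y"
      unfolding property_A_def using Y.expected_exit_eq_mean_exit by metis
    \<comment> \<open>Large enough that the coefficient \<open>B / t0 * max 0 c\<close>, with which
      the Green function of Y reappears on the right, is at most 1/2.\<close>
    define t0 where "t0 = 3 + 2 * B * max 0 c"
    have t0: "3 \<le> t0" using B(1) by (simp add: t0_def)
    have half: "B / t0 * max 0 c \<le> 1 / 2"
    proof -
      have "B * max 0 c \<le> 1 / 2 * t0" by (simp add: t0_def)
      then have "B * max 0 c / t0 \<le> 1 / 2" using t0 by (subst pos_divide_le_eq) auto
      then show ?thesis by simp
    qed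
    show ?thesis
    proof (intro exI[of _ "2 * exp (L * t0)"] ballI)
      fix x assume x: "x \<in> D"
      show "AE y in lborel. green MY Y pY D x y \<le> ennreal (2 * exp (L * t0)) * green MX X pX D x y"
        \<comment> \<open>Half of the Green function is to be subtracted from both sides, so it must
          be finite at the point considered.\<close>
        using B(2)[OF x t0] Y.green_finite[OF x]
      proof eventually_elim
        case (elim y)
        let ?G = "green MY Y pY D x y" and ?H = "ennreal (exp (L * t0)) * green MX X pX D x y"
        have "ennreal (B / t0) * (Y.mean_exit x * Y.mean_exit y) \<le> ennreal (B / t0) * (ennreal (max 0 c) * ?G)"
        proof (rule mult_left_mono)
          show "Y.mean_exit x * Y.mean_exit y \<le> ennreal (max 0 c) * ?G"
          proof (cases "y \<in> D")
            case True
            have "Y.mean_exit x * Y.mean_exit y \<le> ennreal c * ?G" by (rule c[OF x True])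
            also have "\<dots> \<le> ennreal (max 0 c) * ?G" by (intro mult_right_mono ennreal_leI) auto
            finally show ?thesis .
          qed (simp add: Y.mean_exit_outside)
        qed simp
        also have "\<dots> = ennreal (B / t0 * max 0 c) * ?G"
          using B(1) t0 by (subst ennreal_mult[of "B / t0"]) (auto simp: mult.assoc)
        also have "\<dots> \<le> ennreal (1 / 2) * ?G" by (intro mult_right_mono ennreal_leI half) simp
        finally have le: "?G \<le> ?H + ennreal (1 / 2) * ?G"
          using elim(1) by (meson add_left_mono order_trans)
        have "?G \<le> 2 * ?H"
        proof (cases "?H < top")
          case True
          obtain g where g: "0 \<le> g" "?G = ennreal g" using elim(2) by (cases ?G) auto
          obtain h where h: "0 \<le> h" "?H = ennreal h" using True by (cases ?H) auto
          have e: "ennreal (1 / 2) * ennreal g = ennreal (1 / 2 * g)" by (rule ennreal_mult'[symmetric]) simp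
          have "ennreal g \<le> ennreal h + ennreal (1 / 2 * g)" using le unfolding g(2) h(2) e .
          also have "\<dots> = ennreal (h + 1 / 2 * g)" using g(1) h(1) by (intro ennreal_plus[symmetric]) auto
          finally have "g \<le> h + 1 / 2 * g" using g(1) h(1) by (simp add: ennreal_le_iff del: ennreal_plus)
          then have "ennreal g \<le> ennreal (2 * h)" by (intro ennreal_leI) simp
          then show ?thesis unfolding g(2) h(2) using h(1) by (simp add: ennreal_mult')
        next
          case False
          then show ?thesis by (simp add: not_less top_unique ennreal_mult_eq_top_iff)
        qed
        then show ?case by (simp add: ennreal_mult' mult.assoc)
      qed
    qed
  qed
qed

end

theorem mainTheorem10:
  fixes MX :: "'b measure" and MY :: "'c measure"
    and X :: "real \<Rightarrow> 'b \<Rightarrow> 'a::euclidean_space" and Y :: "real \<Rightarrow> 'c \<Rightarrow> 'a"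
    and pX pY :: "real \<Rightarrow> 'a \<Rightarrow> real"
    and \<nu>X \<nu>Y \<sigma> :: "'a measure" and D :: "'a set"
  assumes "levy_process MX X" and "levy_process MY Y"
    and "has_triplet_0_nu_0 MX X \<nu>X" and "has_triplet_0_nu_0 MY Y \<nu>Y"
    and "emeasure \<nu>X (space \<nu>X) \<noteq> 0" and "emeasure \<nu>Y (space \<nu>Y) \<noteq> 0"
    and "bounded_transition_density MX X pX" and "bounded_transition_density MY Y pY"
    and "open D" and "bounded D"
    and "finite_measure \<sigma>" and "sets \<sigma> = sets borel"
    and "\<forall>A\<in>sets borel. emeasure \<nu>X A = emeasure \<nu>Y A + emeasure \<sigma> A"
    and "property_A MX X pX D \<or> property_A MY Y pY D"
  shows "\<exists>C::real. \<forall>x\<in>D. AE y in lborel. green MY Y pY D x y \<le> ennreal C * green MX X pX D x y"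
proof -
  interpret levy_pair MX MY X Y pX pY \<nu>X \<nu>Y D \<sigma>
    by (intro levy_pair.intro levy_domain.intro levy_pair_axioms.intro assms)
  show ?thesis by (rule green_le[OF assms(14)])
qed

end
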